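(* Let $n\ge1$, let $f\colon\mathbb{D}\to\mathbb{D}$ be holomorphic, and let $F_f\colon\mathbb{G}_n\to\mathbb{G}_n$ be the induced self-map of the symmetrized polydisc. Then $$F_f^*g_n\le n\,g_n .$$ If $B$ is a finite Blaschke product of degree $d\ge1$, then $$F_B^*g_n\le\min\{n,d\}\,g_n .$$ The constants are sharp: for each $n\ge1$, there is no real $C<n$ such that $F_f^*g_n\le C\,g_n$ on $\mathbb{G}_n$ for all holomorphic $f\colon\mathbb{D}\to\mathbb{D}$; and for each $n,d\ge1$, there is no real $C<\min\{n,d\}$ such that $F_B^*g_n\le C\,g_n$ on $\mathbb{G}_n$ for all finite Blaschke products $B$ of degree $d$.
   Context: $\mathbb{D}$ is the open unit disk in $\mathbb{C}$. Let $\pi_n(Z)=(\sigma_1(Z),\ldots,\sigma_n(Z))$, where $\sigma_k(Z)=\sum_{1\le i_1<\cdots<i_k\le n}z_{i_1}\cdots z_{i_k}$ is the $k$th elementary symmetric polynomial. The symmetrized polydisc is $\mathbb{G}_n=\pi_n(\mathbb{D}^n)$, a domain in $\mathbb{C}^n$. Let $S_n$ be the Szegő kernel of $\mathbb{G}_n$; it is the function on $\mathbb{G}_n\times\mathbb{G}_n$, holomorphic in the first and antiholomorphic in the second variable, determined by $$S_n(\pi_n(Z),\pi_n(W))=\prod_{i,j=1}^n\frac{1}{1-z_i\overline{w_j}},\qquad Z,W\in\mathbb{D}^n$$ (this known formula may be taken as the definition of $S_n$). The Hermitian metric $g_n$ on $\mathbb{G}_n$ has, in the coordinates $u=(u_1,\ldots,u_n)\in\mathbb{G}_n$,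 the matrix $$[g_n(u)]_{\alpha\beta}=\frac{\partial^2}{\partial u_\beta\,\partial\overline{u_\alpha}}\log S_n(u,u),$$ so that $v\in\mathbb{C}^n$ has squared length $v^*g_n(u)v$ at $u$. For a holomorphic map $F\colon\mathbb{G}_n\to\mathbb{G}_n$ with complex Jacobian matrix $DF$, the pullback $F^*g_n$ is the Hermitian form with matrix $DF(u)^*\,g_n(F(u))\,DF(u)$ at $u$. An inequality $F^*g_n\le C\,g_n$ means that at every $u\in\mathbb{G}_n$ the matrix $C\,g_n(u)-DF(u)^*g_n(F(u))DF(u)$ is positive semidefinite. A holomorphic $f\colon\mathbb{D}\to\mathbb{D}$ induces a well-defined holomorphic map $F_f\colon\mathbb{G}_n\to\mathbb{G}_n$ by $F_f(\pi_n(z_1,\ldots,z_n))=\pi_n(f(z_1),\ldots,f(z_n))$. A finite Blaschke product of degree $d$ is a function $B(z)=e^{i\theta}\prod_{k=1}^d\frac{z-a_k}{1-\overline{a_k}z}$ with $\theta\in\mathbb{R}$ and $a_1,\ldots,a_d\in\mathbb{D}$ (repetitions allowed). *)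

theory Defs
  imports
    "HOL-Complex_Analysis.Complex_Analysis"
    "Jordan_Normal_Form.Schur_Decomposition"
begin

unbundle no vec_syntax
no_notation fps_nth (infixl "$" 75)

text \<open>Points of $n$-dimensional complex space are elements of \<open>carrier_vec n\<close>. Indices
  start at 0, so entry \<open>k\<close> of \<open>sym_map n Z\<close> is the elementary symmetric polynomial of
  degree \<open>k + 1\<close>.\<close>

definition esym :: "nat \<Rightarrow> complex Matrix.vec \<Rightarrow> complex" where
  "esym k Z = (\<Sum>I \<in> {I. I \<subseteq> {..<dim_vec Z} \<and> card I = k}. \<Prod>i\<in>I. Z $ i)"

definition sym_map :: "nat \<Rightarrow> complex Matrix.vec \<Rightarrow> complex Matrix.vec" where
  "sym_map n Z = Matrix.vec n (\<lambda>k. esym (k + 1) Z)"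

definition polydisc :: "nat \<Rightarrow> complex Matrix.vec set" where
  "polydisc n = {Z \<in> carrier_vec n. \<forall>i<n. Z $ i \<in> ball 0 1}"

definition sym_polydisc :: "nat \<Rightarrow> complex Matrix.vec set" where
  "sym_polydisc n = sym_map n ` polydisc n"

text \<open>An arbitrary preimage under \<open>sym_map n\<close>. It is unique up to permutation of the
  entries, so the two definitions below do not depend on the choice; see \<open>szego_sym_map\<close> and
  \<open>induced_map_sym_map\<close>.\<close>

definition desym :: "nat \<Rightarrow> complex Matrix.vec \<Rightarrow> complex Matrix.vec" where
  "desym n = inv_into (polydisc n) (sym_map n)"

definition szego :: "nat \<Rightarrow> complex Matrix.vec \<Rightarrow> complex Matrix.vec \<Rightarrow> complex" where
  "szego n u v = (\<Prod>i<n. \<Prod>j<n. 1 / (1 - desym n u $ i * cnj (desym n v $ j)))"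

definition induced_map ::
    "nat \<Rightarrow> (complex \<Rightarrow> complex) \<Rightarrow> complex Matrix.vec \<Rightarrow> complex Matrix.vec" where
  "induced_map n f u = sym_map n (map_vec f (desym n u))"

definition coord_line :: "complex Matrix.vec \<Rightarrow> nat \<Rightarrow> complex \<Rightarrow> complex Matrix.vec" where
  "coord_line u k t = u + t \<cdot>\<^sub>v unit_vec (dim_vec u) k"

text \<open>The Wirtinger derivatives in coordinate \<open>k\<close>, that is
  $\frac12(\partial_x - i\,\partial_y)$ and $\frac12(\partial_x + i\,\partial_y)$ where
  $u_k = x + iy$.\<close>

definition wirt ::
    "nat \<Rightarrow> (complex Matrix.vec \<Rightarrow> complex) \<Rightarrow> complex Matrix.vec \<Rightarrow> complex" where
  "wirt k h u =
    (vector_derivative (\<lambda>x. h (coord_line u k (complex_of_real x))) (at 0)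
      - \<i> * vector_derivative (\<lambda>y. h (coord_line u k (\<i> * complex_of_real y))) (at 0)) / 2"

definition wirt_bar ::
    "nat \<Rightarrow> (complex Matrix.vec \<Rightarrow> complex) \<Rightarrow> complex Matrix.vec \<Rightarrow> complex" where
  "wirt_bar k h u =
    (vector_derivative (\<lambda>x. h (coord_line u k (complex_of_real x))) (at 0)
      + \<i> * vector_derivative (\<lambda>y. h (coord_line u k (\<i> * complex_of_real y))) (at 0)) / 2"

text \<open>On \<open>sym_polydisc n\<close> the number \<open>szego n u u\<close> is a positive real (\<open>szego_diag_pos\<close>), so
  the principal branch \<open>Ln\<close> is its real logarithm.\<close>

definition szego_metric :: "nat \<Rightarrow> complex Matrix.vec \<Rightarrow> complex Matrix.mat" where
  "szego_metric n u =
    Matrix.mat n n (\<lambda>(\<alpha>, \<beta>). wirt \<beta> (wirt_bar \<alpha> (\<lambda>w. Ln (szego n w w))) u)"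

definition jacobian ::
    "nat \<Rightarrow> (complex Matrix.vec \<Rightarrow> complex Matrix.vec) \<Rightarrow> complex Matrix.vec \<Rightarrow> complex Matrix.mat"
  where "jacobian n F u =
    Matrix.mat n n (\<lambda>(\<alpha>, \<beta>). deriv (\<lambda>t. F (coord_line u \<beta> t) $ \<alpha>) 0)"

definition pullback ::
    "nat \<Rightarrow> (complex Matrix.vec \<Rightarrow> complex Matrix.vec) \<Rightarrow> (complex Matrix.vec \<Rightarrow> complex Matrix.mat)
      \<Rightarrow> complex Matrix.vec \<Rightarrow> complex Matrix.mat" where
  "pullback n F g u = mat_adjoint (jacobian n F u) * g (F u) * jacobian n F u"

text \<open>The order on \<^typ>\<open>complex\<close> is that of \<^theory>\<open>HOL-Library.Complex_Order\<close>: the value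
  $v^*Av$ is required to be real and nonnegative, which makes \<open>A\<close> Hermitian.\<close>

definition pos_semidef :: "nat \<Rightarrow> complex Matrix.mat \<Rightarrow> bool" where
  "pos_semidef n A \<longleftrightarrow>
    A \<in> carrier_mat n n \<and> (\<forall>v \<in> carrier_vec n. 0 \<le> (A *\<^sub>v v) \<bullet>c v)"

definition pullback_metric_le ::
    "nat \<Rightarrow> (complex Matrix.vec \<Rightarrow> complex Matrix.vec) \<Rightarrow> real \<Rightarrow> bool" where
  "pullback_metric_le n F C \<longleftrightarrow>
    (\<forall>u \<in> sym_polydisc n. pos_semidef n
      (complex_of_real C \<cdot>\<^sub>m szego_metric n u - pullback n F (szego_metric n) u))"

definition disc_self_map :: "(complex \<Rightarrow> complex) \<Rightarrow> bool" where
  "disc_self_map f \<longleftrightarrow> f holomorphic_on ball 0 1 \<and> f ` ball 0 1 \<subseteq> ball 0 1"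

text \<open>Only the values on the unit disc matter.\<close>

definition finite_blaschke :: "nat \<Rightarrow> (complex \<Rightarrow> complex) \<Rightarrow> bool" where
  "finite_blaschke d B \<longleftrightarrow>
    (\<exists>(\<theta>::real) a. (\<forall>k<d. a k \<in> ball 0 1) \<and>
      (\<forall>z \<in> ball 0 1. B z = cis \<theta> * (\<Prod>k<d. (z - a k) / (1 - cnj (a k) * z))))"


lemma prod_linear_esym:
  assumes "Z \<in> carrier_vec n"
  shows "(\<Prod>i<n. x - Z $ i) = (\<Sum>k\<le>n. (-1) ^ k * esym k Z * x ^ (n - k))"
proof -
  have n: "dim_vec Z = n" using assms by simp
  have "(\<Prod>i<n. x - Z $ i) = (\<Prod>i<n. (- (Z $ i)) + x)"
    by simp
  also have "\<dots> = (\<Sum>I\<in>Pow {..<n}. (\<Prod>i\<in>I. - (Z $ i)) * (\<Prod>i\<in>{..<n} - I. x))"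
    by (rule prod_add) simp
  also have "\<dots> = (\<Sum>I\<in>Pow {..<n}. (-1) ^ card I * (\<Prod>i\<in>I. Z $ i) * x ^ (n - card I))"
  proof (rule sum.cong[OF refl])
    fix I assume "I \<in> Pow {..<n}"
    then have "I \<subseteq> {..<n}" "finite I" by (auto intro: finite_subset)
    moreover have "(\<Prod>i\<in>I. - (Z $ i)) = (-1) ^ card I * (\<Prod>i\<in>I. Z $ i)"
      by (rule prod_uminus)
    ultimately show "(\<Prod>i\<in>I. - (Z $ i)) * (\<Prod>i\<in>{..<n} - I. x)
        = (-1) ^ card I * (\<Prod>i\<in>I. Z $ i) * x ^ (n - card I)"
      by (simp add: card_Diff_subset)
  qed
  also have "\<dots> = (\<Sum>k\<le>n. \<Sum>I\<in>{I \<in> Pow {..<n}. card I = k}.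
      (-1) ^ card I * (\<Prod>i\<in>I. Z $ i) * x ^ (n - card I))"
    by (rule sum.group[symmetric])
      (auto intro: order_trans[OF card_mono[OF finite_lessThan]])
  also have "\<dots> = (\<Sum>k\<le>n. (-1) ^ k * esym k Z * x ^ (n - k))"
    unfolding esym_def n sum_distrib_left sum_distrib_right
    by (intro sum.cong) auto
  finally show ?thesis .
qed

lemma sym_map_eqD:
  assumes "Z \<in> carrier_vec n" "W \<in> carrier_vec n" "sym_map n Z = sym_map n W"
  shows "image_mset (($) Z) (mset_set {..<n}) = image_mset (($) W) (mset_set {..<n})"
proof -
  have e: "esym k Z = esym k W" if "k \<le> n" for k
  proof (cases k)
    case 0
    have "{I. I \<subseteq> {..<m} \<and> card I = 0} = {{}}" for m :: nat
      by (auto dest: finite_subset)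
    then show ?thesis using 0 by (simp add: esym_def)
  next
    case (Suc j)
    then have "sym_map n Z $ j = sym_map n W $ j" "j < n" using assms(3) that by simp_all
    then show ?thesis using Suc by (simp add: sym_map_def)
  qed
  define P where "P V = (\<Prod>i<n. [:- (V $ i), 1:])" for V :: "complex Matrix.vec"
  have roots: "proots (P V) = image_mset (($) V) (mset_set {..<n})" for V
  proof -
    have "proots (P V) = (\<Sum>i<n. {#V $ i#})"
      unfolding P_def by (subst proots_prod) auto
    also have "\<dots> = image_mset (($) V) (mset_set {..<n})"
      by (induction n) (auto simp: lessThan_Suc)
    finally show ?thesis .
  qed
  have "poly (P Z) x = poly (P W) x" for x
    using prod_linear_esym[OF assms(1), of x] prod_linear_esym[OF assms(2), of x] e
    by (simp add: P_def poly_prod)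
  then have "P Z = P W" by (simp add: poly_eq_poly_eq_iff[symmetric] fun_eq_iff)
  then show ?thesis using roots by metis
qed

lemma desym:
  assumes "u \<in> sym_polydisc n"
  shows "desym n u \<in> polydisc n" "sym_map n (desym n u) = u"
  using assms unfolding sym_polydisc_def desym_def
  by (auto intro: inv_into_into f_inv_into_f)

lemma desym_sym_map:
  assumes "Z \<in> polydisc n"
  shows "image_mset (($) (desym n (sym_map n Z))) (mset_set {..<n})
    = image_mset (($) Z) (mset_set {..<n})"
proof -
  have "sym_map n Z \<in> sym_polydisc n" using assms by (simp add: sym_polydisc_def)
  from desym[OF this] show ?thesis
    using assms by (intro sym_map_eqD) (auto simp: polydisc_def)
qed

lemma prod_desym_sym_map:
  assumes "Z \<in> polydisc n"
  shows "(\<Prod>i<n. h (desym n (sym_map n Z) $ i)) = (\<Prod>i<n. h (Z $ i) :: 'a :: comm_monoid_mult)"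
  using arg_cong[OF desym_sym_map[OF assms], where f = "\<lambda>M. prod_mset (image_mset h M)"]
  by (simp add: image_mset.compositionality comp_def prod_unfold_prod_mset)

lemma szego_sym_map:
  assumes "Z \<in> polydisc n" "W \<in> polydisc n"
  shows "szego n (sym_map n Z) (sym_map n W) = (\<Prod>i<n. \<Prod>j<n. 1 / (1 - Z $ i * cnj (W $ j)))"
proof -
  let ?Z = "desym n (sym_map n Z)" and ?W = "desym n (sym_map n W)"
  have "szego n (sym_map n Z) (sym_map n W) = (\<Prod>i<n. \<Prod>j<n. 1 / (1 - Z $ i * cnj (?W $ j)))"
    unfolding szego_def
    by (rule prod_desym_sym_map[OF assms(1), where h = "\<lambda>z. \<Prod>j<n. 1 / (1 - z * cnj (?W $ j))"])
  also have "\<dots> = (\<Prod>i<n. \<Prod>j<n. 1 / (1 - Z $ i * cnj (W $ j)))"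
    by (intro prod.cong refl
        prod_desym_sym_map[OF assms(2), where h = "\<lambda>w. 1 / (1 - _ * cnj w)"])
  finally show ?thesis .
qed

lemma szego_diag_pos:
  assumes "u \<in> sym_polydisc n"
  shows "szego n u u \<in> \<real>" "0 < Re (szego n u u)"
proof -
  define Z where "Z = desym n u"
  define K where "K i j = 1 / (1 - Z $ i * cnj (Z $ j))" for i j
  have Z: "norm (Z $ i) < 1" if "i < n" for i
    using desym(1)[OF assms] that by (simp add: Z_def polydisc_def)
  have S: "szego n u u = (\<Prod>i<n. \<Prod>j<n. K i j)" by (simp add: szego_def Z_def K_def)
  have "0 < (\<Prod>i<m. \<Prod>j<m. K i j)" if "m \<le> n" for m
    using that
  proof (induction m)
    case (Suc m)
    have nz: "1 - Z $ i * cnj (Z $ j) \<noteq> 0" if "i < n" "j < n" for i j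
    proof
      assume "1 - Z $ i * cnj (Z $ j) = 0"
      then have "norm (Z $ i) * norm (Z $ j) = 1"
        by (metis complex_mod_cnj eq_iff_diff_eq_0 norm_mult norm_one)
      moreover have "norm (Z $ i) * norm (Z $ j) < 1 * 1"
        using Z that by (intro mult_strict_mono') auto
      ultimately show False by simp
    qed
    have cc: "(\<Prod>j<m. K m j) = cnj (\<Prod>i<m. K i m)"
      unfolding cnj_prod by (rule prod.cong) (simp_all add: K_def mult.commute)
    have of_real_pos: "0 < complex_of_real r" if "0 < r" for r
      using that by (simp add: less_complex_def)
    have pos: "0 < z * cnj z" if "z \<noteq> 0" for z :: complex
      unfolding complex_norm_square[symmetric] by (rule of_real_pos) (use that in simp)
    have split: "(\<Prod>i<Suc m. \<Prod>j<Suc m. K i j)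
        = (\<Prod>i<m. \<Prod>j<m. K i j) * ((\<Prod>i<m. K i m) * cnj (\<Prod>i<m. K i m)) * K m m"
      by (simp add: prod.distrib cc del: cnj_prod)
    have "(\<Prod>i<m. K i m) \<noteq> 0"
      using nz Suc.prems by (auto simp: K_def)
    moreover have Kmm: "0 < K m m"
    proof -
      have "(norm (Z $ m))\<^sup>2 < 1" using Z[of m] Suc.prems by (simp add: power_less_one_iff)
      moreover have "K m m = complex_of_real (1 / (1 - (norm (Z $ m))\<^sup>2))"
        unfolding K_def complex_norm_square[symmetric] by simp
      ultimately show ?thesis by (simp only:) (rule of_real_pos, simp)
    qed
    moreover have "0 < a * b" if "0 < a" "0 < b" for a b :: complex
      using that by (auto simp: less_complex_def)
    moreover have "0 < (\<Prod>i<m. \<Prod>j<m. K i j)" using Suc.IH Suc.prems by simp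
    ultimately show ?case unfolding split using pos by blast
  qed (simp add: less_complex_def)
  then have "0 < szego n u u" using S by simp
  then show "szego n u u \<in> \<real>" "0 < Re (szego n u u)"
    by (auto simp: less_complex_def complex_is_Real_iff)
qed

lemma induced_map_sym_map:
  assumes "Z \<in> polydisc n"
  shows "induced_map n f (sym_map n Z) = sym_map n (map_vec f Z)"
proof -
  let ?W = "desym n (sym_map n Z)"
  have Z: "dim_vec Z = n" using assms by (auto simp: polydisc_def)
  have W: "?W \<in> polydisc n" by (rule desym(1)) (use assms in \<open>simp add: sym_polydisc_def\<close>)
  then have W': "dim_vec ?W = n" by (auto simp: polydisc_def)
  obtain p where p: "p permutes {..<n}" "\<forall>i\<in>{..<n}. Z $ i = ?W $ p i"
    using image_mset_eq_implies_permutes[OF finite_lessThan desym_sym_map[OF assms, symmetric]]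
    by metis
  have "esym k (map_vec f ?W) = esym k (map_vec f Z)" for k
  proof -
    have q: "q ` I \<in> {I. I \<subseteq> {..<n} \<and> card I = k}"
      if "q permutes {..<n}" "I \<in> {I. I \<subseteq> {..<n} \<and> card I = k}" for q I
    proof -
      have "q ` I \<subseteq> q ` {..<n}" using that by blast
      moreover have "card (q ` I) = card I"
        by (rule card_image[OF inj_on_subset[OF permutes_inj[OF that(1)] subset_UNIV]])
      ultimately show ?thesis using permutes_image[OF that(1)] that(2) by simp
    qed
    have bij: "bij_betw ((`) p) {I. I \<subseteq> {..<n} \<and> card I = k} {I. I \<subseteq> {..<n} \<and> card I = k}"
    proof (rule bij_betwI[where g = "(`) (inv_into UNIV p)"])
      show "(`) p \<in> {I. I \<subseteq> {..<n} \<and> card I = k} \<rightarrow> {I. I \<subseteq> {..<n} \<and> card I = k}"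
        using q[OF p(1)] by blast
      show "(`) (inv_into UNIV p)
          \<in> {I. I \<subseteq> {..<n} \<and> card I = k} \<rightarrow> {I. I \<subseteq> {..<n} \<and> card I = k}"
        using q[OF permutes_inv[OF p(1)]] by blast
    qed (simp_all add: image_image permutes_inverses[OF p(1)])
    show ?thesis
      unfolding esym_def index_map_vec(2) Z W'
    proof (subst sum.reindex_bij_betw[OF bij, symmetric], rule sum.cong[OF refl])
      fix I assume I: "I \<in> {I. I \<subseteq> {..<n} \<and> card I = k}"
      have "(\<Prod>i\<in>p ` I. map_vec f ?W $ i) = (\<Prod>i\<in>I. map_vec f ?W $ p i)"
        by (simp add: prod.reindex inj_on_subset[OF permutes_inj[OF p(1)] subset_UNIV])
      also have "\<dots> = (\<Prod>i\<in>I. map_vec f Z $ i)"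
      proof (rule prod.cong[OF refl])
        fix i assume "i \<in> I"
        then have "i < n" using I by auto
        then have "p i < n" using permutes_in_image[OF p(1), of i] by simp
        then show "map_vec f ?W $ p i = map_vec f Z $ i"
          using p(2) \<open>i < n\<close> by (simp add: Z W')
      qed
      finally show "(\<Prod>i\<in>p ` I. map_vec f ?W $ i) = (\<Prod>i\<in>I. map_vec f Z $ i)" .
    qed
  qed
  then show ?thesis by (simp add: induced_map_def sym_map_def)
qed

end

theory Submission
  imports Defs
begin

text \<open>At a point \<open>u\<close> with roots $z_i$ the tangent vector \<open>v\<close> defines the functional
  $\Lambda(H) = \sum_i \nu_i H(z_i)$ on holomorphic functions, where \<open>v\<close> is the image of $(\nu_i)$;
  it extends to colliding roots and always annihilates the multiples of $\prod_i (z - z_i)$.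
  Expanding $\log S_n(u,u) = \sum_m |p_m(u)|^2/m$ in power sums gives
  $v^* g_n v = \sum_m (m+1) |\Lambda(z^m)|^2$ and
  $v^* F_f^* g_n v = \sum_m (m+1) |\Lambda(f^m f')|^2$.

  If \<open>f\<close> is a Blaschke product of degree \<open>d\<close>, then
  $1 - f(z)\overline{f(w)} = (1 - z\overline w) \sum_{l<d} e_l(z)\overline{e_l(w)}$, likewise for a second
  family $e'_l$, and $f' = \sum_l e_l e'_l$. So $\Lambda(f^m f')$ is the trace of the \<open>d \<times> d\<close>
  matrix $M_m = (\Lambda(f^m e_l e'_k))$ of rank at most \<open>n\<close>, whence
  $|\Lambda(f^m f')|^2 \le \min(n,d) \|M_m\|^2$ in the Frobenius norm, while the kernel identity
  $(1 - z\overline w)^{-2} = k_f^2 (1 - f(z)\overline{f(w)})^{-2}$ yields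
  $\sum_m (m+1) \|M_m\|^2 = \sum_m (m+1) |\Lambda(z^m)|^2$. For general \<open>f\<close> and a fixed \<open>u\<close>, the
  Schur algorithm replaces \<open>f\<close> by such a function with the same values and derivatives at the
  roots. Sharpness is seen at the origin with $z^k ((z-a)/(1-az))^{d-k}$, $k = \min(n,d)$,
  $a \to 1$.\<close>

section \<open>Functions realised by a finite-dimensional state space\<close>

text \<open>Where roots collide, \<open>sym_map\<close> is not locally invertible, so the metric
  cannot be computed in root coordinates on the whole domain. Derivatives are therefore taken
  through power sums, which are holomorphic in \<open>u\<close>. The price is that series have to be
  differentiated termwise; Cauchy estimates supply the uniform geometric bounds for this. Two
  families are needed because f' is a trace of products \<open>e l * e' k\<close>, and it is the
  product of the two kernels that carries the square in the Bergman kernel. Of the energy identity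
  only the inequality \<le> is proved and used, by truncating both kernels and passing to the limit.
  The interpolant of a general f may have degree larger than n. This is harmless, since the rank
  bound n does not see the degree. Interpolation to second order is forced by f^m f' = (f^(m+1))' /
  (m+1): agreement modulo the square of the root polynomial leaves, after one differentiation,
  agreement modulo the polynomial itself, which the functional annihilates.\<close>

text \<open>Writing \<open>f\<close> as the transfer function of a unitary colligation with \<open>d\<close>-dimensional state
  space, $f(z) = D + zC(1 - zA)^{-1}B$, one may take for \<open>e z\<close> the row $C(1 - zA)^{-1}$ and for
  \<open>e' z\<close> the column $(1 - zA)^{-1}B$. The two kernel identities and the formula for \<open>f'\<close>
  are all that is needed of this.\<close>

definition realizes ::
    "nat \<Rightarrow> (complex \<Rightarrow> complex) \<Rightarrow> (nat \<Rightarrow> complex \<Rightarrow> complex) \<Rightarrow> (nat \<Rightarrow> complex \<Rightarrow> complex) \<Rightarrow> bool"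
  where
  "realizes d f e e' \<longleftrightarrow> f holomorphic_on ball 0 1 \<and>
    (\<forall>l<d. e l holomorphic_on ball 0 1) \<and> (\<forall>l<d. e' l holomorphic_on ball 0 1) \<and>
    (\<forall>z\<in>ball 0 1. \<forall>w\<in>ball 0 1.
      1 - f z * cnj (f w) = (1 - z * cnj w) * (\<Sum>l<d. e l z * cnj (e l w))) \<and>
    (\<forall>z\<in>ball 0 1. \<forall>w\<in>ball 0 1.
      1 - f z * cnj (f w) = (1 - z * cnj w) * (\<Sum>l<d. e' l z * cnj (e' l w))) \<and>
    (\<forall>z\<in>ball 0 1. (f has_field_derivative (\<Sum>l<d. e l z * e' l z)) (at z))"

definition rational_inner :: "nat \<Rightarrow> (complex \<Rightarrow> complex) \<Rightarrow> bool" where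
  "rational_inner d f \<longleftrightarrow> (\<exists>e e'. realizes d f e e')"

lemma realizesD:
  assumes "realizes d f e e'"
  shows "f holomorphic_on ball 0 1"
    and "\<And>l. l < d \<Longrightarrow> e l holomorphic_on ball 0 1"
    and "\<And>l. l < d \<Longrightarrow> e' l holomorphic_on ball 0 1"
    and "\<And>z w. z \<in> ball 0 1 \<Longrightarrow> w \<in> ball 0 1 \<Longrightarrow>
        1 - f z * cnj (f w) = (1 - z * cnj w) * (\<Sum>l<d. e l z * cnj (e l w))"
    and "\<And>z w. z \<in> ball 0 1 \<Longrightarrow> w \<in> ball 0 1 \<Longrightarrow>
        1 - f z * cnj (f w) = (1 - z * cnj w) * (\<Sum>l<d. e' l z * cnj (e' l w))"
    and "\<And>z. z \<in> ball 0 1 \<Longrightarrow> (f has_field_derivative (\<Sum>l<d. e l z * e' l z)) (at z)"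
  using assms unfolding realizes_def by blast+

lemma norm_mult_cnj_less_1:
  fixes z w :: complex
  assumes "norm z \<le> 1" "norm w < 1"
  shows "norm (z * cnj w) < 1" "1 - z * cnj w \<noteq> 0" "1 - cnj w * z \<noteq> 0" "1 + cnj w * z \<noteq> 0"
proof -
  have *: "norm (z * cnj w) \<le> 1 * norm w"
    unfolding norm_mult complex_mod_cnj using assms by (intro mult_right_mono) auto
  then show 1: "norm (z * cnj w) < 1" using assms by simp
  then show "1 - z * cnj w \<noteq> 0" by auto
  then show "1 - cnj w * z \<noteq> 0" by (simp add: mult.commute)
  show "1 + cnj w * z \<noteq> 0"
  proof
    assume "1 + cnj w * z = 0"
    then have "z * cnj w = -1" by (metis add.commute add_eq_0_iff mult.commute)
    then show False using 1 by simp
  qed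
qed

text \<open>On the diagonal w = z the kernel identity reads 1 - |f|^2 = (1 - |z|^2) times a sum of
  squares. The bound is not strict because unimodular constants are included.\<close>

lemma rational_inner_norm_le:
  assumes "rational_inner d f" "z \<in> ball 0 1"
  shows "norm (f z) \<le> 1"
proof -
  obtain e e' where "realizes d f e e'" using assms(1) unfolding rational_inner_def by blast
  note e = realizesD(4)[OF this assms(2) assms(2)]
  have "complex_of_real (1 - (norm (f z))\<^sup>2)
      = complex_of_real ((1 - (norm z)\<^sup>2) * (\<Sum>l<d. (norm (e l z))\<^sup>2))"
    using e by (simp add: complex_norm_square del: of_real_power)
  then have "1 - (norm (f z))\<^sup>2 = (1 - (norm z)\<^sup>2) * (\<Sum>l<d. (norm (e l z))\<^sup>2)"
    by (simp only: of_real_eq_iff)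
  moreover have "(norm z)\<^sup>2 < 1" using assms by (simp add: power_less_one_iff)
  ultimately have "0 \<le> 1 - (norm (f z))\<^sup>2" by (simp add: sum_nonneg)
  then show ?thesis by (simp add: power_le_one_iff)
qed

lemma rational_inner_cong:
  assumes "rational_inner d f" "\<And>z. z \<in> ball 0 1 \<Longrightarrow> g z = f z"
  shows "rational_inner d g"
proof -
  obtain e e' where f: "realizes d f e e'" using assms(1) unfolding rational_inner_def by blast
  have "realizes d g e e'"
    unfolding realizes_def
  proof (intro conjI allI impI ballI)
    show "g holomorphic_on ball 0 1"
      by (rule holomorphic_transform[OF realizesD(1)[OF f]]) (simp add: assms(2))
  next
    fix z :: complex assume z: "z \<in> ball 0 1"
    from realizesD(6)[OF f z] open_ball z
    show "(g has_field_derivative (\<Sum>l<d. e l z * e' l z)) (at z)"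
      by (rule has_field_derivative_transform_within_open) (simp add: assms(2))
  qed ((simp only: assms(2))?, (rule realizesD(2-5)[OF f]; assumption))+
  then show ?thesis unfolding rational_inner_def by blast
qed

lemma rational_inner_const:
  assumes "norm c = 1"
  shows "rational_inner 0 (\<lambda>_. c)"
proof -
  have "c * cnj c = 1" using assms by (simp add: complex_norm_square[symmetric])
  then show ?thesis by (auto simp: rational_inner_def realizes_def)
qed

lemma complex_of_sqrt_square:
  assumes "norm a < 1"
  shows "complex_of_real (sqrt (1 - (norm a)\<^sup>2)) * complex_of_real (sqrt (1 - (norm a)\<^sup>2))
    = 1 - a * cnj a"
proof -
  have "(norm a)\<^sup>2 < 1" using assms by (simp add: power_less_one_iff)
  then have "sqrt (1 - (norm a)\<^sup>2) * sqrt (1 - (norm a)\<^sup>2) = 1 - (norm a)\<^sup>2" by simp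
  then show ?thesis
    unfolding of_real_mult[symmetric] by (simp add: complex_norm_square del: of_real_power)
qed

text \<open>With b the Blaschke factor, 1 - bg cnj(bg) splits in two ways: as (1 - b cnj b) + b cnj
  b (1 - g cnj g), and with the roles of b and g exchanged. One splitting gives the first family,
  the other the second.\<close>

lemma rational_inner_blaschke_factor:
  assumes g: "rational_inner d g" and a: "norm a < 1"
  shows "rational_inner (Suc d) (\<lambda>z. (z - a) / (1 - cnj a * z) * g z)"
proof -
  obtain e e' where R: "realizes d g e e'" using g unfolding rational_inner_def by blast
  note hol = realizesD(1-3)[OF R] and ker = realizesD(4,5)[OF R] and der = realizesD(6)[OF R]
  define s where "s = complex_of_real (sqrt (1 - (norm a)\<^sup>2))"
  have s: "s * s = 1 - a * cnj a" "cnj s = s"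
    using complex_of_sqrt_square[OF a] by (simp_all add: s_def)
  define b where "b z = (z - a) / (1 - cnj a * z)" for z
  \<comment> \<open>For a single factor both families consist of this normalised Szego kernel
    function: it factors the kernel of \<open>b\<close>, and b' = eb^2.\<close>
  define eb where "eb z = s / (1 - cnj a * z)" for z
  have nz: "1 - cnj a * z \<noteq> 0" "1 - a * cnj z \<noteq> 0" if "z \<in> ball 0 1" for z
    using norm_mult_cnj_less_1[of z a] norm_mult_cnj_less_1[of a z] a that by auto
  have hb: "b holomorphic_on ball 0 1" "eb holomorphic_on ball 0 1"
    unfolding b_def eb_def using nz by (auto intro!: holomorphic_intros)
  have kb: "1 - b z * cnj (b w) = (1 - z * cnj w) * (eb z * cnj (eb w))"
    if "z \<in> ball 0 1" "w \<in> ball 0 1" for z w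
  proof -
    have t: "eb z * cnj (eb w) = (1 - a * cnj a) / ((1 - cnj a * z) * (1 - a * cnj w))"
      by (simp add: eb_def s)
    show ?thesis
      unfolding t using nz[OF that(1)] nz[OF that(2)]
      by (simp add: b_def divide_simps) (simp add: algebra_simps)
  qed
  have db: "(b has_field_derivative (eb z * eb z)) (at z)" if "z \<in> ball 0 1" for z
  proof -
    have "(b has_field_derivative (1 - a * cnj a) / ((1 - cnj a * z) * (1 - cnj a * z))) (at z)"
      unfolding b_def using nz[OF that]
      by (auto intro!: derivative_eq_intros simp: algebra_simps)
    then show ?thesis by (simp add: eb_def s)
  qed
  \<comment> \<open>The factor \<open>b\<close> goes to the old part of one family and
    \<open>g\<close> to the new part of the other, so that the sum of \<open>E l * E' l\<close> is b
    g' + b' g.\<close>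
  define E where "E l z = (if l < d then b z * e l z else eb z)" for l z
  define E' where "E' l z = (if l < d then e' l z else g z * eb z)" for l z
  have "(\<lambda>z. b z * g z) holomorphic_on ball 0 1"
    using hb hol by (intro holomorphic_intros)
  moreover have "E l holomorphic_on ball 0 1 \<and> E' l holomorphic_on ball 0 1" for l
    unfolding E_def E'_def using hb hol by (cases "l < d") (auto intro!: holomorphic_intros)
  moreover have "1 - (b z * g z) * cnj (b w * g w) = (1 - z * cnj w) * (\<Sum>l<Suc d. E l z * cnj (E l w))"
      "1 - (b z * g z) * cnj (b w * g w) = (1 - z * cnj w) * (\<Sum>l<Suc d. E' l z * cnj (E' l w))"
    if zw: "z \<in> ball 0 1" "w \<in> ball 0 1" for z w
  proof -
    have "(\<Sum>l<Suc d. E l z * cnj (E l w))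
        = (\<Sum>l<d. b z * cnj (b w) * (e l z * cnj (e l w))) + eb z * cnj (eb w)"
      by (simp add: E_def mult_ac)
    then have "(1 - z * cnj w) * (\<Sum>l<Suc d. E l z * cnj (E l w))
        = b z * cnj (b w) * (1 - g z * cnj (g w)) + (1 - b z * cnj (b w))"
      unfolding ker(1)[OF zw] kb[OF zw] sum_distrib_left[symmetric] by (simp add: algebra_simps)
    then show "1 - (b z * g z) * cnj (b w * g w) = (1 - z * cnj w) * (\<Sum>l<Suc d. E l z * cnj (E l w))"
      by (simp add: algebra_simps)
    have "(\<Sum>l<Suc d. E' l z * cnj (E' l w))
        = (\<Sum>l<d. e' l z * cnj (e' l w)) + g z * cnj (g w) * (eb z * cnj (eb w))"
      by (simp add: E'_def mult_ac)
    then have "(1 - z * cnj w) * (\<Sum>l<Suc d. E' l z * cnj (E' l w))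
        = (1 - g z * cnj (g w)) + g z * cnj (g w) * (1 - b z * cnj (b w))"
      unfolding ker(2)[OF zw] kb[OF zw] by (simp add: algebra_simps)
    then show "1 - (b z * g z) * cnj (b w * g w) = (1 - z * cnj w) * (\<Sum>l<Suc d. E' l z * cnj (E' l w))"
      by (simp add: algebra_simps)
  qed
  moreover have "((\<lambda>z. b z * g z) has_field_derivative (\<Sum>l<Suc d. E l z * E' l z)) (at z)"
    if "z \<in> ball 0 1" for z
    using DERIV_mult[OF db[OF that] der[OF that]]
    by (simp add: E_def E'_def sum_distrib_left algebra_simps)
  ultimately have "rational_inner (Suc d) (\<lambda>z. b z * g z)"
    unfolding rational_inner_def realizes_def by (intro exI[of _ E] exI[of _ E']) simp
  then show ?thesis by (simp add: b_def[abs_def])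
qed

text \<open>Composition with a disc automorphism multiplies the kernel by t(z) cnj(t(w)) and the
  derivative by t^2, so scaling both families by \<open>t\<close> leaves \<open>d\<close>
  unchanged.\<close>

lemma rational_inner_moebius:
  assumes f: "rational_inner d f" and a: "norm a < 1"
  shows "rational_inner d (\<lambda>z. (f z + a) / (1 + cnj a * f z))"
proof -
  obtain e e' where R: "realizes d f e e'" using f unfolding rational_inner_def by blast
  note hol = realizesD(1-3)[OF R] and ker = realizesD(4,5)[OF R] and der = realizesD(6)[OF R]
  define s where "s = complex_of_real (sqrt (1 - (norm a)\<^sup>2))"
  have s: "s * s = 1 - a * cnj a" "cnj s = s"
    using complex_of_sqrt_square[OF a] by (simp_all add: s_def)
  have nz: "1 + cnj a * f z \<noteq> 0" "1 + a * cnj (f z) \<noteq> 0" if "z \<in> ball 0 1" for z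
  proof -
    show *: "1 + cnj a * f z \<noteq> 0"
      using norm_mult_cnj_less_1(4)[OF rational_inner_norm_le[OF f that] a] .
    then have "cnj (1 + cnj a * f z) \<noteq> 0" by (simp only: complex_cnj_zero_iff) simp
    then show "1 + a * cnj (f z) \<noteq> 0" by simp
  qed
  define t where "t z = s / (1 + cnj a * f z)" for z
  define h where "h z = (f z + a) / (1 + cnj a * f z)" for z
  have ht: "t holomorphic_on ball 0 1" "h holomorphic_on ball 0 1"
    unfolding t_def h_def using nz hol by (auto intro!: holomorphic_intros)
  have kh: "1 - h z * cnj (h w) = t z * cnj (t w) * (1 - f z * cnj (f w))"
    if "z \<in> ball 0 1" "w \<in> ball 0 1" for z w
  proof -
    have t: "t z * cnj (t w) = (1 - a * cnj a) / ((1 + cnj a * f z) * (1 + a * cnj (f w)))"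
      by (simp add: t_def s)
    show ?thesis
      unfolding t using nz[OF that(1)] nz[OF that(2)]
      by (simp add: h_def divide_simps) (simp add: algebra_simps)
  qed
  have dh: "(h has_field_derivative (t z * t z * (\<Sum>l<d. e l z * e' l z))) (at z)"
    if "z \<in> ball 0 1" for z
  proof -
    have "(h has_field_derivative (1 - a * cnj a) / ((1 + cnj a * f z) * (1 + cnj a * f z))
        * (\<Sum>l<d. e l z * e' l z)) (at z)"
      unfolding h_def using nz[OF that] der[OF that]
      by (auto intro!: derivative_eq_intros simp: algebra_simps divide_simps)
    then show ?thesis by (simp add: t_def s)
  qed
  define E where "E l z = t z * e l z" for l z
  define E' where "E' l z = t z * e' l z" for l z
  have "E l holomorphic_on ball 0 1 \<and> E' l holomorphic_on ball 0 1" if "l < d" for l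
    unfolding E_def E'_def using ht hol that by (auto intro!: holomorphic_intros)
  moreover have "1 - h z * cnj (h w) = (1 - z * cnj w) * (\<Sum>l<d. E l z * cnj (E l w))"
      "1 - h z * cnj (h w) = (1 - z * cnj w) * (\<Sum>l<d. E' l z * cnj (E' l w))"
    if zw: "z \<in> ball 0 1" "w \<in> ball 0 1" for z w
    unfolding kh[OF zw]
    by (simp add: ker(1)[OF zw] E_def sum_distrib_left mult_ac,
        simp add: ker(2)[OF zw] E'_def sum_distrib_left mult_ac)
  moreover have "(h has_field_derivative (\<Sum>l<d. E l z * E' l z)) (at z)"
    if "z \<in> ball 0 1" for z
    using dh[OF that] by (simp add: E_def E'_def sum_distrib_left mult_ac)
  ultimately have "rational_inner d h"
    using ht(2) unfolding rational_inner_def realizes_def by (intro exI[of _ E] exI[of _ E']) simp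
  then show ?thesis by (simp add: h_def[abs_def])
qed

lemma finite_blaschke_rational_inner:
  assumes "finite_blaschke d B"
  shows "rational_inner d B"
proof -
  obtain \<theta> a where a: "\<And>k. k < d \<Longrightarrow> a k \<in> ball 0 1"
    and B: "\<And>z. z \<in> ball 0 1 \<Longrightarrow> B z = cis \<theta> * (\<Prod>k<d. (z - a k) / (1 - cnj (a k) * z))"
    using assms unfolding finite_blaschke_def by blast
  have "rational_inner m (\<lambda>z. cis \<theta> * (\<Prod>k<m. (z - a k) / (1 - cnj (a k) * z)))" if "m \<le> d" for m
    using that
  proof (induction m)
    case 0
    then show ?case using rational_inner_const[of "cis \<theta>"] by simp
  next
    case (Suc m)
    then have "norm (a m) < 1" using a[of m] by simp
    from rational_inner_blaschke_factor[OF Suc.IH this] Suc.prems show ?case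
      by (simp add: mult_ac)
  qed
  from rational_inner_cong[OF this[OF order_refl] B] show ?thesis .
qed

section \<open>Hermite interpolation by realised functions\<close>

text \<open>After moving \<open>a\<close> to the origin, the Schwarz lemma bounds k by the Blaschke
  factor at \<open>a\<close>. This gives |g| \<le> 1 away from \<open>a\<close>, and continuity
  gives it at \<open>a\<close>. Equality can occur, so one step of the Schur algorithm starts from a
  strict bound and returns only a weak one.\<close>

lemma Schwarz_Pick_quotient:
  assumes k: "k holomorphic_on ball 0 1" "\<And>z. z \<in> ball 0 1 \<Longrightarrow> norm (k z) < 1"
    and a: "a \<in> ball 0 1" "k a = 0"
  obtains g where "g holomorphic_on ball 0 1" "\<And>z. z \<in> ball 0 1 \<Longrightarrow> norm (g z) \<le> 1"
    "\<And>z. z \<in> ball 0 1 \<Longrightarrow> k z = (z - a) / (1 - cnj a * z) * g z"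
proof -
  have a1: "norm a < 1" using a(1) by simp
  have nz: "1 - cnj a * z \<noteq> 0" if "z \<in> ball 0 1" for z
    using norm_mult_cnj_less_1(3)[of z a] a1 that by auto
  define q where "q = (\<lambda>z. if z = a then deriv k a else (k z - k a) / (z - a))"
  have q: "q holomorphic_on ball 0 1"
    unfolding q_def by (rule pole_lemma_open[OF k(1) open_ball])
  define g where "g z = (1 - cnj a * z) * q z" for z
  have g: "g holomorphic_on ball 0 1"
    unfolding g_def using q by (intro holomorphic_intros)
  have kg: "k z = (z - a) / (1 - cnj a * z) * g z" if "z \<in> ball 0 1" for z
    using nz[OF that] a(2) by (simp add: g_def q_def)
  define H where "H w = k (Moebius_function 0 (-a) w)" for w
  have na: "norm (- a) < 1" using a1 by simp
  have H: "H holomorphic_on ball 0 1" "H 0 = 0" "norm w < 1 \<Longrightarrow> norm (H w) < 1" for w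
    unfolding H_def
    using holomorphic_on_compose_gen[OF Moebius_function_holomorphic[OF na, of 0] k(1)]
      Moebius_function_norm_lt_1[OF na, of _ 0] k(2) a(2)
    by (auto simp: comp_def Moebius_function_def image_subset_iff)
  have Hb: "norm (H w) \<le> norm w" if "norm w < 1" for w
    using Schwarz_Lemma(1)[OF H(1) H(2) H(3) that] by simp
  have g1: "norm (g z) \<le> 1" if z: "z \<in> ball 0 1" "z \<noteq> a" for z
  proof -
    define w where "w = Moebius_function 0 a z"
    have w: "norm w < 1" unfolding w_def using Moebius_function_norm_lt_1[OF a1, of z 0] z by simp
    have "Moebius_function 0 (-a) w = z"
      unfolding w_def by (rule Moebius_function_compose) (use a1 z in auto)
    then have "norm (k z) \<le> norm w" using Hb[OF w] by (simp add: H_def)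
    also have "w = (z - a) / (1 - cnj a * z)" by (simp add: w_def Moebius_function_def)
    finally have "norm ((z - a) / (1 - cnj a * z)) * norm (g z) \<le> norm ((z - a) / (1 - cnj a * z)) * 1"
      unfolding kg[OF z(1)] norm_mult by simp
    moreover have "0 < norm ((z - a) / (1 - cnj a * z))" using nz[OF z(1)] z(2) by simp
    ultimately show ?thesis by (meson mult_le_cancel_left_pos)
  qed
  have "norm (g a) \<le> 1"
  proof (rule tendsto_upperbound)
    have "isCont g a"
      using holomorphic_on_imp_continuous_on[OF g] a(1) by (metis continuous_on_eq_continuous_at open_ball)
    then show "((\<lambda>z. norm (g z)) \<longlongrightarrow> norm (g a)) (at a)"
      by (intro tendsto_norm) (simp add: isCont_def)
    have "eventually (\<lambda>z. z \<in> ball 0 1) (at a)"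
      using a(1) by (intro eventually_at_in_open') auto
    then show "eventually (\<lambda>z. norm (g z) \<le> 1) (at a)"
      using eventually_neq_at_within[of a] by eventually_elim (use g1 in auto)
  qed simp
  with g1 have "norm (g z) \<le> 1" if "z \<in> ball 0 1" for z using that by (cases "z = a") auto
  from that[OF g this kg] show thesis .
qed

text \<open>The Schur algorithm: moving \<open>f x\<close> to the origin by a disc automorphism and dividing by the
  Blaschke factor at \<open>x\<close> leaves a function with one interpolation condition fewer.\<close>

lemma schur_interpolation:
  assumes "f holomorphic_on ball 0 1" "\<And>z. z \<in> ball 0 1 \<Longrightarrow> norm (f z) \<le> 1"
    and "set xs \<subseteq> ball 0 1"
  shows "\<exists>d h r. rational_inner d h \<and> r holomorphic_on ball 0 1 \<and>
    (\<forall>z\<in>ball 0 1. f z - h z = (\<Prod>x\<leftarrow>xs. z - x) * r z)"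
  using assms
proof (induction xs arbitrary: f)
  case Nil
  have "rational_inner 0 (\<lambda>_. 1)" by (rule rational_inner_const) simp
  moreover have "(\<lambda>z. f z - 1) holomorphic_on ball 0 1" using Nil by (intro holomorphic_intros)
  ultimately show ?case by fastforce
next
  case (Cons x xs)
  show ?case
  proof (cases "\<exists>\<xi>\<in>ball 0 1. norm (f \<xi>) = 1")
    \<comment> \<open>By the maximum principle f is a unimodular constant, which interpolates
      itself; the algorithm stops with remainder 0.\<close>
    case True
    then obtain \<xi> where \<xi>: "\<xi> \<in> ball 0 1" "norm (f \<xi>) = 1" by blast
    have "f constant_on ball 0 1"
      by (rule maximum_modulus_principle[OF Cons.prems(1) open_ball _ open_ball order_refl \<xi>(1)])
        (use Cons.prems(2) \<xi> in auto)
    then have "f z = f \<xi>" if "z \<in> ball 0 1" for z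
      using \<xi>(1) that unfolding constant_on_def by metis
    moreover have "rational_inner 0 (\<lambda>_. f \<xi>)" using \<xi>(2) by (rule rational_inner_const)
    ultimately show ?thesis
      by (intro exI[of _ 0] exI[of _ "\<lambda>_. f \<xi>"] exI[of _ "\<lambda>_. 0"]) auto
  next
    case False
    then have f1: "norm (f z) < 1" if "z \<in> ball 0 1" for z
      using Cons.prems(2)[OF that] that by (auto simp: less_le)
    have x: "x \<in> ball 0 1" and xs: "set xs \<subseteq> ball 0 1" using Cons.prems(3) by auto
    define a where "a = f x"
    have a: "norm a < 1" using f1[OF x] by (simp add: a_def)
    have nzf: "1 - cnj a * f z \<noteq> 0" if "z \<in> ball 0 1" for z
      using norm_mult_cnj_less_1(3)[of "f z" a] a f1[OF that] by auto
    define k where "k z = (f z - a) / (1 - cnj a * f z)" for z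
    have "k holomorphic_on ball 0 1"
      unfolding k_def using nzf Cons.prems(1) by (intro holomorphic_intros)
    moreover have "norm (k z) < 1" if "z \<in> ball 0 1" for z
      using Moebius_function_norm_lt_1[OF a f1[OF that], of 0]
      by (simp add: k_def Moebius_function_def)
    moreover have "k x = 0" by (simp add: k_def a_def)
    ultimately obtain g where g: "g holomorphic_on ball 0 1"
        "\<And>z. z \<in> ball 0 1 \<Longrightarrow> norm (g z) \<le> 1"
        "\<And>z. z \<in> ball 0 1 \<Longrightarrow> k z = (z - x) / (1 - cnj x * z) * g z"
      using Schwarz_Pick_quotient[of k x] x by blast
    define b where "b z = (z - x) / (1 - cnj x * z)" for z
    from Cons.IH[OF g(1,2) xs] obtain d h r where h: "rational_inner d h"
        "r holomorphic_on ball 0 1" "\<And>z. z \<in> ball 0 1 \<Longrightarrow> g z - h z = (\<Prod>x\<leftarrow>xs. z - x) * r z"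
      by blast
    \<comment> \<open>This undoes the automorphism in \<open>k\<close>: f is the same expression
      with \<open>g\<close> in place of \<open>h\<close>.\<close>
    define h' where "h' z = (b z * h z + a) / (1 + cnj a * (b z * h z))" for z
    have "norm x < 1" using x by simp
    from rational_inner_blaschke_factor[OF h(1) this]
    have bh: "rational_inner (Suc d) (\<lambda>z. b z * h z)" by (simp add: b_def)
    have h': "rational_inner (Suc d) h'"
      using rational_inner_moebius[OF bh a] by (simp add: h'_def[abs_def])
    have nzx: "1 - cnj x * z \<noteq> 0" if "z \<in> ball 0 1" for z
      using norm_mult_cnj_less_1(3)[of z x] x that by auto
    have nzh: "1 + cnj a * (b z * h z) \<noteq> 0" if "z \<in> ball 0 1" for z
      using norm_mult_cnj_less_1(4)[OF rational_inner_norm_le[OF bh that] a] .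
    have holh: "h holomorphic_on ball 0 1"
      using h(1) realizesD(1) unfolding rational_inner_def by blast
    have holb: "b holomorphic_on ball 0 1"
      unfolding b_def using nzx by (intro holomorphic_intros)
    \<comment> \<open>Read off from f - h' = (1 - cnj a f) b (g - h) / (1 + cnj a b h): the factor
      \<open>b\<close> contributes the new node, g - h the old ones, and no denominator vanishes on
      the disc.\<close>
    define r' where "r' z = (1 - cnj a * f z) * r z / ((1 - cnj x * z) * (1 + cnj a * (b z * h z)))" for z
    have "r' holomorphic_on ball 0 1"
      unfolding r'_def using nzx nzh Cons.prems(1) h(2) holh holb by (intro holomorphic_intros) auto
    moreover have "f z - h' z = (\<Prod>x\<leftarrow>x # xs. z - x) * r' z" if z: "z \<in> ball 0 1" for z
    proof -
      have "f z - a = (1 - cnj a * f z) * (b z * g z)"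
        using g(3)[OF z] nzf[OF z] by (simp add: b_def k_def field_simps)
      then have "f z * (1 + cnj a * (b z * h z)) - (b z * h z + a)
          = (1 - cnj a * f z) * (b z * (g z - h z))"
        by (simp add: algebra_simps)
      then have "f z - h' z = (1 - cnj a * f z) * (b z * (g z - h z)) / (1 + cnj a * (b z * h z))"
        using nzh[OF z] by (simp add: h'_def field_simps)
      then show ?thesis
        using h(3)[OF z] by (simp add: r'_def b_def mult_ac)
    qed
    ultimately show ?thesis using h' by blast
  qed
qed

text \<open>Nodes in the list count with multiplicity, so listing all of them twice produces the
  square.\<close>

lemma rational_inner_hermite_interpolation:
  assumes f: "f holomorphic_on ball 0 1" "\<And>z. z \<in> ball 0 1 \<Longrightarrow> norm (f z) \<le> 1"
    and xs: "set xs \<subseteq> ball 0 1"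
  obtains d h r where "rational_inner d h" "r holomorphic_on ball 0 1"
    "\<And>z. z \<in> ball 0 1 \<Longrightarrow> f z - h z = (\<Prod>x\<leftarrow>xs. z - x)\<^sup>2 * r z"
proof -
  have "set (xs @ xs) \<subseteq> ball 0 1" using xs by simp
  from schur_interpolation[OF f this] obtain d h r where "rational_inner d h"
    "r holomorphic_on ball 0 1" "\<And>z. z \<in> ball 0 1 \<Longrightarrow> f z - h z = (\<Prod>x\<leftarrow>xs @ xs. z - x) * r z"
    by blast
  then show thesis by (intro that[of d h r]) (simp_all add: power2_eq_square)
qed

section \<open>Traces of matrices of low rank\<close>

lemma norm_sum_mult_squared_le:
  fixes a b :: "'i \<Rightarrow> complex"
  shows "(norm (\<Sum>i\<in>I. a i * b i))\<^sup>2 \<le> (\<Sum>i\<in>I. (norm (a i))\<^sup>2) * (\<Sum>i\<in>I. (norm (b i))\<^sup>2)"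
proof -
  have "norm (\<Sum>i\<in>I. a i * b i) \<le> (\<Sum>i\<in>I. \<bar>norm (a i)\<bar> * \<bar>norm (b i)\<bar>)"
    by (rule order_trans[OF norm_sum]) (simp add: norm_mult)
  also have "\<dots> \<le> L2_set (\<lambda>i. norm (a i)) I * L2_set (\<lambda>i. norm (b i)) I"
    by (rule L2_set_mult_ineq)
  finally have "(norm (\<Sum>i\<in>I. a i * b i))\<^sup>2
      \<le> (L2_set (\<lambda>i. norm (a i)) I * L2_set (\<lambda>i. norm (b i)) I)\<^sup>2"
    by (intro power_mono) auto
  then show ?thesis by (simp add: L2_set_def power_mult_distrib sum_nonneg)
qed

lemma norm_sum_squared_le_card:
  fixes b :: "nat \<Rightarrow> complex"
  shows "(norm (\<Sum>i<n. b i))\<^sup>2 \<le> real n * (\<Sum>i<n. (norm (b i))\<^sup>2)"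
  using norm_sum_mult_squared_le[of "\<lambda>_. 1" b "{..<n}"] by simp

text \<open>Gram-Schmidt without discarding dependent vectors: these become zero vectors, so the
  family keeps its \<open>n\<close> indices and no rank has to be computed.\<close>

lemma orthonormal_spanning_family:
  fixes \<alpha> :: "nat \<Rightarrow> nat \<Rightarrow> complex"
  shows "\<exists>o' c. (\<forall>s<n. \<forall>t<n. s \<noteq> t \<longrightarrow> (\<Sum>l<d. o' s l * cnj (o' t l)) = 0) \<and>
    (\<forall>s<n. (\<Sum>l<d. (norm (o' s l))\<^sup>2) \<in> {0, 1}) \<and>
    (\<forall>s<n. \<forall>l<d. \<alpha> s l = (\<Sum>t<n. c s t * o' t l))"
proof (induction n)
  case (Suc n)
  then obtain o' c where orth: "\<forall>s<n. \<forall>t<n. s \<noteq> t \<longrightarrow> (\<Sum>l<d. o' s l * cnj (o' t l)) = 0"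
    and unit: "\<forall>s<n. (\<Sum>l<d. (norm (o' s l))\<^sup>2) \<in> {0, 1}"
    and span: "\<forall>s<n. \<forall>l<d. \<alpha> s l = (\<Sum>t<n. c s t * o' t l)"
    by (elim exE conjE)
  note orth = orth[rule_format] and unit = unit[rule_format] and span = span[rule_format]
  define ip where "ip x y = (\<Sum>l<d. x l * cnj (y l))" for x y :: "nat \<Rightarrow> complex"
  define \<beta> where "\<beta> l = \<alpha> n l - (\<Sum>t<n. ip (\<alpha> n) (o' t) * o' t l)" for l
  define N where "N = sqrt (\<Sum>l<d. (norm (\<beta> l))\<^sup>2)"
  have N2: "N\<^sup>2 = (\<Sum>l<d. (norm (\<beta> l))\<^sup>2)" by (simp add: N_def sum_nonneg)
  have self: "ip (o' t) (o' t) = of_real (\<Sum>l<d. (norm (o' t l))\<^sup>2)" for t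
    by (simp add: ip_def complex_norm_square del: of_real_power)
  have ip_linear: "ip (\<lambda>l. x l - (\<Sum>t<n. a t * o' t l)) y = ip x y - (\<Sum>t<n. a t * ip (o' t) y)"
    for x y a
    unfolding ip_def
    by (simp add: left_diff_distrib sum_subtractf sum_distrib_left sum_distrib_right mult.assoc)
       (rule sum.swap)
  have \<beta>_orth: "ip \<beta> (o' s) = 0" if s: "s < n" for s
  proof -
    have "(\<Sum>t<n. ip (\<alpha> n) (o' t) * ip (o' t) (o' s)) = (\<Sum>t\<in>{s}. ip (\<alpha> n) (o' t) * ip (o' t) (o' s))"
      using s orth by (intro sum.mono_neutral_right) (auto simp: ip_def)
    also have "\<dots> = ip (\<alpha> n) (o' s)"
    proof (cases "(\<Sum>l<d. (norm (o' s l))\<^sup>2) = 1")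
      case False
      then have "(\<Sum>l<d. (norm (o' s l))\<^sup>2) = 0" using unit[OF s] by blast
      then have "\<forall>l\<in>{..<d}. (norm (o' s l))\<^sup>2 = 0" by (subst (asm) sum_nonneg_eq_0_iff) auto
      then have "o' s l = 0" if "l < d" for l using that by simp
      then show ?thesis by (simp add: ip_def)
    qed (simp add: self)
    finally show ?thesis unfolding \<beta>_def ip_linear by simp
  qed
  \<comment> \<open>If \<open>N\<close> is 0 then \<beta> vanishes on the range, and division by
    zero returns the zero vector wanted here.\<close>
  define o2 where "o2 t = (if t < n then o' t else (\<lambda>l. \<beta> l / of_real N))" for t
  define c2 where "c2 s t = (if s < n then (if t < n then c s t else 0)
    else if t < n then ip (\<alpha> n) (o' t) else of_real N)" for s t
  have new_orth: "ip (o2 n) (o' s) = 0" "ip (o' s) (o2 n) = 0" if "s < n" for s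
  proof -
    show 1: "ip (o2 n) (o' s) = 0"
      using \<beta>_orth[OF that] by (simp add: o2_def ip_def sum_divide_distrib[symmetric])
    have "ip (o' s) (o2 n) = cnj (ip (o2 n) (o' s))"
      by (simp add: ip_def mult.commute)
    then show "ip (o' s) (o2 n) = 0" using 1 by simp
  qed
  have "ip (o2 s) (o2 t) = 0" if st: "s < Suc n" "t < Suc n" "s \<noteq> t" for s t
  proof -
    consider "s < n" "t < n" | "s = n" "t < n" | "s < n" "t = n" using st by (auto simp: less_Suc_eq)
    then show ?thesis
    proof cases
      case 1 then show ?thesis using orth[OF _ _ st(3)] by (simp add: o2_def ip_def)
    next
      case 2 then show ?thesis using new_orth(1)[of t] by (simp add: o2_def)
    next
      case 3 then show ?thesis using new_orth(2)[of s] by (simp add: o2_def)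
    qed
  qed
  moreover have "(\<Sum>l<d. (norm (o2 s l))\<^sup>2) \<in> {0, 1}" if "s < Suc n" for s
  proof (cases "s < n")
    case True then show ?thesis using unit[OF True] by (simp add: o2_def)
  next
    case False
    then have "(\<Sum>l<d. (norm (o2 s l))\<^sup>2) = (\<Sum>l<d. (norm (\<beta> l))\<^sup>2) / N\<^sup>2"
      by (simp add: o2_def norm_divide power_divide sum_divide_distrib)
    also have "\<dots> \<in> {0, 1}" unfolding N2[symmetric] by simp
    finally show ?thesis .
  qed
  moreover have "\<alpha> s l = (\<Sum>t<Suc n. c2 s t * o2 t l)" if "s < Suc n" and l: "l < d" for s l
  proof (cases "s < n")
    case True
    then show ?thesis using span[OF True l] by (simp add: o2_def c2_def)
  next
    case False
    then have s: "s = n" using that by simp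
    have N\<beta>: "of_real N * (\<beta> l / of_real N) = \<beta> l"
    proof (cases "N = 0")
      case True
      then have "\<forall>l\<in>{..<d}. (norm (\<beta> l))\<^sup>2 = 0"
        using N2 by (subst sum_nonneg_eq_0_iff[symmetric]) auto
      then show ?thesis using l by simp
    qed simp
    have "(\<Sum>t<Suc n. c2 s t * o2 t l)
        = (\<Sum>t<n. ip (\<alpha> n) (o' t) * o' t l) + of_real N * (\<beta> l / of_real N)"
      by (simp add: s o2_def c2_def)
    then show ?thesis unfolding N\<beta> by (simp add: \<beta>_def s)
  qed
  ultimately show ?case
    unfolding ip_def by (intro exI[of _ o2] exI[of _ c2] conjI allI impI) simp_all
qed simp

lemma sum_swap3:
  "(\<Sum>k\<in>A. \<Sum>s\<in>B. \<Sum>t\<in>C. F k s t) = (\<Sum>s\<in>B. \<Sum>t\<in>C. \<Sum>k\<in>A. F k s t)"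
  by (rule trans[OF sum.swap], rule sum.cong[OF refl], rule sum.swap)

text \<open>Expanding the columns of M in an orthogonal family writes M as \<open>n\<close> dyads
  that are orthogonal in the Frobenius inner product. The trace is estimated by Cauchy-Schwarz
  inside each dyad and then over the \<open>n\<close> of them.\<close>

lemma trace_squared_le_rank_mult_frobenius:
  fixes M :: "nat \<Rightarrow> nat \<Rightarrow> complex"
  assumes M: "\<And>l k. l < d \<Longrightarrow> k < d \<Longrightarrow> M l k = (\<Sum>s<n. \<alpha> s l * \<beta> s k)"
  shows "(norm (\<Sum>l<d. M l l))\<^sup>2 \<le> real n * (\<Sum>l<d. \<Sum>k<d. (norm (M l k))\<^sup>2)"
proof -
  obtain o' c where orth: "\<forall>s<n. \<forall>t<n. s \<noteq> t \<longrightarrow> (\<Sum>l<d. o' s l * cnj (o' t l)) = 0"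
    and unit: "\<forall>s<n. (\<Sum>l<d. (norm (o' s l))\<^sup>2) \<in> {0, 1}"
    and span: "\<forall>s<n. \<forall>l<d. \<alpha> s l = (\<Sum>t<n. c s t * o' t l)"
    using orthonormal_spanning_family[of n d \<alpha>] by (elim exE conjE)
  note orth = orth[rule_format] and unit = unit[rule_format] and span = span[rule_format]
  define \<gamma> where "\<gamma> t k = (\<Sum>s<n. c s t * \<beta> s k)" for t k
  define W where "W t = (\<Sum>l<d. (norm (o' t l))\<^sup>2)" for t
  have M': "M l k = (\<Sum>t<n. o' t l * \<gamma> t k)" if "l < d" "k < d" for l k
    unfolding M[OF that] \<gamma>_def sum_distrib_left
    by (subst sum.swap) (simp add: span that sum_distrib_left sum_distrib_right mult_ac)
  have "(\<Sum>l<d. M l l) = (\<Sum>t<n. \<Sum>l<d. o' t l * \<gamma> t l)"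
    by (subst sum.swap) (simp add: M')
  then have "(norm (\<Sum>l<d. M l l))\<^sup>2 \<le> real n * (\<Sum>t<n. (norm (\<Sum>l<d. o' t l * \<gamma> t l))\<^sup>2)"
    using norm_sum_squared_le_card by simp
  also have "\<dots> \<le> real n * (\<Sum>t<n. W t * (\<Sum>k<d. (norm (\<gamma> t k))\<^sup>2))"
    unfolding W_def by (intro mult_left_mono sum_mono norm_sum_mult_squared_le) auto
  \<comment> \<open>Orthogonality of the \<open>o' t\<close> removes all mixed terms, so the squared
    Frobenius norms of the dyads add up.\<close>
  also have "(\<Sum>t<n. W t * (\<Sum>k<d. (norm (\<gamma> t k))\<^sup>2)) = (\<Sum>l<d. \<Sum>k<d. (norm (M l k))\<^sup>2)"
  proof -
    have "complex_of_real (\<Sum>l<d. \<Sum>k<d. (norm (M l k))\<^sup>2)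
        = (\<Sum>l<d. \<Sum>k<d. (\<Sum>s<n. o' s l * \<gamma> s k) * (\<Sum>t<n. cnj (o' t l) * cnj (\<gamma> t k)))"
      by (simp add: complex_norm_square M' del: of_real_power)
    also have "\<dots> = (\<Sum>l<d. \<Sum>k<d. \<Sum>s<n. \<Sum>t<n. (o' s l * cnj (o' t l)) * (\<gamma> s k * cnj (\<gamma> t k)))"
      by (simp add: sum_product mult_ac)
    also have "\<dots> = (\<Sum>l<d. \<Sum>s<n. \<Sum>t<n. \<Sum>k<d. (o' s l * cnj (o' t l)) * (\<gamma> s k * cnj (\<gamma> t k)))"
      by (rule sum.cong[OF refl], rule sum_swap3)
    also have "\<dots> = (\<Sum>s<n. \<Sum>t<n. \<Sum>l<d. \<Sum>k<d. (o' s l * cnj (o' t l)) * (\<gamma> s k * cnj (\<gamma> t k)))"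
      by (rule sum_swap3)
    also have "\<dots> = (\<Sum>s<n. \<Sum>t<n. (\<Sum>l<d. o' s l * cnj (o' t l)) * (\<Sum>k<d. \<gamma> s k * cnj (\<gamma> t k)))"
      by (simp add: sum_product)
    also have "\<dots> = (\<Sum>s<n. of_real (W s * (\<Sum>k<d. (norm (\<gamma> s k))\<^sup>2)))"
    proof (rule sum.cong[OF refl])
      fix s assume s: "s \<in> {..<n}"
      have "(\<Sum>t<n. (\<Sum>l<d. o' s l * cnj (o' t l)) * (\<Sum>k<d. \<gamma> s k * cnj (\<gamma> t k)))
          = (\<Sum>t\<in>{s}. (\<Sum>l<d. o' s l * cnj (o' t l)) * (\<Sum>k<d. \<gamma> s k * cnj (\<gamma> t k)))"
        using s orth by (intro sum.mono_neutral_right) auto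
      then show "(\<Sum>t<n. (\<Sum>l<d. o' s l * cnj (o' t l)) * (\<Sum>k<d. \<gamma> s k * cnj (\<gamma> t k)))
          = of_real (W s * (\<Sum>k<d. (norm (\<gamma> s k))\<^sup>2))"
        by (simp add: W_def complex_norm_square del: of_real_power)
    qed
    finally have "complex_of_real (\<Sum>l<d. \<Sum>k<d. (norm (M l k))\<^sup>2)
        = complex_of_real (\<Sum>s<n. W s * (\<Sum>k<d. (norm (\<gamma> s k))\<^sup>2))"
      by (simp only: of_real_sum)
    then show ?thesis by (simp only: of_real_eq_iff)
  qed
  finally show ?thesis .
qed

lemma trace_squared_le_dim_mult_frobenius:
  fixes M :: "nat \<Rightarrow> nat \<Rightarrow> complex"
  shows "(norm (\<Sum>l<d. M l l))\<^sup>2 \<le> real d * (\<Sum>l<d. \<Sum>k<d. (norm (M l k))\<^sup>2)"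
proof -
  have "(\<Sum>l<d. (norm (M l l))\<^sup>2) \<le> (\<Sum>l<d. \<Sum>k<d. (norm (M l k))\<^sup>2)"
    by (intro sum_mono member_le_sum) auto
  then show ?thesis
    using norm_sum_squared_le_card[of "\<lambda>l. M l l" d]
    by (meson mult_left_mono of_nat_0_le_iff order_trans)
qed

section \<open>Taylor coefficients at the origin\<close>

definition coeff0 :: "(complex \<Rightarrow> complex) \<Rightarrow> nat \<Rightarrow> complex" where
  "coeff0 H k = fps_nth (fps_expansion H 0) k"

lemma coeff0_higher_deriv: "coeff0 H k = (deriv ^^ k) H 0 / fact k"
  by (simp add: coeff0_def fps_expansion_def)

lemma coeff0_eqI: "H has_fps_expansion F \<Longrightarrow> coeff0 H k = fps_nth F k"
  by (simp add: coeff0_def fps_expansion_eqI)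

lemma has_fps_expansion_disc:
  "H holomorphic_on ball 0 1 \<Longrightarrow> H has_fps_expansion fps_expansion H 0"
  by (rule has_fps_expansion_fps_expansion[of "ball 0 1"]) auto

lemma coeff0_sums:
  assumes "H holomorphic_on ball 0 1" "z \<in> ball 0 1"
  shows "(\<lambda>k. coeff0 H k * z ^ k) sums H z"
  using holomorphic_power_series[OF assms] by (simp add: coeff0_higher_deriv)

lemma norm_coeff0_le:
  assumes "H holomorphic_on ball 0 1" "0 < r" "r < 1" "\<And>z. z \<in> cball 0 r \<Longrightarrow> norm (H z) \<le> B"
  shows "norm (coeff0 H k) \<le> B / r ^ k"
proof -
  have "norm ((deriv ^^ k) H 0) \<le> fact k * B / r ^ k"
  proof (rule Cauchy_inequality)
    show "H holomorphic_on ball 0 r" "continuous_on (cball 0 r) H"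
      using assms by (auto intro!: holomorphic_on_imp_continuous_on intro: holomorphic_on_subset)
  qed (use assms in auto)
  then show ?thesis by (simp add: coeff0_higher_deriv norm_divide field_simps)
qed

lemma coeff0_add:
  assumes "H holomorphic_on ball 0 1" "G holomorphic_on ball 0 1"
  shows "coeff0 (\<lambda>z. H z + G z) k = coeff0 H k + coeff0 G k"
  using coeff0_eqI[OF has_fps_expansion_add[OF assms[THEN has_fps_expansion_disc]], of k]
  by (simp add: coeff0_def)

lemma coeff0_cmult:
  assumes "H holomorphic_on ball 0 1"
  shows "coeff0 (\<lambda>z. c * H z) k = c * coeff0 H k"
  using coeff0_eqI[OF has_fps_expansion_cmult_left[OF has_fps_expansion_disc[OF assms]], of c k]
  by (simp add: coeff0_def)

lemma coeff0_mult_power: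
  assumes "H holomorphic_on ball 0 1"
  shows "coeff0 (\<lambda>z. z ^ j * H z) k = (if k < j then 0 else coeff0 H (k - j))"
  using coeff0_eqI[OF has_fps_expansion_mult[OF has_fps_expansion_fps_X_power
        has_fps_expansion_disc[OF assms]], of j k]
  by (simp add: coeff0_def fps_X_power_mult_nth)

lemma coeff0_deriv:
  assumes "H holomorphic_on ball 0 1"
  shows "coeff0 (deriv H) k = of_nat (k + 1) * coeff0 H (k + 1)"
  using coeff0_eqI[OF has_fps_expansion_deriv[OF has_fps_expansion_disc[OF assms]], of k]
  by (simp add: coeff0_def)

lemma coeff0_cong:
  assumes "\<And>z. z \<in> ball 0 1 \<Longrightarrow> H z = G z"
  shows "coeff0 H k = coeff0 G k"
proof -
  have "eventually (\<lambda>z. H z = G z) (nhds 0)"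
    using eventually_nhds_in_open[of "ball 0 1 :: complex set" 0]
    by (auto elim!: eventually_mono simp: assms)
  then show ?thesis unfolding coeff0_def by (subst fps_expansion_cong) auto
qed

section \<open>Bounded functionals on holomorphic functions of the disc\<close>

text \<open>\<open>\<phi> k\<close> stands for the value of the functional at z^k. Geometric decay
  with ratio \<rho> means that the functional lives on a smaller disc. \<open>R\<close> is placed
  between \<rho> and 1 so that Cauchy estimates on radius \<open>R\<close> are beaten by the decay,
  and \<open>K\<close> bounds the functional in the sup norm over that closed disc.\<close>

locale disc_functional =
  fixes \<phi> :: "nat \<Rightarrow> complex" and A \<rho> :: real
  assumes \<rho>: "0 < \<rho>" "\<rho> < 1" and \<phi>_bound: "\<And>k. norm (\<phi> k) \<le> A * \<rho> ^ k"
begin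

definition Lam :: "(complex \<Rightarrow> complex) \<Rightarrow> complex" where
  "Lam H = (\<Sum>k. coeff0 H k * \<phi> k)"

definition R :: real where "R = (1 + \<rho>) / 2"

definition K :: real where "K = A / (1 - \<rho> / R)"

lemma R: "0 < R" "R < 1" "\<rho> < R" "\<rho> / R < 1"
  using \<rho> by (auto simp: R_def)

lemma Lam_term_bound:
  assumes "H holomorphic_on ball 0 1" "\<And>z. z \<in> cball 0 R \<Longrightarrow> norm (H z) \<le> B"
  shows "norm (coeff0 H k * \<phi> k) \<le> B * A * (\<rho> / R) ^ k"
proof -
  have "0 \<le> B" using assms(2)[of 0] R by (auto intro: order_trans[OF norm_ge_zero])
  have "norm (coeff0 H k * \<phi> k) \<le> (B / R ^ k) * (A * \<rho> ^ k)"
    unfolding norm_mult using R(1,2) assms \<open>0 \<le> B\<close>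
    by (intro mult_mono norm_coeff0_le \<phi>_bound) auto
  then show ?thesis by (simp add: power_divide)
qed

lemma majorant_sums: "(\<lambda>k. B * A * (\<rho> / R) ^ k) sums (K * B)"
proof -
  have "norm (\<rho> / R) < 1" using R \<rho> by simp
  from sums_mult[OF geometric_sums[OF this], of "B * A"] show ?thesis
    by (simp add: K_def mult_ac)
qed

lemma bounded_on_cball:
  assumes "H holomorphic_on ball 0 1"
  obtains B where "\<And>z. z \<in> cball 0 R \<Longrightarrow> norm (H z) \<le> B"
proof -
  have "continuous_on (cball 0 R) H"
    using assms R by (intro holomorphic_on_imp_continuous_on holomorphic_on_subset[OF assms]) auto
  then have "bounded (H ` cball 0 R)"
    by (intro compact_imp_bounded compact_continuous_image) auto
  then obtain B where "\<forall>x\<in>cball 0 R. norm (H x) \<le> B" unfolding bounded_iff by blast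
  then show thesis by (intro that[of B]) blast
qed

lemma Lam_summable:
  assumes H: "H holomorphic_on ball 0 1"
  shows "summable (\<lambda>k. coeff0 H k * \<phi> k)"
proof -
  obtain B where B: "\<And>z. z \<in> cball 0 R \<Longrightarrow> norm (H z) \<le> B"
    using bounded_on_cball[OF H] by blast
  show ?thesis
    by (rule summable_comparison_test'[OF sums_summable[OF majorant_sums], of 0])
      (rule Lam_term_bound[OF H B])
qed

lemma Lam_bound:
  assumes "H holomorphic_on ball 0 1" "\<And>z. z \<in> cball 0 R \<Longrightarrow> norm (H z) \<le> B"
  shows "norm (Lam H) \<le> K * B"
  unfolding Lam_def sums_unique[OF majorant_sums]
  by (rule norm_suminf_le[OF Lam_term_bound[OF assms] sums_summable[OF majorant_sums]])

lemma Lam_cong: "(\<And>z. z \<in> ball 0 1 \<Longrightarrow> H z = G z) \<Longrightarrow> Lam H = Lam G"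
  unfolding Lam_def using coeff0_cong[of H G] by simp

lemma Lam_add:
  assumes "H holomorphic_on ball 0 1" "G holomorphic_on ball 0 1"
  shows "Lam (\<lambda>z. H z + G z) = Lam H + Lam G"
  unfolding Lam_def by (simp add: coeff0_add[OF assms] distrib_right suminf_add Lam_summable assms)

lemma Lam_cmult:
  assumes "H holomorphic_on ball 0 1"
  shows "Lam (\<lambda>z. c * H z) = c * Lam H"
  unfolding Lam_def by (simp add: coeff0_cmult[OF assms] mult.assoc suminf_mult Lam_summable assms)

lemma Lam_zero: "Lam (\<lambda>z. 0) = 0"
  using Lam_cmult[of "\<lambda>z. 0" 0] by simp

lemma Lam_sum:
  assumes "\<And>i. i \<in> I \<Longrightarrow> H i holomorphic_on ball 0 1"
  shows "Lam (\<lambda>z. \<Sum>i\<in>I. c i * H i z) = (\<Sum>i\<in>I. c i * Lam (H i))"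
  using assms
proof (induction I rule: infinite_finite_induct)
  case (insert i I)
  then have "Lam (\<lambda>z. c i * H i z + (\<Sum>i\<in>I. c i * H i z))
      = c i * Lam (H i) + (\<Sum>i\<in>I. c i * Lam (H i))"
    by (subst Lam_add) (auto intro!: holomorphic_intros simp: Lam_cmult)
  then show ?case using insert by simp
qed (simp_all add: Lam_zero)

lemma Lam_power_mult:
  assumes "H holomorphic_on ball 0 1"
  shows "(\<lambda>k. coeff0 H k * \<phi> (k + j)) sums Lam (\<lambda>z. z ^ j * H z)"
proof -
  have "(\<lambda>k. coeff0 (\<lambda>z. z ^ j * H z) k * \<phi> k) sums Lam (\<lambda>z. z ^ j * H z)"
    unfolding Lam_def using assms by (intro summable_sums Lam_summable holomorphic_intros)
  then have "(\<lambda>k. coeff0 (\<lambda>z. z ^ j * H z) (k + j) * \<phi> (k + j)) sums Lam (\<lambda>z. z ^ j * H z)"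
    by (subst sums_zero_iff_shift) (auto simp: coeff0_mult_power[OF assms])
  then show ?thesis by (simp add: coeff0_mult_power[OF assms])
qed

lemma Lam_power: "Lam (\<lambda>z. z ^ j) = \<phi> j"
proof -
  have "coeff0 (\<lambda>z. 1) k = (if k = 0 then 1 else 0)" for k
    using coeff0_eqI[OF has_fps_expansion_1] by simp
  then have "(\<lambda>k. if k = 0 then \<phi> j else 0) = (\<lambda>k. coeff0 (\<lambda>z. 1) k * \<phi> (k + j))"
    by auto
  moreover have "(\<lambda>k. if k = 0 then \<phi> j else 0) sums \<phi> j" using sums_single[of 0 "\<lambda>_. \<phi> j"] by simp
  ultimately show ?thesis
    using sums_unique2 Lam_power_mult[of "\<lambda>z. 1" j] by fastforce
qed

lemma Lam_sesquilinear_bound: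
  fixes \<sigma> :: "'i \<Rightarrow> real"
  assumes a: "\<And>i. i \<in> I \<Longrightarrow> a i holomorphic_on ball 0 1"
    and B: "\<And>z w. z \<in> cball 0 R \<Longrightarrow> w \<in> cball 0 R \<Longrightarrow>
      norm (\<Sum>i\<in>I. of_real (\<sigma> i) * (a i z * cnj (a i w))) \<le> B"
  shows "\<bar>\<Sum>i\<in>I. \<sigma> i * (norm (Lam (a i)))\<^sup>2\<bar> \<le> K\<^sup>2 * B"
proof -
  have "norm (\<Sum>i\<in>I. (of_real (\<sigma> i) * cnj (Lam (a i))) * a i z) \<le> K * B" if z: "z \<in> cball 0 R" for z
  proof -
    have "norm (Lam (\<lambda>w. \<Sum>i\<in>I. (of_real (\<sigma> i) * cnj (a i z)) * a i w)) \<le> K * B"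
    proof (rule Lam_bound)
      fix w :: complex assume w: "w \<in> cball 0 R"
      show "norm (\<Sum>i\<in>I. (of_real (\<sigma> i) * cnj (a i z)) * a i w) \<le> B"
        using B[OF w z] by (simp add: mult_ac)
    qed (use a in \<open>auto intro!: holomorphic_intros\<close>)
    also have "Lam (\<lambda>w. \<Sum>i\<in>I. (of_real (\<sigma> i) * cnj (a i z)) * a i w)
        = (\<Sum>i\<in>I. (of_real (\<sigma> i) * cnj (a i z)) * Lam (a i))"
      using a by (rule Lam_sum)
    \<comment> \<open>Applied in w with z fixed, the functional returns a function antiholomorphic
      in z; its conjugate is holomorphic with the same norm, so the functional applies
      again.\<close>
    also have "\<dots> = cnj (\<Sum>i\<in>I. (of_real (\<sigma> i) * cnj (Lam (a i))) * a i z)"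
      by (simp add: mult_ac)
    finally show ?thesis by (simp only: complex_mod_cnj)
  qed
  then have "norm (Lam (\<lambda>z. \<Sum>i\<in>I. (of_real (\<sigma> i) * cnj (Lam (a i))) * a i z)) \<le> K * (K * B)"
    using a by (intro Lam_bound) (auto intro!: holomorphic_intros)
  also have "Lam (\<lambda>z. \<Sum>i\<in>I. (of_real (\<sigma> i) * cnj (Lam (a i))) * a i z)
      = (\<Sum>i\<in>I. (of_real (\<sigma> i) * cnj (Lam (a i))) * Lam (a i))"
    using a by (rule Lam_sum)
  also have "\<dots> = of_real (\<Sum>i\<in>I. \<sigma> i * (norm (Lam (a i)))\<^sup>2)"
    by (simp add: complex_norm_square mult_ac del: of_real_power)
  finally show ?thesis unfolding norm_of_real by (simp add: power2_eq_square mult_ac)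
qed

end

section \<open>Truncated Bergman kernels and the energy inequality\<close>

lemma sum_Suc_mult_power:
  fixes x :: "'a :: comm_ring_1"
  shows "(1 - x)\<^sup>2 * (\<Sum>m<N. of_nat (m + 1) * x ^ m)
    = 1 - of_nat (N + 1) * x ^ N + of_nat N * x ^ (N + 1)"
proof (induction N)
  case (Suc N)
  have "(1 - x)\<^sup>2 * (\<Sum>m<Suc N. of_nat (m + 1) * x ^ m)
      = (1 - of_nat (N + 1) * x ^ N + of_nat N * x ^ (N + 1)) + (1 - x)\<^sup>2 * (of_nat (N + 1) * x ^ N)"
    by (simp only: sum.lessThan_Suc distrib_left Suc.IH)
  then show ?case by (simp add: power2_eq_square algebra_simps)
qed simp

text \<open>Repeated division by one linear factor at a time. Repeated nodes are allowed because the
  difference quotient takes the derivative as its value at the node.\<close>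

lemma newton_interpolation:
  fixes a :: "complex \<Rightarrow> complex" and n :: nat
  assumes "a holomorphic_on ball 0 1"
  shows "\<exists>c q. q holomorphic_on ball 0 1 \<and>
    (\<forall>z\<in>ball 0 1. a z = (\<Sum>s<n. c s * (\<Prod>i<s. z - Z i)) + (\<Prod>i<n. z - Z i) * q z)"
proof (induction n)
  case 0
  then show ?case using assms by auto
next
  case (Suc n)
  then obtain c q where q: "q holomorphic_on ball 0 1"
    and a: "\<forall>z\<in>ball 0 1. a z = (\<Sum>s<n. c s * (\<Prod>i<s. z - Z i)) + (\<Prod>i<n. z - Z i) * q z"
    by (elim exE conjE)
  define q' where "q' = (\<lambda>z. if z = Z n then deriv q (Z n) else (q z - q (Z n)) / (z - Z n))"
  have "q' holomorphic_on ball 0 1"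
    unfolding q'_def by (rule pole_lemma_open[OF q open_ball])
  moreover have "a z = (\<Sum>s<Suc n. (if s < n then c s else q (Z n)) * (\<Prod>i<s. z - Z i))
      + (\<Prod>i<Suc n. z - Z i) * q' z" if z: "z \<in> ball 0 1" for z
  proof -
    have "q z = q (Z n) + (z - Z n) * q' z" by (simp add: q'_def)
    then have "a z = (\<Sum>s<n. c s * (\<Prod>i<s. z - Z i)) + (\<Prod>i<n. z - Z i) * (q (Z n) + (z - Z n) * q' z)"
      using a[rule_format, OF z] by simp
    then show ?thesis by (simp add: algebra_simps)
  qed
  ultimately show ?case by (intro exI[of _ "\<lambda>s. if s < n then c s else q (Z n)"] exI[of _ q']) simp
qed

context disc_functional
begin

lemma energy_summable: "summable (\<lambda>m. real (m + 1) * (norm (\<phi> m))\<^sup>2)"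
proof (rule summable_comparison_test')
  have "norm (\<rho>\<^sup>2) < 1" using \<rho> by (simp add: power_less_one_iff)
  then have "(\<lambda>m. of_nat (Suc m) * (\<rho>\<^sup>2) ^ m) sums (1 / (1 - \<rho>\<^sup>2)\<^sup>2)"
    by (rule geometric_deriv_sums)
  then show "summable (\<lambda>m. A\<^sup>2 * (real (Suc m) * (\<rho>\<^sup>2) ^ m))"
    by (intro summable_mult sums_summable)
next
  fix m
  have "(norm (\<phi> m))\<^sup>2 \<le> (A * \<rho> ^ m)\<^sup>2" using \<phi>_bound by (intro power_mono) auto
  then have "real (m + 1) * (norm (\<phi> m))\<^sup>2 \<le> real (m + 1) * (A * \<rho> ^ m)\<^sup>2"
    by (intro mult_left_mono) auto
  then show "norm (real (m + 1) * (norm (\<phi> m))\<^sup>2) \<le> A\<^sup>2 * (real (Suc m) * (\<rho>\<^sup>2) ^ m)"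
    by (simp add: power_mult_distrib power_mult[symmetric] mult_ac)
qed

text \<open>The matrix with entries \<open>Lam (g \<cdot> e l \<cdot> e' k)\<close> has rank at most \<open>n\<close>: modulo the polynomial
  annihilated by \<open>Lam\<close>, every \<open>e l\<close> is a combination of \<open>n\<close> fixed functions.\<close>

lemma Lam_trace_bound:
  assumes annih: "\<And>q. q holomorphic_on ball 0 1 \<Longrightarrow> Lam (\<lambda>z. (\<Prod>i<n. z - Z i) * q z) = 0"
    and hol: "g holomorphic_on ball 0 1" "\<And>l. l < d \<Longrightarrow> e l holomorphic_on ball 0 1"
      "\<And>l. l < d \<Longrightarrow> e' l holomorphic_on ball 0 1"
  shows "(norm (Lam (\<lambda>z. g z * (\<Sum>l<d. e l z * e' l z))))\<^sup>2
    \<le> real (min n d) * (\<Sum>l<d. \<Sum>k<d. (norm (Lam (\<lambda>z. g z * (e l z * e' k z))))\<^sup>2)"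
proof -
  define M where "M l k = Lam (\<lambda>z. g z * (e l z * e' k z))" for l k
  have tr: "Lam (\<lambda>z. g z * (\<Sum>l<d. e l z * e' l z)) = (\<Sum>l<d. M l l)"
  proof -
    have "Lam (\<lambda>z. \<Sum>l<d. 1 * (g z * (e l z * e' l z))) = (\<Sum>l<d. 1 * M l l)"
      unfolding M_def using hol by (intro Lam_sum) (auto intro!: holomorphic_intros)
    then show ?thesis by (simp add: sum_distrib_left)
  qed
  have "\<forall>l. \<exists>c q. l < d \<longrightarrow> q holomorphic_on ball 0 1 \<and>
      (\<forall>z\<in>ball 0 1. e l z = (\<Sum>s<n. c s * (\<Prod>i<s. z - Z i)) + (\<Prod>i<n. z - Z i) * q z)"
    using newton_interpolation[OF hol(2)] by blast
  from choice[OF this] obtain c where "\<forall>l. \<exists>q. l < d \<longrightarrow> q holomorphic_on ball 0 1 \<and>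
      (\<forall>z\<in>ball 0 1. e l z = (\<Sum>s<n. c l s * (\<Prod>i<s. z - Z i)) + (\<Prod>i<n. z - Z i) * q z)" ..
  from choice[OF this] obtain q where cq: "\<forall>l. l < d \<longrightarrow> q l holomorphic_on ball 0 1 \<and>
      (\<forall>z\<in>ball 0 1. e l z = (\<Sum>s<n. c l s * (\<Prod>i<s. z - Z i)) + (\<Prod>i<n. z - Z i) * q l z)" ..
  have "M l k = (\<Sum>s<n. c l s * Lam (\<lambda>z. g z * ((\<Prod>i<s. z - Z i) * e' k z)))"
    if lk: "l < d" "k < d" for l k
  proof -
    have q: "q l holomorphic_on ball 0 1" using cq lk by blast
    have "M l k = Lam (\<lambda>z. (\<Sum>s<n. c l s * (g z * ((\<Prod>i<s. z - Z i) * e' k z)))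
        + (\<Prod>i<n. z - Z i) * (q l z * g z * e' k z))"
      unfolding M_def
    proof (rule Lam_cong)
      fix z :: complex assume "z \<in> ball 0 1"
      then have e: "e l z = (\<Sum>s<n. c l s * (\<Prod>i<s. z - Z i)) + (\<Prod>i<n. z - Z i) * q l z"
        using cq lk by blast
      show "g z * (e l z * e' k z) = (\<Sum>s<n. c l s * (g z * ((\<Prod>i<s. z - Z i) * e' k z)))
          + (\<Prod>i<n. z - Z i) * (q l z * g z * e' k z)"
        unfolding e by (simp add: algebra_simps sum_distrib_left)
    qed
    also have "\<dots> = Lam (\<lambda>z. \<Sum>s<n. c l s * (g z * ((\<Prod>i<s. z - Z i) * e' k z)))
        + Lam (\<lambda>z. (\<Prod>i<n. z - Z i) * (q l z * g z * e' k z))"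
      using hol q lk by (intro Lam_add) (auto intro!: holomorphic_intros)
    also have "Lam (\<lambda>z. (\<Prod>i<n. z - Z i) * (q l z * g z * e' k z)) = 0"
      using hol q lk by (intro annih) (auto intro!: holomorphic_intros)
    also have "Lam (\<lambda>z. \<Sum>s<n. c l s * (g z * ((\<Prod>i<s. z - Z i) * e' k z)))
        = (\<Sum>s<n. c l s * Lam (\<lambda>z. g z * ((\<Prod>i<s. z - Z i) * e' k z)))"
      using hol lk by (intro Lam_sum) (auto intro!: holomorphic_intros)
    finally show ?thesis by simp
  qed
  then have "(norm (\<Sum>l<d. M l l))\<^sup>2 \<le> real n * (\<Sum>l<d. \<Sum>k<d. (norm (M l k))\<^sup>2)"
    by (intro trace_squared_le_rank_mult_frobenius[where \<alpha> = "\<lambda>s l. c l s"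
        and \<beta> = "\<lambda>s k. Lam (\<lambda>z. g z * ((\<Prod>i<s. z - Z i) * e' k z))"])
  moreover have "(norm (\<Sum>l<d. M l l))\<^sup>2 \<le> real d * (\<Sum>l<d. \<Sum>k<d. (norm (M l k))\<^sup>2)"
    by (rule trace_squared_le_dim_mult_frobenius)
  ultimately show ?thesis unfolding tr by (simp add: min_def M_def)
qed

text \<open>Both sums are partial sums for the Bergman kernel $(1 - z \overline{w})^{-2}$, which equals
  $k_f(z,w)^2 (1 - f(z) \overline{f(w)})^{-2}$ for
  $k_f(z,w) = (1 - f(z) \overline{f(w)}) / (1 - z \overline{w})$.\<close>

lemma kernel_partial_sum_bound:
  assumes real: "realizes d f e e'" and \<tau>: "R \<le> \<tau>" "\<tau> < 1"
    and f: "\<And>z. z \<in> cball 0 R \<Longrightarrow> norm (f z) \<le> \<tau>"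
    and z: "z \<in> cball 0 R" and w: "w \<in> cball 0 R"
  shows "norm ((\<Sum>m<N. of_nat (m + 1) * (f z * cnj (f w)) ^ m *
      ((\<Sum>l<d. e l z * cnj (e l w)) * (\<Sum>k<d. e' k z * cnj (e' k w))))
      - (\<Sum>m<N. of_nat (m + 1) * (z * cnj w) ^ m)) \<le> 2 * real (2 * N + 1) * \<tau> ^ N / (1 - R\<^sup>2)\<^sup>2"
proof -
  define x where "x = f z * cnj (f w)"
  define y where "y = z * cnj w"
  define E where "E = (\<Sum>l<d. e l z * cnj (e l w))"
  define E' where "E' = (\<Sum>l<d. e' l z * cnj (e' l w))"
  have zw: "z \<in> ball 0 1" "w \<in> ball 0 1" using z w R by auto
  have nx: "norm x \<le> \<tau>"
  proof -
    have "norm x \<le> \<tau> * 1" unfolding x_def norm_mult complex_mod_cnj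
      using f[OF z] f[OF w] \<tau> R by (intro mult_mono) auto
    then show ?thesis by simp
  qed
  have ny: "norm y \<le> R\<^sup>2" unfolding y_def norm_mult complex_mod_cnj power2_eq_square
    using z w R by (intro mult_mono) auto
  have "R\<^sup>2 \<le> R * 1" unfolding power2_eq_square using R by (intro mult_left_mono) auto
  then have R2: "R\<^sup>2 \<le> \<tau>" "R\<^sup>2 < 1" using \<tau> R by auto
  have "1 - norm y \<le> norm (1 - y)" using norm_triangle_ineq2[of 1 y] by simp
  then have n1y: "1 - R\<^sup>2 \<le> norm (1 - y)" using ny by linarith
  then have y1: "1 - y \<noteq> 0" using R2 by auto
  have E: "E = (1 - x) / (1 - y)" "E' = (1 - x) / (1 - y)"
    using realizesD(4,5)[OF real zw] y1 by (simp_all add: x_def y_def E_def E'_def)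
  have gen: "(E * E') * u - v = ((1 - x)\<^sup>2 * u - (1 - y)\<^sup>2 * v) / (1 - y)\<^sup>2" for u v
    unfolding E using y1 by (simp add: power2_eq_square divide_simps)
  \<comment> \<open>Each truncated sum, multiplied by its squared denominator, is 1 plus terms
    containing an N-th power. The two ones cancel in \<open>D\<close>, which is therefore of order N
    \<tau>^N.\<close>
  define D where "D = (1 - of_nat (N + 1) * x ^ N + of_nat N * x ^ (N + 1))
      - (1 - of_nat (N + 1) * y ^ N + of_nat N * y ^ (N + 1))"
  have "(\<Sum>m<N. of_nat (m + 1) * x ^ m * (E * E')) - (\<Sum>m<N. of_nat (m + 1) * y ^ m)
      = (E * E') * (\<Sum>m<N. of_nat (m + 1) * x ^ m) - (\<Sum>m<N. of_nat (m + 1) * y ^ m)"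
    by (simp only: sum_distrib_left mult_ac)
  also have "\<dots> = ((1 - x)\<^sup>2 * (\<Sum>m<N. of_nat (m + 1) * x ^ m)
      - (1 - y)\<^sup>2 * (\<Sum>m<N. of_nat (m + 1) * y ^ m)) / (1 - y)\<^sup>2"
    by (rule gen)
  also have "\<dots> = D / (1 - y)\<^sup>2"
    unfolding sum_Suc_mult_power D_def ..
  finally have eq: "(\<Sum>m<N. of_nat (m + 1) * x ^ m * (E * E')) - (\<Sum>m<N. of_nat (m + 1) * y ^ m)
      = D / (1 - y)\<^sup>2" .
  have pw: "norm (u ^ N) \<le> \<tau> ^ N" "norm (u ^ (N + 1)) \<le> \<tau> ^ N" if "norm u \<le> \<tau>" for u :: complex
  proof -
    show 1: "norm (u ^ N) \<le> \<tau> ^ N" unfolding norm_power using that by (intro power_mono) auto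
    have "norm u * norm (u ^ N) \<le> 1 * \<tau> ^ N"
      using that \<tau> 1 by (intro mult_mono) auto
    then show "norm (u ^ (N + 1)) \<le> \<tau> ^ N" by (simp add: norm_mult norm_power)
  qed
  have part: "norm (- of_nat (N + 1) * u ^ N + of_nat N * u ^ (N + 1)) \<le> real (2 * N + 1) * \<tau> ^ N"
    if "norm u \<le> \<tau>" for u :: complex
  proof -
    have "norm (- of_nat (N + 1) * u ^ N + of_nat N * u ^ (N + 1))
        \<le> real (N + 1) * norm (u ^ N) + real N * norm (u ^ (N + 1))"
      by (rule order_trans[OF norm_triangle_ineq])
        (simp only: norm_mult norm_minus_cancel norm_of_nat order_refl)
    also have "\<dots> \<le> real (N + 1) * \<tau> ^ N + real N * \<tau> ^ N"
      using pw[OF that] by (intro add_mono mult_left_mono) auto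
    finally show ?thesis by (simp add: algebra_simps)
  qed
  have "D = (- of_nat (N + 1) * x ^ N + of_nat N * x ^ (N + 1))
      - (- of_nat (N + 1) * y ^ N + of_nat N * y ^ (N + 1))"
    by (simp add: D_def algebra_simps)
  also have "norm \<dots> \<le> real (2 * N + 1) * \<tau> ^ N + real (2 * N + 1) * \<tau> ^ N"
    by (rule order_trans[OF norm_triangle_ineq4 add_mono[OF part[OF nx] part[OF order_trans[OF ny R2(1)]]]])
  finally have "norm D \<le> real (2 * N + 1) * \<tau> ^ N + real (2 * N + 1) * \<tau> ^ N" .
  then have D: "norm D \<le> 2 * real (2 * N + 1) * \<tau> ^ N" by (simp add: algebra_simps)
  have "norm (D / (1 - y)\<^sup>2) \<le> 2 * real (2 * N + 1) * \<tau> ^ N / (1 - R\<^sup>2)\<^sup>2"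
    unfolding norm_divide norm_power
    using D n1y R2 order_trans[OF norm_ge_zero D] by (intro frac_le power_mono) auto
  then show ?thesis unfolding eq[symmetric] by (simp add: x_def y_def E_def E'_def)
qed

text \<open>The uniform estimate for the difference of the truncated kernels becomes an estimate for
  the difference of the truncated energies. Strictness of |f| < 1 is what provides, by compactness,
  a common bound \<tau> < 1 on the closed disc of radius \<open>R\<close>.\<close>

lemma kernel_energy_bound:
  assumes real: "realizes d f e e'" and f: "\<And>z. z \<in> ball 0 1 \<Longrightarrow> norm (f z) < 1"
  shows "(\<Sum>m<N. real (m + 1) * (\<Sum>l<d. \<Sum>k<d. (norm (Lam (\<lambda>z. f z ^ m * (e l z * e' k z))))\<^sup>2))
    \<le> (\<Sum>m. real (m + 1) * (norm (\<phi> m))\<^sup>2)"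
proof -
  note hol = realizesD(1-3)[OF real]
  have sub: "cball 0 R \<subseteq> (ball 0 1 :: complex set)" using R by auto
  obtain \<tau>0 where \<tau>0: "\<tau>0 < 1" "\<And>z. z \<in> cball 0 R \<Longrightarrow> norm (f z) \<le> \<tau>0"
  proof -
    have "continuous_on (cball 0 R) (\<lambda>z. norm (f z))"
      using hol(1) sub by (intro continuous_on_norm holomorphic_on_imp_continuous_on)
        (rule holomorphic_on_subset)
    moreover have "cball (0::complex) R \<noteq> {}" using R by auto
    ultimately obtain x where "x \<in> cball 0 R" "\<forall>y\<in>cball 0 R. norm (f y) \<le> norm (f x)"
      using continuous_attains_sup[OF compact_cball] by blast
    then show thesis using that[of "norm (f x)"] f sub by blast
  qed
  define \<tau> where "\<tau> = max R \<tau>0"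
  have \<tau>: "R \<le> \<tau>" "\<tau> < 1" "\<And>z. z \<in> cball 0 R \<Longrightarrow> norm (f z) \<le> \<tau>"
    using R \<tau>0(1) \<tau>0(2) by (auto simp: \<tau>_def max.coboundedI2)
  define T where "T N = (\<Sum>m<N. real (m + 1) *
      (\<Sum>l<d. \<Sum>k<d. (norm (Lam (\<lambda>z. f z ^ m * (e l z * e' k z))))\<^sup>2))" for N
  define S where "S = (\<Sum>m. real (m + 1) * (norm (\<phi> m))\<^sup>2)"
  define \<delta> where "\<delta> N = 2 * real (2 * N + 1) * \<tau> ^ N / (1 - R\<^sup>2)\<^sup>2" for N
  have T: "T N \<le> S + K\<^sup>2 * \<delta> N" for N
  proof -
    \<comment> \<open>The disjoint union carries both expansions: positive weights for the family
      built from f, negative weights for the monomials.\<close>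
    define I where "I = ({..<N} \<times> {..<d} \<times> {..<d}) <+> {..<N}"
    define \<sigma> :: "nat \<times> nat \<times> nat + nat \<Rightarrow> real"
      where "\<sigma> = case_sum (\<lambda>(m, l, k). real (m + 1)) (\<lambda>m. - real (m + 1))"
    define a :: "nat \<times> nat \<times> nat + nat \<Rightarrow> complex \<Rightarrow> complex"
      where "a = case_sum (\<lambda>(m, l, k) z. f z ^ m * (e l z * e' k z)) (\<lambda>m z. z ^ m)"
    have split: "(\<Sum>i\<in>I. G i) = (\<Sum>m<N. \<Sum>l<d. \<Sum>k<d. G (Inl (m, l, k))) + (\<Sum>m<N. G (Inr m))"
      for G :: "_ \<Rightarrow> 'b :: comm_monoid_add"
      unfolding I_def by (subst sum.Plus) (auto simp: sum.cartesian_product case_prod_unfold)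
    have "\<bar>\<Sum>i\<in>I. \<sigma> i * (norm (Lam (a i)))\<^sup>2\<bar> \<le> K\<^sup>2 * \<delta> N"
    proof (rule Lam_sesquilinear_bound)
      show "a i holomorphic_on ball 0 1" if "i \<in> I" for i
        using that hol unfolding I_def a_def by (auto intro!: holomorphic_intros)
    next
      fix z w :: complex assume zw: "z \<in> cball 0 R" "w \<in> cball 0 R"
      have "(\<Sum>i\<in>I. of_real (\<sigma> i) * (a i z * cnj (a i w)))
        = (\<Sum>m<N. of_nat (m + 1) * (f z * cnj (f w)) ^ m *
            ((\<Sum>l<d. e l z * cnj (e l w)) * (\<Sum>k<d. e' k z * cnj (e' k w))))
          - (\<Sum>m<N. of_nat (m + 1) * (z * cnj w) ^ m)"
        unfolding split sum_product
        by (simp add: \<sigma>_def a_def sum_distrib_left power_mult_distrib sum_negf mult_ac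
            del: of_nat_add of_nat_Suc)
      then show "norm (\<Sum>i\<in>I. of_real (\<sigma> i) * (a i z * cnj (a i w))) \<le> \<delta> N"
        unfolding \<delta>_def using kernel_partial_sum_bound[OF real \<tau> zw] by simp
    qed
    moreover have "(\<Sum>i\<in>I. \<sigma> i * (norm (Lam (a i)))\<^sup>2) = T N - (\<Sum>m<N. real (m + 1) * (norm (\<phi> m))\<^sup>2)"
      unfolding split T_def
      by (simp add: \<sigma>_def a_def Lam_power sum_distrib_left sum_negf del: of_nat_add of_nat_Suc)
    moreover have "(\<Sum>m<N. real (m + 1) * (norm (\<phi> m))\<^sup>2) \<le> S"
      unfolding S_def by (intro sum_le_suminf energy_summable) auto
    ultimately show ?thesis by linarith
  qed
  have "(\<lambda>N. S + K\<^sup>2 * \<delta> N) \<longlonglongrightarrow> S + K\<^sup>2 * 0"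
  proof (intro tendsto_intros)
    have "norm \<tau> < 1" using \<tau> R by auto
    then have "(\<lambda>N. (4 * (real N * \<tau> ^ N) + 2 * \<tau> ^ N) / (1 - R\<^sup>2)\<^sup>2) \<longlonglongrightarrow> (4 * 0 + 2 * 0) / (1 - R\<^sup>2)\<^sup>2"
      by (intro tendsto_intros powser_times_n_limit_0 LIMSEQ_power_zero)
        (use R in \<open>auto simp: power2_eq_1_iff\<close>)
    then show "\<delta> \<longlonglongrightarrow> 0" by (simp add: \<delta>_def[abs_def] algebra_simps)
  qed
  then have lim: "(\<lambda>N. S + K\<^sup>2 * \<delta> N) \<longlonglongrightarrow> S" by simp
  \<comment> \<open>Monotonicity fixes N and lets the error at M tend to 0.\<close>
  have "T N \<le> T M" if "N \<le> M" for M
    unfolding T_def using that by (intro sum_mono2) (auto intro!: mult_nonneg_nonneg sum_nonneg)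
  then have "T N \<le> S"
    using T by (intro LIMSEQ_le_const[OF lim]) (meson order_trans)
  then show ?thesis by (simp add: T_def S_def)
qed

text \<open>The trace bound is applied to each m, then the energy bound to the weighted sum.
  Unimodular constants, for which the strict bound fails, have derivative 0 and are settled
  separately.\<close>

lemma energy_contraction:
  assumes annih: "\<And>q. q holomorphic_on ball 0 1 \<Longrightarrow> Lam (\<lambda>z. (\<Prod>i<n. z - Z i) * q z) = 0"
    and f: "rational_inner d f"
  shows "(\<Sum>m<N. real (m + 1) * (norm (Lam (\<lambda>z. f z ^ m * deriv f z)))\<^sup>2)
    \<le> real (min n d) * (\<Sum>m. real (m + 1) * (norm (\<phi> m))\<^sup>2)"
proof (cases "\<exists>\<xi>\<in>ball 0 1. norm (f \<xi>) = 1")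
  case True
  then obtain \<xi> where \<xi>: "\<xi> \<in> ball 0 1" "norm (f \<xi>) = 1" by blast
  have hol: "f holomorphic_on ball 0 1" using f realizesD(1) unfolding rational_inner_def by blast
  have "f constant_on ball 0 1"
    by (rule maximum_modulus_principle[OF hol open_ball _ open_ball order_refl \<xi>(1)])
      (use rational_inner_norm_le[OF f] \<xi> in auto)
  then obtain c where c: "\<And>z. z \<in> ball 0 1 \<Longrightarrow> f z = c" unfolding constant_on_def by blast
  have "deriv f z = 0" if z: "z \<in> ball 0 1" for z
  proof (rule DERIV_imp_deriv)
    have "((\<lambda>_. c) has_field_derivative 0) (at z)" by simp
    from this open_ball z show "(f has_field_derivative 0) (at z)"
      by (rule has_field_derivative_transform_within_open) (simp add: c)
  qed
  then have "Lam (\<lambda>z. f z ^ m * deriv f z) = 0" for m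
    using Lam_zero Lam_cong[of "\<lambda>z. f z ^ m * deriv f z" "\<lambda>_. 0"] by simp
  then show ?thesis using suminf_nonneg[OF energy_summable] by simp
next
  case False
  then have f1: "norm (f z) < 1" if "z \<in> ball 0 1" for z
    using rational_inner_norm_le[OF f that] that by (auto simp: less_le)
  obtain e e' where real: "realizes d f e e'" using f unfolding rational_inner_def by blast
  note hol = realizesD(1-3)[OF real]
  have "(norm (Lam (\<lambda>z. f z ^ m * deriv f z)))\<^sup>2 \<le> real (min n d) *
      (\<Sum>l<d. \<Sum>k<d. (norm (Lam (\<lambda>z. f z ^ m * (e l z * e' k z))))\<^sup>2)" for m
  proof -
    have "Lam (\<lambda>z. f z ^ m * deriv f z) = Lam (\<lambda>z. f z ^ m * (\<Sum>l<d. e l z * e' l z))"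
      by (rule Lam_cong) (simp add: DERIV_imp_deriv[OF realizesD(6)[OF real]])
    moreover have "(norm (Lam (\<lambda>z. f z ^ m * (\<Sum>l<d. e l z * e' l z))))\<^sup>2 \<le> real (min n d) *
        (\<Sum>l<d. \<Sum>k<d. (norm (Lam (\<lambda>z. f z ^ m * (e l z * e' k z))))\<^sup>2)"
    proof (rule Lam_trace_bound[where Z = Z])
      show "(\<lambda>z. f z ^ m) holomorphic_on ball 0 1" using hol(1) by (intro holomorphic_intros)
    qed (use annih hol in auto)
    ultimately show ?thesis by (simp only:)
  qed
  then have "(\<Sum>m<N. real (m + 1) * (norm (Lam (\<lambda>z. f z ^ m * deriv f z)))\<^sup>2)
      \<le> (\<Sum>m<N. real (m + 1) * (real (min n d) *
        (\<Sum>l<d. \<Sum>k<d. (norm (Lam (\<lambda>z. f z ^ m * (e l z * e' k z))))\<^sup>2)))"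
    by (intro sum_mono mult_left_mono) auto
  also have "\<dots> = real (min n d) * (\<Sum>m<N. real (m + 1) *
        (\<Sum>l<d. \<Sum>k<d. (norm (Lam (\<lambda>z. f z ^ m * (e l z * e' k z))))\<^sup>2))"
    by (simp only: sum_distrib_left mult.left_commute)
  also have "\<dots> \<le> real (min n d) * (\<Sum>m. real (m + 1) * (norm (\<phi> m))\<^sup>2)"
    by (intro mult_left_mono kernel_energy_bound[OF real f1]) auto
  finally show ?thesis .
qed

end

section \<open>Coordinates on the symmetrized polydisc\<close>

text \<open>Absorbs the index shift of vectors and supplies the values 1 at 0 and 0 beyond n, so
  that generating series have no boundary cases.\<close>

definition esym_ext :: "nat \<Rightarrow> complex Matrix.vec \<Rightarrow> nat \<Rightarrow> complex" where
  "esym_ext n u k = (if k = 0 then 1 else if k \<le> n then u $ (k - 1) else 0)"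

lemma esym_0: "esym 0 Z = 1"
proof -
  have "{I. I \<subseteq> {..<dim_vec Z} \<and> card I = 0} = {{}}" by (auto dest: finite_subset)
  then show ?thesis by (simp add: esym_def)
qed

lemma esym_ext_sym_map: "k \<le> n \<Longrightarrow> esym_ext n (sym_map n Z) k = esym k Z"
  by (cases k) (simp_all add: esym_ext_def esym_0 sym_map_def)

lemma prod_linear_sym_map:
  assumes "Z \<in> carrier_vec n"
  shows "(\<Prod>i<n. x - Z $ i) = (\<Sum>k\<le>n. (-1) ^ k * esym_ext n (sym_map n Z) k * x ^ (n - k))"
  unfolding prod_linear_esym[OF assms] by (intro sum.cong) (simp_all add: esym_ext_sym_map)

lemma coeff_sum_monom_rev:
  fixes c :: "nat \<Rightarrow> 'a :: comm_monoid_add"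
  assumes "j \<le> n"
  shows "Polynomial.coeff (\<Sum>k\<le>n. Polynomial.monom (c k) (n - k)) (n - j) = c j"
proof -
  have "(\<Sum>k\<le>n. Polynomial.coeff (Polynomial.monom (c k) (n - k)) (n - j))
      = (\<Sum>k\<le>n. if k = j then c k else 0)"
    using assms by (intro sum.cong) (auto simp: coeff_monom)
  then show ?thesis using assms by (simp add: coeff_sum)
qed

text \<open>The roots of the monic polynomial with coefficients (-1)^k u_k give Z. Over all of C^n
  there is no constraint on the roots; the next lemma controls their size.\<close>

lemma sym_map_surj:
  assumes "u \<in> carrier_vec n"
  obtains Z where "Z \<in> carrier_vec n" "sym_map n Z = u"
proof -
  define p where "p = (\<Sum>k\<le>n. Polynomial.monom ((-1) ^ k * esym_ext n u k) (n - k))"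
  have cn: "Polynomial.coeff p n = 1"
    using coeff_sum_monom_rev[of 0 n "\<lambda>k. (-1) ^ k * esym_ext n u k"] by (simp add: p_def esym_ext_def)
  have "degree p \<le> n"
    unfolding p_def by (intro degree_sum_le) (auto intro: order_trans[OF degree_monom_le])
  then have deg: "degree p = n" using cn by (intro antisym le_degree) auto
  then have "p \<noteq> 0" "lead_coeff p = 1" using cn by auto
  then obtain A where A: "size A = n" "p = (\<Prod>x\<in>#A. [:- x, 1:])"
    using alg_closed_imp_factorization[of p] deg by auto
  obtain xs where xs: "mset xs = A" using ex_mset by blast
  define Z where "Z = vec_of_list xs"
  have len: "length xs = n" using A xs by (metis size_mset)
  then have Z: "Z \<in> carrier_vec n" unfolding Z_def by (intro carrier_vecI) simp
  have "p = (\<Prod>x\<leftarrow>xs. [:- x, 1:])" using A(2) unfolding xs[symmetric]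
    by (simp add: prod_mset_prod_list mset_map[symmetric] del: mset_map)
  also have "\<dots> = (\<Prod>i<n. [:- (Z $ i), 1:])"
    by (simp add: prod.list_conv_set_nth len Z_def atLeast0LessThan vec_of_list_index)
  finally have p: "p = (\<Prod>i<n. [:- (Z $ i), 1:])" .
  have "poly p x = poly (\<Sum>k\<le>n. Polynomial.monom ((-1) ^ k * esym k Z) (n - k)) x" for x
    unfolding p using prod_linear_esym[OF Z, of x] by (simp add: poly_prod poly_sum poly_monom)
  then have "p = (\<Sum>k\<le>n. Polynomial.monom ((-1) ^ k * esym k Z) (n - k))"
    by (simp add: poly_eq_poly_eq_iff[symmetric] fun_eq_iff)
  then have "(-1) ^ k * esym_ext n u k = (-1) ^ k * esym k Z" if "k \<le> n" for k
    using coeff_sum_monom_rev[OF that, of "\<lambda>k. (-1) ^ k * esym_ext n u k"]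
      coeff_sum_monom_rev[OF that, of "\<lambda>k. (-1) ^ k * esym k Z"] by (simp add: p_def)
  then have *: "esym_ext n u k = esym k Z" if "k \<le> n" for k using that by simp
  have "sym_map n Z = u"
  proof (rule eq_vecI)
    fix k assume "k < dim_vec u"
    then have "k < n" using assms by simp
    then show "sym_map n Z $ k = u $ k"
      using *[of "Suc k"] by (simp add: sym_map_def esym_ext_def)
  qed (use assms in \<open>simp add: sym_map_def\<close>)
  from that[OF Z this] show thesis .
qed

text \<open>Openness of the domain with uniform control of the roots, by a direct comparison: at a
  root \<zeta> of the perturbed polynomial with |\<zeta>| > \<rho>, the original polynomial is small
  because the coefficients are close, yet at least (\<delta> |\<zeta>|)^n because \<zeta> is far
  from its roots.\<close>

lemma sym_polydisc_neighbourhood: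
  assumes u: "u \<in> sym_polydisc n"
  obtains \<epsilon> \<rho> where "0 < \<epsilon>" "0 < \<rho>" "\<rho> < 1"
    "\<And>u'. u' \<in> carrier_vec n \<Longrightarrow> (\<And>k. k < n \<Longrightarrow> norm (u' $ k - u $ k) \<le> \<epsilon>) \<Longrightarrow>
      u' \<in> sym_polydisc n \<and> (\<forall>i<n. norm (desym n u' $ i) \<le> \<rho>)"
proof -
  define Z where "Z = desym n u"
  have Zp: "Z \<in> polydisc n" and Zu: "sym_map n Z = u" using desym[OF u] by (simp_all add: Z_def)
  have Z: "Z \<in> carrier_vec n" using Zp by (simp add: polydisc_def)
  \<comment> \<open>The inserted 1/2 keeps the set nonempty and \<open>r\<close> positive.\<close>
  define r where "r = Max (insert (1/2) ((\<lambda>i. norm (Z $ i)) ` {..<n}))"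
  have r1: "r < 1" "1/2 \<le> r" and rZ: "\<And>i. i < n \<Longrightarrow> norm (Z $ i) \<le> r"
  proof -
    show "r < 1" using Zp unfolding r_def by (auto simp: polydisc_def)
    show "1/2 \<le> r" unfolding r_def by (rule Max_ge) auto
    show "norm (Z $ i) \<le> r" if "i < n" for i unfolding r_def using that by (intro Max_ge) auto
  qed
  define \<rho> where "\<rho> = (1 + r) / 2"
  have \<rho>: "0 < \<rho>" "\<rho> < 1" "r < \<rho>" using r1 by (auto simp: \<rho>_def)
  define \<delta> where "\<delta> = 1 - r / \<rho>"
  have \<delta>: "0 < \<delta>" using \<rho> by (simp add: \<delta>_def)
  \<comment> \<open>Chosen so that the n perturbed coefficients contribute together n/(n+1) times
    (\<delta> |\<zeta>|)^n, strictly below the lower bound.\<close>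
  define \<epsilon> where "\<epsilon> = \<delta> ^ n * \<rho> ^ n / real (n + 1)"
  have \<epsilon>: "0 < \<epsilon>" using \<delta> \<rho> by (simp add: \<epsilon>_def)
  have roots: "norm (W $ i) \<le> \<rho>"
    if W: "W \<in> carrier_vec n" and close: "\<And>k. k < n \<Longrightarrow> norm (sym_map n W $ k - u $ k) \<le> \<epsilon>"
      and i: "i < n" for W i
  proof (rule ccontr)
    assume "\<not> norm (W $ i) \<le> \<rho>"
    define \<zeta> where "\<zeta> = W $ i"
    have \<zeta>: "\<rho> < norm \<zeta>" using \<open>\<not> norm (W $ i) \<le> \<rho>\<close> by (simp add: \<zeta>_def)
    then have \<zeta>0: "0 < norm \<zeta>" using \<rho> by linarith
    have "(\<Prod>j<n. \<zeta> - W $ j) = 0" using i by (auto simp: \<zeta>_def)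
    then have "(\<Prod>j<n. \<zeta> - Z $ j) = (\<Prod>j<n. \<zeta> - Z $ j) - (\<Prod>j<n. \<zeta> - W $ j)" by simp
    also have "\<dots> = (\<Sum>k\<le>n. (-1) ^ k * (esym_ext n u k - esym_ext n (sym_map n W) k) * \<zeta> ^ (n - k))"
      unfolding prod_linear_sym_map[OF Z] prod_linear_sym_map[OF W] Zu sum_subtractf[symmetric]
      by (simp add: algebra_simps)
    finally have "norm (\<Prod>j<n. \<zeta> - Z $ j)
        \<le> (\<Sum>k\<le>n. norm ((-1) ^ k * (esym_ext n u k - esym_ext n (sym_map n W) k) * \<zeta> ^ (n - k)))"
      by (simp only: norm_sum)
    also have "\<dots> \<le> (\<Sum>k\<le>n. if k = 0 then 0 else \<epsilon> * (norm \<zeta> ^ n / \<rho> ^ n))"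
    proof (rule sum_mono)
      fix k assume k: "k \<in> {..n}"
      show "norm ((-1) ^ k * (esym_ext n u k - esym_ext n (sym_map n W) k) * \<zeta> ^ (n - k))
          \<le> (if k = 0 then 0 else \<epsilon> * (norm \<zeta> ^ n / \<rho> ^ n))"
      proof (cases "k = 0")
        case False
        have "norm (esym_ext n u k - esym_ext n (sym_map n W) k) \<le> \<epsilon>"
          using close[of "k - 1"] False k by (simp add: esym_ext_def norm_minus_commute)
        moreover have "norm \<zeta> ^ (n - k) \<le> norm \<zeta> ^ n / \<rho> ^ n"
        proof -
          have "\<rho> ^ n \<le> \<rho> ^ k" using k \<rho> by (intro power_decreasing) auto
          also have "\<dots> \<le> norm \<zeta> ^ k" using \<zeta> \<rho> by (intro power_mono) auto
          finally have "norm \<zeta> ^ (n - k) * \<rho> ^ n \<le> norm \<zeta> ^ (n - k) * norm \<zeta> ^ k"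
            by (intro mult_left_mono) auto
          also have "\<dots> = norm \<zeta> ^ n" using k by (simp add: power_add[symmetric])
          finally show ?thesis using \<rho> by (simp add: field_simps)
        qed
        ultimately have "norm (esym_ext n u k - esym_ext n (sym_map n W) k) * norm \<zeta> ^ (n - k)
            \<le> \<epsilon> * (norm \<zeta> ^ n / \<rho> ^ n)"
          using \<epsilon> by (intro mult_mono) auto
        then show ?thesis using False by (simp add: norm_mult norm_power)
      qed (simp add: esym_ext_def)
    qed
    also have "\<dots> = (\<Sum>k\<in>{1..n}. \<epsilon> * (norm \<zeta> ^ n / \<rho> ^ n))"
      by (rule sum.mono_neutral_cong_right) auto
    also have "\<dots> = (real n / real (n + 1)) * (\<delta> * norm \<zeta>) ^ n"
      using \<rho> by (simp add: \<epsilon>_def power_mult_distrib)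
    also have "\<dots> < 1 * (\<delta> * norm \<zeta>) ^ n"
      using \<delta> \<zeta>0 by (intro mult_strict_right_mono zero_less_power mult_pos_pos) auto
    also have "\<dots> \<le> norm (\<Prod>j<n. \<zeta> - Z $ j)"
    proof -
      have "\<delta> * norm \<zeta> \<le> norm (\<zeta> - Z $ j)" if "j < n" for j
      proof -
        have "r * 1 \<le> r * (norm \<zeta> / \<rho>)" using \<zeta> \<rho> r1 by (intro mult_left_mono) auto
        then have "\<delta> * norm \<zeta> \<le> norm \<zeta> - r" by (simp add: \<delta>_def algebra_simps)
        also have "\<dots> \<le> norm \<zeta> - norm (Z $ j)" using rZ[OF that] by simp
        also have "\<dots> \<le> norm (\<zeta> - Z $ j)" by (rule norm_triangle_ineq2)
        finally show ?thesis .
      qed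
      then have "(\<Prod>j<n. \<delta> * norm \<zeta>) \<le> (\<Prod>j<n. norm (\<zeta> - Z $ j))"
        using \<delta> by (intro prod_mono) auto
      then show ?thesis by (simp add: prod_norm)
    qed
    finally show False by simp
  qed
  show thesis
  proof (rule that[OF \<epsilon> \<rho>(1,2)])
    fix u' assume u': "u' \<in> carrier_vec n" and close: "\<And>k. k < n \<Longrightarrow> norm (u' $ k - u $ k) \<le> \<epsilon>"
    obtain W where W: "W \<in> carrier_vec n" "sym_map n W = u'" using sym_map_surj[OF u'] .
    have "W \<in> polydisc n"
      using W(1) roots[OF W(1)] close \<rho>(2) unfolding W(2) polydisc_def
      by (auto intro: le_less_trans)
    then have "u' \<in> sym_polydisc n" using W(2) by (auto simp: sym_polydisc_def)
    moreover from desym[OF this] have "norm (desym n u' $ i) \<le> \<rho>" if "i < n" for i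
      using roots[of "desym n u'" i] close that by (auto simp: polydisc_def)
    ultimately show "u' \<in> sym_polydisc n \<and> (\<forall>i<n. norm (desym n u' $ i) \<le> \<rho>)" by blast
  qed
qed

section \<open>Newton's identities and the moments of a tangent vector\<close>

definition esym_fps :: "nat \<Rightarrow> complex Matrix.vec \<Rightarrow> complex fps" where
  "esym_fps n u = Abs_fps (\<lambda>k. (-1) ^ k * esym_ext n u k)"

definition psum :: "nat \<Rightarrow> complex Matrix.vec \<Rightarrow> nat \<Rightarrow> complex" where
  "psum n u m = (\<Sum>i<n. desym n u $ i ^ m)"

text \<open>The constant term is 0 instead of n, so that the series is -x E'/E with E =
  \<open>esym_fps n u\<close>.\<close>

definition psum_fps :: "nat \<Rightarrow> complex Matrix.vec \<Rightarrow> complex fps" where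
  "psum_fps n u = Abs_fps (\<lambda>m. if m = 0 then 0 else psum n u m)"

text \<open>A tangent vector \<open>v\<close> at \<open>u\<close> is encoded by the power series \<open>moment n u v\<close>. If \<open>v\<close> is the
  image of a tangent vector $(\nu_i)$ at a preimage $(z_i)$ of \<open>u\<close>, this series is
  $\sum_i \nu_i / (1 - z_i x)$, so its coefficients are the moments $\sum_i \nu_i z_i^m$. The quotient
  also makes sense where the roots \<open>z\<^sub>i\<close> collide.\<close>

definition dir_fps :: "nat \<Rightarrow> complex Matrix.vec \<Rightarrow> complex fps" where
  "dir_fps n v = Abs_fps (\<lambda>k. if k < n then (-1) ^ k * v $ k else 0)"

definition moment :: "nat \<Rightarrow> complex Matrix.vec \<Rightarrow> complex Matrix.vec \<Rightarrow> complex fps" where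
  "moment n u v = dir_fps n v * inverse (esym_fps n u)"

lemma esym_fps_sym_map:
  assumes "Z \<in> carrier_vec n"
  shows "esym_fps n (sym_map n Z) = (\<Prod>i<n. 1 - fps_const (Z $ i) * fps_X)"
proof -
  have n: "dim_vec Z = n" using assms by simp
  have "(\<Prod>i<n. 1 - fps_const (Z $ i) * fps_X) = (\<Prod>i<n. (- (fps_const (Z $ i) * fps_X)) + 1)"
    by simp
  also have "\<dots> = (\<Sum>I\<in>Pow {..<n}. (\<Prod>i\<in>I. - (fps_const (Z $ i) * fps_X)) * (\<Prod>i\<in>{..<n} - I. 1))"
    by (rule prod_add) simp
  also have "\<dots> = (\<Sum>I\<in>Pow {..<n}. fps_const ((-1) ^ card I * (\<Prod>i\<in>I. Z $ i)) * fps_X ^ card I)"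
  proof (rule sum.cong[OF refl])
    fix I assume "I \<in> Pow {..<n}"
    have "(\<Prod>i\<in>I. - (fps_const (Z $ i) * fps_X)) = (\<Prod>i\<in>I. fps_const (- (Z $ i)) * fps_X)"
      by (simp add: fps_const_neg[symmetric] del: fps_const_neg)
    also have "\<dots> = (\<Prod>i\<in>I. fps_const (- (Z $ i))) * fps_X ^ card I"
      by (simp add: prod.distrib)
    also have "(\<Prod>i\<in>I. fps_const (- (Z $ i))) = fps_const (\<Prod>i\<in>I. - (Z $ i))"
      by (induction I rule: infinite_finite_induct) (simp_all del: fps_const_neg)
    also have "(\<Prod>i\<in>I. - (Z $ i)) = (-1) ^ card I * (\<Prod>i\<in>I. Z $ i)" by (rule prod_uminus)
    finally show "(\<Prod>i\<in>I. - (fps_const (Z $ i) * fps_X)) * (\<Prod>i\<in>{..<n} - I. 1)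
        = fps_const ((-1) ^ card I * (\<Prod>i\<in>I. Z $ i)) * fps_X ^ card I" by simp
  qed
  finally have P: "(\<Prod>i<n. 1 - fps_const (Z $ i) * fps_X)
      = (\<Sum>I\<in>Pow {..<n}. fps_const ((-1) ^ card I * (\<Prod>i\<in>I. Z $ i)) * fps_X ^ card I)" .
  show ?thesis
  proof (rule fps_ext)
    fix k
    have "fps_nth (\<Prod>i<n. 1 - fps_const (Z $ i) * fps_X) k
        = (\<Sum>I\<in>Pow {..<n}. if card I = k then (-1) ^ k * (\<Prod>i\<in>I. Z $ i) else 0)"
      unfolding P fps_sum_nth by (intro sum.cong) auto
    also have "\<dots> = (\<Sum>I\<in>{I. I \<subseteq> {..<n} \<and> card I = k}. (-1) ^ k * (\<Prod>i\<in>I. Z $ i))"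
      by (intro sum.mono_neutral_cong_right) auto
    also have "\<dots> = (-1) ^ k * esym k Z" by (simp add: esym_def n sum_distrib_left)
    also have "\<dots> = (-1) ^ k * esym_ext n (sym_map n Z) k"
    proof (cases "k \<le> n")
      case False
      then have "{I. I \<subseteq> {..<n} \<and> card I = k} = {}"
        using card_mono[OF finite_lessThan, of _ n] by auto
      then have "esym k Z = 0" unfolding esym_def n by (simp only: sum.empty)
      then show ?thesis using False by (simp add: esym_ext_def)
    qed (simp add: esym_ext_sym_map)
    finally show "fps_nth (esym_fps n (sym_map n Z)) k = fps_nth (\<Prod>i<n. 1 - fps_const (Z $ i) * fps_X) k"
      by (simp add: esym_fps_def)
  qed
qed

text \<open>A logarithmic derivative without division: adding a factor L = 1 - z x adds to the power
  sums the series G of z x / (1 - z x), which satisfies L G = z x.\<close>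

lemma newton_identity_prod:
  fixes z :: "nat \<Rightarrow> complex"
  shows "(\<Prod>i<n. 1 - fps_const (z i) * fps_X) * Abs_fps (\<lambda>m. if m = 0 then 0 else (\<Sum>i<n. z i ^ m))
    = - (fps_X * fps_deriv (\<Prod>i<n. 1 - fps_const (z i) * fps_X))"
proof (induction n)
  case 0
  show ?case by (simp add: fps_eq_iff)
next
  case (Suc n)
  define E where "E = (\<Prod>i<n. 1 - fps_const (z i) * fps_X)"
  define R where "R = Abs_fps (\<lambda>m. if m = 0 then 0 else (\<Sum>i<n. z i ^ m))"
  define L where "L = 1 - fps_const (z n) * fps_X"
  define G where "G = Abs_fps (\<lambda>m. if m = 0 then 0 else z n ^ m)"
  have "L * G = fps_const (z n) * fps_X"
  proof (rule fps_ext)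
    fix m show "fps_nth (L * G) m = fps_nth (fps_const (z n) * fps_X) m"
      by (cases m) (auto simp: L_def G_def left_diff_distrib mult.assoc)
  qed
  then have LG: "(E * L) * G = E * (fps_const (z n) * fps_X)" by (simp add: mult.assoc)
  have ER: "(E * L) * R = - (fps_X * fps_deriv E) * L"
    using Suc.IH unfolding E_def[symmetric] R_def[symmetric] by (metis mult.commute mult.left_commute)
  have dL: "fps_deriv L = - fps_const (z n)" by (simp add: L_def)
  have "(E * L) * (R + G) = - (fps_X * fps_deriv (E * L))"
    unfolding distrib_left LG ER fps_deriv_mult dL by (simp add: algebra_simps del: fps_const_neg)
  moreover have "R + G = Abs_fps (\<lambda>m. if m = 0 then 0 else (\<Sum>i<Suc n. z i ^ m))"
    by (simp add: R_def G_def fps_eq_iff)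
  ultimately show ?case by (simp add: E_def L_def)
qed

lemma newton_identity:
  assumes "u \<in> sym_polydisc n"
  shows "esym_fps n u * psum_fps n u = - (fps_X * fps_deriv (esym_fps n u))"
proof -
  have "desym n u \<in> carrier_vec n" using desym(1)[OF assms] by (simp add: polydisc_def)
  from esym_fps_sym_map[OF this] have "esym_fps n u = (\<Prod>i<n. 1 - fps_const (desym n u $ i) * fps_X)"
    using desym(2)[OF assms] by simp
  then show ?thesis
    using newton_identity_prod[of "\<lambda>i. desym n u $ i" n] unfolding psum_fps_def psum_def by simp
qed

lemma sym_polydisc_carrier: "u \<in> sym_polydisc n \<Longrightarrow> u \<in> carrier_vec n"
  by (auto simp: sym_polydisc_def sym_map_def)

lemma esym_fps_0: "fps_nth (esym_fps n u) 0 = 1"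
  by (simp add: esym_fps_def esym_ext_def)

lemma esym_fps_mult_moment: "esym_fps n u * moment n u v = dir_fps n v"
  using inverse_mult_eq_1'[of "esym_fps n u"] esym_fps_0[of n u]
  by (simp add: moment_def mult.left_commute)

lemma newton_recursion:
  assumes "u \<in> sym_polydisc n"
  shows "fps_nth (psum_fps n u) m + (\<Sum>j=1..m. fps_nth (esym_fps n u) j * fps_nth (psum_fps n u) (m - j))
    = - (of_nat m * fps_nth (esym_fps n u) m)"
proof -
  have "fps_nth (esym_fps n u * psum_fps n u) m = fps_nth (- (fps_X * fps_deriv (esym_fps n u))) m"
    by (simp only: newton_identity[OF assms])
  also have "\<dots> = - (of_nat m * fps_nth (esym_fps n u) m)" by (cases m) simp_all
  finally show ?thesis
    by (simp add: fps_mult_nth sum.atLeast_Suc_atMost esym_fps_0)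
qed

text \<open>Coordinate k of \<open>u\<close> sits at x^(k+1) with sign (-1)^(k+1); relative to
  \<open>dir_fps\<close> this is the factor -x.\<close>

lemma esym_fps_has_derivative:
  assumes "\<And>k. k < n \<Longrightarrow> ((\<lambda>t. U t $ k) has_field_derivative v $ k) (at t0)"
  shows "((\<lambda>t. fps_nth (esym_fps n (U t)) j) has_field_derivative
    fps_nth (- (fps_X * dir_fps n v)) j) (at t0)"
proof (cases j)
  case (Suc k)
  show ?thesis
  proof (cases "k < n")
    case True
    then show ?thesis
      using DERIV_cmult[OF assms[OF True], of "(-1) ^ Suc k"] Suc
      by (simp add: esym_fps_def esym_ext_def dir_fps_def)
  qed (use Suc in \<open>simp add: esym_fps_def esym_ext_def dir_fps_def\<close>)
qed (simp add: esym_fps_0)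

text \<open>With $E$ and $R$ the generating series of the elementary symmetric functions and the power
  sums, Newton's identity $ER = -xE'$ is differentiated along the curve and compared with
  $E \cdot x\varphi = -\dot E$.\<close>

lemma psum_fps_has_derivative:
  assumes U: "eventually (\<lambda>t. U t \<in> sym_polydisc n) (nhds t0)"
    and der: "\<And>k. k < n \<Longrightarrow> ((\<lambda>t. U t $ k) has_field_derivative v $ k) (at t0)"
  shows "((\<lambda>t. fps_nth (psum_fps n (U t)) m) has_field_derivative
    fps_nth (fps_X * fps_deriv (fps_X * moment n (U t0) v)) m) (at t0)"
proof (induction m rule: less_induct)
  case (less m)
  define E where "E = esym_fps n (U t0)"
  define R where "R = psum_fps n (U t0)"
  define D where "D = - (fps_X * dir_fps n v)"
  define \<phi> where "\<phi> = moment n (U t0) v"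
  define W where "W = fps_X * fps_deriv (fps_X * \<phi>)"
  have U0: "U t0 \<in> sym_polydisc n" using U by (rule eventually_nhds_x_imp_x)
  have "E * (fps_X * \<phi>) = - D"
    using esym_fps_mult_moment[of n "U t0" v] by (simp add: E_def \<phi>_def D_def mult.left_commute)
  note E\<phi> = this
  have "E * W + fps_X * fps_deriv E * (fps_X * \<phi>) = fps_X * fps_deriv (E * (fps_X * \<phi>))"
    unfolding W_def fps_deriv_mult[of E] by (simp only: distrib_left mult_ac)
  then have "E * W + fps_X * fps_deriv E * (fps_X * \<phi>) = - (fps_X * fps_deriv D)"
    unfolding E\<phi> by simp
  moreover have "fps_X * fps_deriv E * (fps_X * \<phi>) = D * R"
  proof -
    have "fps_X * fps_deriv E = - (E * R)"
      using newton_identity[OF U0] by (simp add: E_def R_def)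
    then have "fps_X * fps_deriv E * (fps_X * \<phi>) = - (E * R) * (fps_X * \<phi>)" by simp
    also have "\<dots> = - (R * (E * (fps_X * \<phi>)))" by (simp add: mult_ac)
    finally have "fps_X * fps_deriv E * (fps_X * \<phi>) = - (R * (E * (fps_X * \<phi>)))" .
    then show ?thesis unfolding E\<phi> by (simp add: mult.commute)
  qed
  ultimately have "fps_nth (E * W + D * R) m = fps_nth (- (fps_X * fps_deriv D)) m" by simp
  also have "\<dots> = - (of_nat m * fps_nth D m)" by (cases m) simp_all
  \<comment> \<open>This is the recursion of \<open>newton_recursion\<close> after differentiation,
    with \<open>D\<close> and \<open>W\<close> as the derivatives of the two series. Strong
    induction on m then identifies \<open>W\<close> with the derivative.\<close>
  finally have key: "fps_nth W m = - (of_nat m * fps_nth D m)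
      - (\<Sum>j=1..m. fps_nth D j * fps_nth R (m - j) + fps_nth E j * fps_nth W (m - j))"
    by (simp add: fps_mult_nth sum.atLeast_Suc_atMost sum.distrib E_def esym_fps_0 D_def[symmetric])
       (simp add: D_def algebra_simps)
  have dE: "((\<lambda>t. fps_nth (esym_fps n (U t)) j) has_field_derivative fps_nth D j) (at t0)" for j
    unfolding D_def using der by (rule esym_fps_has_derivative)
  have "((\<lambda>t. - (of_nat m * fps_nth (esym_fps n (U t)) m)
      - (\<Sum>j=1..m. fps_nth (esym_fps n (U t)) j * fps_nth (psum_fps n (U t)) (m - j)))
      has_field_derivative fps_nth W m) (at t0)"
    unfolding key
  proof (intro DERIV_diff DERIV_minus DERIV_cmult DERIV_sum dE)
    fix j assume "j \<in> {1..m}"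
    then have "m - j < m" by auto
    from less[OF this] have "((\<lambda>t. fps_nth (psum_fps n (U t)) (m - j)) has_field_derivative
        fps_nth W (m - j)) (at t0)" by (simp add: W_def \<phi>_def)
    from DERIV_mult[OF dE this, of j]
    show "((\<lambda>t. fps_nth (esym_fps n (U t)) j * fps_nth (psum_fps n (U t)) (m - j)) has_field_derivative
        fps_nth D j * fps_nth R (m - j) + fps_nth E j * fps_nth W (m - j)) (at t0)"
      by (simp add: E_def R_def algebra_simps)
  qed
  moreover have "eventually (\<lambda>t. fps_nth (psum_fps n (U t)) m = - (of_nat m * fps_nth (esym_fps n (U t)) m)
      - (\<Sum>j=1..m. fps_nth (esym_fps n (U t)) j * fps_nth (psum_fps n (U t)) (m - j))) (nhds t0)"
    using U by eventually_elim (simp add: newton_recursion[symmetric])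
  ultimately have "((\<lambda>t. fps_nth (psum_fps n (U t)) m) has_field_derivative fps_nth W m) (at t0)"
    by (subst DERIV_cong_ev[OF refl _ refl]) auto
  then show ?case by (simp add: W_def \<phi>_def)
qed

text \<open>In root coordinates this is the derivative (m+1) \<Sum> \<nu>_i z_i^m of the power sum;
  the series version remains valid at collisions.\<close>

lemma psum_has_derivative:
  assumes "eventually (\<lambda>t. U t \<in> sym_polydisc n) (nhds t0)"
    and "\<And>k. k < n \<Longrightarrow> ((\<lambda>t. U t $ k) has_field_derivative v $ k) (at t0)"
  shows "((\<lambda>t. psum n (U t) (Suc m)) has_field_derivative
    of_nat (Suc m) * fps_nth (moment n (U t0) v) m) (at t0)"
  using psum_fps_has_derivative[OF assms, of "Suc m"]
  by (simp add: psum_fps_def fps_deriv_nth del: fps_deriv_mult of_nat_Suc)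

text \<open>Newton's identity is solved for the elementary symmetric functions, dividing by m. It
  serves to show that the coordinates of \<open>induced_map\<close> are differentiable, since its
  power sums are accessible while its coordinates are not.\<close>

lemma sym_coordinate_differentiable:
  assumes U: "eventually (\<lambda>t. U t \<in> sym_polydisc n) (nhds t0)"
    and psum: "\<And>m. (\<lambda>t. psum n (U t) (Suc m)) field_differentiable at t0"
    and k: "k < n"
  shows "(\<lambda>t. U t $ k) field_differentiable at t0"
proof -
  have R: "(\<lambda>t. fps_nth (psum_fps n (U t)) m) field_differentiable at t0" for m
    using psum by (cases m) (simp_all add: psum_fps_def)
  have E: "(\<lambda>t. fps_nth (esym_fps n (U t)) m) field_differentiable at t0" for m
  proof (induction m rule: less_induct)
    case (less m)
    show ?case
    proof (cases m)
      case (Suc m')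
      have "(\<lambda>t. - (\<Sum>j<m. fps_nth (esym_fps n (U t)) j * fps_nth (psum_fps n (U t)) (m - j)) / of_nat m)
          field_differentiable at t0"
        using less R Suc by (intro derivative_intros) (auto simp del: of_nat_Suc)
      moreover have "eventually (\<lambda>t. fps_nth (esym_fps n (U t)) m
          = - (\<Sum>j<m. fps_nth (esym_fps n (U t)) j * fps_nth (psum_fps n (U t)) (m - j)) / of_nat m) (nhds t0)"
        using U
      proof eventually_elim
        case (elim t)
        have "fps_nth (esym_fps n (U t) * psum_fps n (U t)) m
            = (\<Sum>j<m. fps_nth (esym_fps n (U t)) j * fps_nth (psum_fps n (U t)) (m - j))"
          unfolding fps_mult_nth
          by (intro sum.mono_neutral_right) (auto simp: psum_fps_def not_less)
        moreover have "fps_nth (esym_fps n (U t) * psum_fps n (U t)) m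
            = - (of_nat m * fps_nth (esym_fps n (U t)) m)"
          unfolding newton_identity[OF elim] Suc by simp
        ultimately show ?case using Suc by (simp add: field_simps del: of_nat_Suc)
      qed
      ultimately show ?thesis
        unfolding field_differentiable_def by (simp only: DERIV_cong_ev[OF refl _ refl])
    qed (simp add: esym_fps_0)
  qed
  have "(\<lambda>t. (-1) ^ Suc k * fps_nth (esym_fps n (U t)) (Suc k)) field_differentiable at t0"
    by (intro derivative_intros E)
  then show ?thesis using k by (simp add: esym_fps_def esym_ext_def mult.assoc[symmetric] power_mult_distrib[symmetric])
qed

lemma moment_linear:
  assumes "v \<in> carrier_vec n"
  shows "fps_nth (moment n u v) m = (\<Sum>k<n. v $ k * fps_nth (moment n u (unit_vec n k)) m)"
proof -
  have "dir_fps n v = (\<Sum>k<n. fps_const (v $ k) * dir_fps n (unit_vec n k))"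
  proof (rule fps_ext)
    fix j
    have "fps_nth (\<Sum>k<n. fps_const (v $ k) * dir_fps n (unit_vec n k)) j
        = (\<Sum>k<n. if k = j then fps_nth (dir_fps n v) j else 0)"
      unfolding fps_sum_nth by (intro sum.cong) (auto simp: dir_fps_def unit_vec_def)
    also have "\<dots> = fps_nth (dir_fps n v) j" by (simp add: dir_fps_def)
    finally show "fps_nth (dir_fps n v) j
        = fps_nth (\<Sum>k<n. fps_const (v $ k) * dir_fps n (unit_vec n k)) j" ..
  qed
  then have "moment n u v = (\<Sum>k<n. fps_const (v $ k) * moment n u (unit_vec n k))"
    by (simp add: moment_def sum_distrib_right mult.assoc)
  then show ?thesis by (simp add: fps_sum_nth)
qed

lemma coord_line_coordinate:
  assumes "u \<in> carrier_vec n" "k < n"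
  shows "((\<lambda>t. coord_line u j t $ k) has_field_derivative unit_vec n j $ k) (at t)"
proof -
  have "(\<lambda>t. coord_line u j t $ k) = (\<lambda>t. u $ k + t * unit_vec n j $ k)"
    using assms by (simp add: coord_line_def)
  then show ?thesis by (auto intro!: derivative_eq_intros)
qed

lemma coord_line_carrier [simp]: "u \<in> carrier_vec n \<Longrightarrow> coord_line u j t \<in> carrier_vec n"
  by (simp add: coord_line_def)

lemma coord_line_0: "u \<in> carrier_vec n \<Longrightarrow> coord_line u j 0 = u"
  by (intro eq_vecI) (auto simp: coord_line_def)

section \<open>The metric as a sum of squares of moments\<close>

lemma norm_psum_le:
  assumes "\<And>i. i < n \<Longrightarrow> norm (desym n u $ i) \<le> \<rho>"
  shows "norm (psum n u m) \<le> real n * \<rho> ^ m"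
proof -
  have "norm (psum n u m) \<le> (\<Sum>i<n. \<rho> ^ m)"
    unfolding psum_def using assms by (intro sum_norm_le) (auto simp: norm_power intro: power_mono)
  then show ?thesis by simp
qed

lemma coord_line_nearby:
  assumes "u \<in> carrier_vec n" "k < n"
  shows "norm (coord_line u j t $ k - u $ k) \<le> norm t"
  using assms by (simp add: coord_line_def unit_vec_def)

text \<open>Power sums are bounded through the roots. A moment in direction \<alpha>, times m+1, is
  the derivative of a power sum along a second coordinate line, so a Cauchy estimate on that line
  bounds it.\<close>

lemma coord_line_bounds:
  assumes u: "u \<in> sym_polydisc n"
  obtains \<epsilon> \<rho> A where "0 < \<epsilon>" "0 < \<rho>" "\<rho> < 1" "0 \<le> A"
    "\<And>\<beta> t. norm t < \<epsilon> \<Longrightarrow> coord_line u \<beta> t \<in> sym_polydisc n"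
    "\<And>\<beta> t m. norm t < \<epsilon> \<Longrightarrow> norm (psum n (coord_line u \<beta> t) m) \<le> A * \<rho> ^ m"
    "\<And>\<alpha> \<beta> t m. norm t < \<epsilon> \<Longrightarrow>
      norm (fps_nth (moment n (coord_line u \<beta> t) (unit_vec n \<alpha>)) m) \<le> A * \<rho> ^ m"
proof (rule sym_polydisc_neighbourhood[OF u])
  fix \<epsilon> \<rho> :: real
  assume \<epsilon>: "0 < \<epsilon>" and \<rho>: "0 < \<rho>" "\<rho> < 1"
    and nbhd: "\<And>u'. u' \<in> carrier_vec n \<Longrightarrow> (\<And>k. k < n \<Longrightarrow> norm (u' $ k - u $ k) \<le> \<epsilon>) \<Longrightarrow>
      u' \<in> sym_polydisc n \<and> (\<forall>i<n. norm (desym n u' $ i) \<le> \<rho>)"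
  have uc: "u \<in> carrier_vec n" using sym_polydisc_carrier[OF u] .
  \<comment> \<open>n comes from the power sums, 4n/\<epsilon> from the Cauchy estimate on radius
    \<epsilon>/4.\<close>
  define A where "A = real n + 4 * real n / \<epsilon>"
  have A: "0 \<le> A" "real n \<le> A" "4 * real n / \<epsilon> \<le> A" using \<epsilon> by (auto simp: A_def)
  \<comment> \<open>Half of the radius is spent on the base line and half on the second
    line.\<close>
  have in_nbhd: "coord_line (coord_line u \<beta> t) \<alpha> s \<in> sym_polydisc n \<and>
      (\<forall>i<n. norm (desym n (coord_line (coord_line u \<beta> t) \<alpha> s) $ i) \<le> \<rho>)"
    if "norm t < \<epsilon> / 2" "norm s \<le> \<epsilon> / 2" for t s \<alpha> \<beta>
  proof (rule nbhd)
    fix k assume k: "k < n"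
    have "norm (coord_line (coord_line u \<beta> t) \<alpha> s $ k - coord_line u \<beta> t $ k) \<le> norm s"
      using uc k by (intro coord_line_nearby) auto
    moreover have "norm (coord_line u \<beta> t $ k - u $ k) \<le> norm t"
      using uc k by (intro coord_line_nearby) auto
    ultimately show "norm (coord_line (coord_line u \<beta> t) \<alpha> s $ k - u $ k) \<le> \<epsilon>"
      using norm_triangle_ineq[of "coord_line (coord_line u \<beta> t) \<alpha> s $ k - coord_line u \<beta> t $ k"
          "coord_line u \<beta> t $ k - u $ k"] that by simp
  qed (use uc in simp)
  have line: "coord_line u \<beta> t \<in> sym_polydisc n \<and> (\<forall>i<n. norm (desym n (coord_line u \<beta> t) $ i) \<le> \<rho>)"
    if "norm t < \<epsilon> / 2" for t \<beta>
    using in_nbhd[OF that, of 0 \<beta> 0] coord_line_0[OF coord_line_carrier[OF uc]] \<epsilon> by simp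
  show thesis
  proof (rule that[of "\<epsilon> / 2" \<rho> A])
    show "norm (psum n (coord_line u \<beta> t) m) \<le> A * \<rho> ^ m" if "norm t < \<epsilon> / 2" for t \<beta> m
      using line[OF that] A(2) \<rho>
      by (intro order_trans[OF norm_psum_le mult_right_mono]) auto
  next
    fix \<alpha> \<beta> t m assume t: "norm (t::complex) < \<epsilon> / 2"
    define w where "w = coord_line u \<beta> t"
    have wc: "w \<in> carrier_vec n" using uc by (simp add: w_def)
    define U where "U s = coord_line w \<alpha> s" for s
    have U: "U s \<in> sym_polydisc n" "norm (psum n (U s) m) \<le> real n * \<rho> ^ m"
      if "norm s \<le> \<epsilon> / 2" for s m
      using in_nbhd[OF t that, of \<beta> \<alpha>] norm_psum_le[of n "U s" \<rho> m] by (auto simp: U_def w_def)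
    have d: "((\<lambda>s. psum n (U s) (Suc m)) has_field_derivative
        of_nat (Suc m) * fps_nth (moment n (U s0) (unit_vec n \<alpha>)) m) (at s0)"
      if "norm s0 < \<epsilon> / 2" for s0
    proof (rule psum_has_derivative)
      have "eventually (\<lambda>s. s \<in> ball 0 (\<epsilon> / 2)) (nhds s0)"
        using that by (intro eventually_nhds_in_open) auto
      then show "eventually (\<lambda>s. U s \<in> sym_polydisc n) (nhds s0)"
        by eventually_elim (simp add: U)
      show "((\<lambda>s. U s $ k) has_field_derivative unit_vec n \<alpha> $ k) (at s0)" if "k < n" for k
        unfolding U_def using wc that by (rule coord_line_coordinate)
    qed
    define r where "r = \<epsilon> / 4"
    have r: "0 < r" "r < \<epsilon> / 2" using \<epsilon> by (auto simp: r_def)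
    have "norm ((deriv ^^ 1) (\<lambda>s. psum n (U s) (Suc m)) 0) \<le> fact 1 * (real n * \<rho> ^ Suc m) / r ^ 1"
    proof (rule Cauchy_inequality)
      show "(\<lambda>s. psum n (U s) (Suc m)) holomorphic_on ball 0 r"
        unfolding holomorphic_on_def field_differentiable_def
      proof (intro ballI exI)
        fix x :: complex assume "x \<in> ball 0 r"
        then have "norm x < \<epsilon> / 2" using r by simp
        from has_field_derivative_at_within[OF d[OF this]]
        show "((\<lambda>s. psum n (U s) (Suc m)) has_field_derivative
          of_nat (Suc m) * fps_nth (moment n (U x) (unit_vec n \<alpha>)) m) (at x within ball 0 r)" .
      qed
      show "continuous_on (cball 0 r) (\<lambda>s. psum n (U s) (Suc m))"
      proof (intro continuous_at_imp_continuous_on ballI)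
        fix x :: complex assume "x \<in> cball 0 r"
        then show "isCont (\<lambda>s. psum n (U s) (Suc m)) x" using d[of x] r by (auto dest: DERIV_isCont)
      qed
      show "norm (psum n (U x) (Suc m)) \<le> real n * \<rho> ^ Suc m" if "norm (0 - x) = r" for x
        using that r by (intro U) simp
    qed (use r in simp)
    moreover have dv: "deriv (\<lambda>s. psum n (U s) (Suc m)) 0
        = of_nat (Suc m) * fps_nth (moment n w (unit_vec n \<alpha>)) m"
      using DERIV_imp_deriv[OF d[of 0]] \<epsilon> wc by (simp add: U_def coord_line_0)
    ultimately have b: "real (Suc m) * norm (fps_nth (moment n w (unit_vec n \<alpha>)) m)
        \<le> real n * \<rho> ^ Suc m / r"
      by (simp add: norm_mult del: of_nat_Suc)
    have "1 * norm (fps_nth (moment n w (unit_vec n \<alpha>)) m)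
        \<le> real (Suc m) * norm (fps_nth (moment n w (unit_vec n \<alpha>)) m)"
      by (intro mult_right_mono) auto
    also note b
    also have "real n * \<rho> ^ Suc m / r \<le> real n * \<rho> ^ m / r"
      using \<rho> r by (intro divide_right_mono mult_left_mono power_decreasing) auto
    also have "\<dots> = 4 * real n / \<epsilon> * \<rho> ^ m" by (simp add: r_def)
    also have "\<dots> \<le> A * \<rho> ^ m" using A \<rho> by (intro mult_right_mono) auto
    finally show "norm (fps_nth (moment n (coord_line u \<beta> t) (unit_vec n \<alpha>)) m) \<le> A * \<rho> ^ m"
      by (simp add: w_def)
  qed (use \<epsilon> \<rho> A line in auto)
qed

lemma Ln_szego_sums:
  assumes u: "u \<in> sym_polydisc n"
  shows "(\<lambda>m. psum n u (Suc m) * cnj (psum n u (Suc m) / of_nat (Suc m))) sums Ln (szego n u u)"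
proof -
  define Z where "Z = desym n u"
  have Z: "norm (Z $ i) < 1" if "i < n" for i
    using desym(1)[OF u] that by (simp add: Z_def polydisc_def)
  define y where "y i j = Z $ i * cnj (Z $ j)" for i j
  have y: "norm (y i j) < 1" if "i < n" "j < n" for i j
    using norm_mult_cnj_less_1(1)[of "Z $ i" "Z $ j"] Z[OF that(1)] Z[OF that(2)] by (simp add: y_def)
  have L: "(\<lambda>m. y i j ^ Suc m / of_nat (Suc m)) sums (- Ln (1 - y i j))" if "i < n" "j < n" for i j
  proof -
    have "(\<lambda>m. - (- ((y i j) ^ m) / of_nat m)) sums - Ln (1 + - y i j)"
      using sums_minus[OF Ln_series'[of "- y i j"]] y[OF that] by simp
    then have "(\<lambda>m. y i j ^ m / of_nat m) sums - Ln (1 - y i j)" by simp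
    then show ?thesis by (subst sums_Suc_iff) simp
  qed
  define S where "S = (\<Sum>i<n. \<Sum>j<n. - Ln (1 - y i j))"
  have "(\<lambda>m. \<Sum>i<n. \<Sum>j<n. y i j ^ Suc m / of_nat (Suc m)) sums S"
    unfolding S_def by (intro sums_sum L) auto
  moreover have eq: "(\<Sum>i<n. \<Sum>j<n. y i j ^ Suc m / of_nat (Suc m))
      = psum n u (Suc m) * cnj (psum n u (Suc m) / of_nat (Suc m))" for m
    unfolding psum_def Z_def[symmetric] y_def
    by (simp add: sum_product sum_divide_distrib power_mult_distrib mult_ac del: of_nat_Suc)
  ultimately have sums: "(\<lambda>m. psum n u (Suc m) * cnj (psum n u (Suc m) / of_nat (Suc m))) sums S"
    by simp
  \<comment> \<open>All terms are real, hence the sum of logarithms is real and equals the principal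
    logarithm of the product.\<close>
  have "Im S = 0"
  proof -
    have "Im (psum n u (Suc m) * cnj (psum n u (Suc m) / of_nat (Suc m))) = 0" for m
    proof -
      have "psum n u (Suc m) * cnj (psum n u (Suc m) / of_nat (Suc m))
          = of_real ((norm (psum n u (Suc m)))\<^sup>2 / real (Suc m))"
        by (simp add: complex_norm_square del: of_nat_Suc of_real_power)
      then show ?thesis by (simp only: Im_complex_of_real)
    qed
    then have "(\<lambda>m. 0) sums Im S" using sums_Im[OF sums] by simp
    then show ?thesis using sums_unique2 sums_zero by blast
  qed
  moreover have "exp S = szego n u u"
  proof -
    have "1 - y i j \<noteq> 0" if "i < n" "j < n" for i j using y[OF that] by auto
    then have "exp S = (\<Prod>i<n. \<Prod>j<n. 1 / (1 - y i j))"
      unfolding S_def by (simp add: exp_sum exp_minus inverse_eq_divide)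
    then show ?thesis by (simp add: szego_def y_def Z_def)
  qed
  ultimately have "Ln (szego n u u) = S"
    using Ln_exp[of S] pi_gt_zero by simp
  then show ?thesis using sums by simp
qed

text \<open>On series of terms a cnj(b) with a, b holomorphic, the two Wirtinger derivatives act on
  one factor each. Real directional derivatives along 1 and \<i> are computed termwise and then
  recombined.\<close>

lemma wirt_series:
  fixes a b a' b' :: "nat \<Rightarrow> complex \<Rightarrow> complex"
  assumes \<epsilon>: "0 < \<epsilon>" and \<rho>: "0 < \<rho>" "\<rho> < 1" and A: "0 \<le> A"
    and da: "\<And>m t. norm t < \<epsilon> \<Longrightarrow> (a m has_field_derivative a' m t) (at t)"
    and db: "\<And>m t. norm t < \<epsilon> \<Longrightarrow> (b m has_field_derivative b' m t) (at t)"
    and a: "\<And>m t. norm t < \<epsilon> \<Longrightarrow> norm (a m t) \<le> A * \<rho> ^ m"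
    and b: "\<And>m t. norm t < \<epsilon> \<Longrightarrow> norm (b m t) \<le> A * \<rho> ^ m"
    and h: "\<And>t. norm t < \<epsilon> \<Longrightarrow> (\<lambda>m. a m t * cnj (b m t)) sums h (coord_line u k t)"
  shows "(\<lambda>m. a' m 0 * cnj (b m 0)) sums wirt k h u"
    and "(\<lambda>m. a m 0 * cnj (b' m 0)) sums wirt_bar k h u"
proof -
  have dir: "(\<lambda>m. c * (a' m 0 * cnj (b m 0)) + cnj c * (a m 0 * cnj (b' m 0)))
      sums vector_derivative (\<lambda>x. h (coord_line u k (c * complex_of_real x))) (at 0)"
    if c: "norm c = 1" for c
  proof -
    \<comment> \<open>The second conjugation, inside the argument of b, makes \<open>f m\<close>
      holomorphic in s while agreeing with a cnj(b) for real s. Thus the termwise differentiation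
      theorem for holomorphic series applies.\<close>
    define f where "f m s = a m (c * s) * cnj (b m (c * cnj s))" for m s
    define f' where "f' m s = a m (c * s) * cnj (b' m (c * cnj s) * c)
      + a' m (c * s) * c * cnj (b m (c * cnj s))" for m s
    have f_deriv: "(f m has_field_derivative f' m s) (at s)" if s: "s \<in> ball 0 \<epsilon>" for m s
    proof -
      have n1: "norm (c * s) < \<epsilon>" "norm (c * cnj s) < \<epsilon>" using s c by (simp_all add: norm_mult)
      have m: "((\<lambda>s. c * s) has_field_derivative c) (at x)" for x
        using DERIV_cmult_Id[of c x] by simp
      have "((\<lambda>s. a m (c * s)) has_field_derivative a' m (c * s) * c) (at s)"
        using DERIV_chain2[OF da[OF n1(1)] m] .
      moreover have "((\<lambda>s. b m (c * s)) has_field_derivative b' m (c * cnj s) * c) (at (cnj s))"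
        using DERIV_chain2[OF db[OF n1(2)] m] .
      then have "((cnj \<circ> (\<lambda>s. b m (c * s)) \<circ> cnj) has_field_derivative cnj (b' m (c * cnj s) * c)) (at s)"
        by (rule has_field_derivative_cnj_cnj)
      then have "((\<lambda>s. cnj (b m (c * cnj s))) has_field_derivative cnj (b' m (c * cnj s) * c)) (at s)"
        by (simp only: comp_def)
      ultimately show ?thesis
        unfolding f_def f'_def by (rule DERIV_mult')
    qed
    have f_bound: "norm (f m s) \<le> A\<^sup>2 * (\<rho>\<^sup>2) ^ m" if s: "s \<in> ball 0 \<epsilon>" for m s
    proof -
      have n1: "norm (c * s) < \<epsilon>" "norm (c * cnj s) < \<epsilon>" using s c by (simp_all add: norm_mult)
      have "norm (f m s) \<le> (A * \<rho> ^ m) * (A * \<rho> ^ m)"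
        unfolding f_def norm_mult complex_mod_cnj using a[OF n1(1)] b[OF n1(2)] A \<rho>
        by (intro mult_mono) auto
      then show ?thesis by (simp add: power2_eq_square power_mult_distrib mult_ac)
    qed
    have sm: "summable (\<lambda>m. A\<^sup>2 * (\<rho>\<^sup>2) ^ m)"
      using \<rho> by (intro summable_mult summable_geometric) (simp add: power_less_one_iff)
    have ev: "\<forall>\<^sub>F m in sequentially. \<forall>s\<in>ball 0 \<epsilon>. norm (f m s) \<le> A\<^sup>2 * (\<rho>\<^sup>2) ^ m"
      using f_bound by simp
    obtain g g' where gg': "\<forall>s\<in>ball 0 \<epsilon>. ((\<lambda>m. f m s) sums g s) \<and> ((\<lambda>m. f' m s) sums g' s) \<and>
        (g has_field_derivative g' s) (at s)"
      by (rule series_and_derivative_comparison[OF open_ball sm f_deriv ev])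
    have g: "(\<lambda>m. f m s) sums g s" "(\<lambda>m. f' m s) sums g' s" "(g has_field_derivative g' s) (at s)"
      if "s \<in> ball 0 \<epsilon>" for s using gg' that by simp_all
    have "((\<lambda>x. g (complex_of_real x)) has_vector_derivative g' 0) (at 0)"
      using g(3)[of 0] \<epsilon> by (intro has_vector_derivative_real_field) simp
    then have "((\<lambda>x. h (coord_line u k (c * complex_of_real x))) has_vector_derivative g' 0) (at 0)"
    proof (rule has_vector_derivative_transform_within_open[of _ _ _ "ball 0 \<epsilon>"])
      fix x :: real assume x: "x \<in> ball 0 \<epsilon>"
      then have "norm (c * complex_of_real x) < \<epsilon>" using c by (simp add: norm_mult)
      from h[OF this] have "(\<lambda>m. f m (complex_of_real x)) sums h (coord_line u k (c * complex_of_real x))"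
        by (simp add: f_def)
      then show "g (complex_of_real x) = h (coord_line u k (c * complex_of_real x))"
        using g(1)[of "complex_of_real x"] x sums_unique2 by fastforce
    qed (use \<epsilon> in auto)
    then have "vector_derivative (\<lambda>x. h (coord_line u k (c * complex_of_real x))) (at 0) = g' 0"
      by (rule vector_derivative_at)
    moreover have "(\<lambda>m. f' m 0) sums g' 0" using g(2) \<epsilon> by simp
    moreover have "f' m 0 = c * (a' m 0 * cnj (b m 0)) + cnj c * (a m 0 * cnj (b' m 0))" for m
      by (simp add: f'_def mult_ac)
    ultimately show ?thesis by simp
  qed
  define V where "V c = vector_derivative (\<lambda>x. h (coord_line u k (c * complex_of_real x))) (at 0)" for c
  have V1: "(\<lambda>m. a' m 0 * cnj (b m 0) + a m 0 * cnj (b' m 0)) sums V 1"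
    using dir[of 1] by (simp add: V_def)
  have Vi: "(\<lambda>m. \<i> * (\<i> * (a' m 0 * cnj (b m 0)) - \<i> * (a m 0 * cnj (b' m 0)))) sums (\<i> * V \<i>)"
    using dir[of \<i>] by (intro sums_mult) (simp add: V_def)
  have w: "wirt k h u = (V 1 - \<i> * V \<i>) / 2" "wirt_bar k h u = (V 1 + \<i> * V \<i>) / 2"
    by (simp_all add: wirt_def wirt_bar_def V_def)
  show "(\<lambda>m. a' m 0 * cnj (b m 0)) sums wirt k h u"
    using sums_divide[OF sums_diff[OF V1 Vi], of 2] unfolding w(1)
    by (simp add: right_diff_distrib mult.assoc[symmetric])
  show "(\<lambda>m. a m 0 * cnj (b' m 0)) sums wirt_bar k h u"
    using sums_divide[OF sums_add[OF V1 Vi], of 2] unfolding w(2)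
    by (simp add: right_diff_distrib mult.assoc[symmetric])
qed

text \<open>Since E has constant term 1, the relation E \<cdot> moment = \<open>dir_fps\<close>
  determines the coefficients recursively as polynomials in the coordinates.\<close>

lemma moment_differentiable:
  assumes "\<And>k. k < n \<Longrightarrow> (\<lambda>t. U t $ k) field_differentiable at t0"
  shows "(\<lambda>t. fps_nth (moment n (U t) v) m) field_differentiable at t0"
proof (induction m rule: less_induct)
  case (less m)
  have E: "(\<lambda>t. fps_nth (esym_fps n (U t)) j) field_differentiable at t0" for j
    unfolding esym_fps_def esym_ext_def fps_nth_Abs_fps
    by (cases "j = 0"; cases "j \<le> n") (auto intro!: derivative_intros assms)
  have "fps_nth (moment n (U t) v) m = fps_nth (dir_fps n v) m
      - (\<Sum>j=1..m. fps_nth (esym_fps n (U t)) j * fps_nth (moment n (U t) v) (m - j))" for t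
    unfolding esym_fps_mult_moment[of n "U t" v, symmetric]
    by (simp add: fps_mult_nth sum.atLeast_Suc_atMost esym_fps_0)
  moreover have "(\<lambda>t. fps_nth (dir_fps n v) m
      - (\<Sum>j=1..m. fps_nth (esym_fps n (U t)) j * fps_nth (moment n (U t) v) (m - j)))
      field_differentiable at t0"
    by (intro derivative_intros E less) auto
  ultimately show ?case by simp
qed

lemma psum_line_has_derivative:
  assumes u: "u \<in> carrier_vec n"
    and line: "\<And>t. norm t < \<epsilon> \<Longrightarrow> coord_line u \<beta> t \<in> sym_polydisc n" and t0: "norm t0 < \<epsilon>"
  shows "((\<lambda>t. psum n (coord_line u \<beta> t) (Suc m)) has_field_derivative
    of_nat (Suc m) * fps_nth (moment n (coord_line u \<beta> t0) (unit_vec n \<beta>)) m) (at t0)"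
proof (rule psum_has_derivative)
  have "eventually (\<lambda>t. t \<in> ball 0 \<epsilon>) (nhds t0)"
    using t0 by (intro eventually_nhds_in_open) auto
  then show "eventually (\<lambda>t. coord_line u \<beta> t \<in> sym_polydisc n) (nhds t0)"
    by eventually_elim (simp add: line)
qed (rule coord_line_coordinate[OF u])

lemma wirt_bar_Ln_szego:
  assumes w: "w \<in> sym_polydisc n"
  shows "(\<lambda>m. psum n w (Suc m) * cnj (fps_nth (moment n w (unit_vec n \<alpha>)) m))
    sums wirt_bar \<alpha> (\<lambda>w. Ln (szego n w w)) w"
proof (rule coord_line_bounds[OF w])
  fix \<epsilon> \<rho> A :: real
  assume \<epsilon>: "0 < \<epsilon>" and \<rho>: "0 < \<rho>" "\<rho> < 1" and A: "0 \<le> A"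
    and line: "\<And>\<beta> t. norm t < \<epsilon> \<Longrightarrow> coord_line w \<beta> t \<in> sym_polydisc n"
    and psum: "\<And>\<beta> t m. norm t < \<epsilon> \<Longrightarrow> norm (psum n (coord_line w \<beta> t) m) \<le> A * \<rho> ^ m"
  have wc: "w \<in> carrier_vec n" using sym_polydisc_carrier[OF w] .
  define a where "a m t = psum n (coord_line w \<alpha> t) (Suc m)" for m t
  define b where "b m t = a m t / of_nat (Suc m)" for m t
  define b' where "b' m t = fps_nth (moment n (coord_line w \<alpha> t) (unit_vec n \<alpha>)) m" for m t
  have da: "(a m has_field_derivative of_nat (Suc m) * b' m t) (at t)" if "norm t < \<epsilon>" for m t
    unfolding a_def b'_def using wc line that by (rule psum_line_has_derivative)
  have db: "(b m has_field_derivative b' m t) (at t)" if "norm t < \<epsilon>" for m t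
    using DERIV_cdivide[OF da[OF that], of m "of_nat (Suc m)"] by (simp add: b_def[abs_def] del: of_nat_Suc)
  have a: "norm (a m t) \<le> A * \<rho> ^ m" if "norm t < \<epsilon>" for m t
  proof -
    have "norm (a m t) \<le> A * \<rho> ^ Suc m" unfolding a_def using psum[OF that] .
    also have "\<dots> \<le> A * \<rho> ^ m" using A \<rho> by (intro mult_left_mono power_decreasing) auto
    finally show ?thesis .
  qed
  have b: "norm (b m t) \<le> A * \<rho> ^ m" if "norm t < \<epsilon>" for m t
  proof -
    have "norm (b m t) \<le> norm (a m t) / 1"
      unfolding b_def norm_divide norm_of_nat by (intro divide_left_mono) auto
    then show ?thesis using a[OF that] by (simp add: order_trans)
  qed
  have "(\<lambda>m. a m 0 * cnj (b' m 0)) sums wirt_bar \<alpha> (\<lambda>w. Ln (szego n w w)) w"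
  proof (rule wirt_series(2)[OF \<epsilon> \<rho> A da db a b])
    show "(\<lambda>m. a m t * cnj (b m t)) sums Ln (szego n (coord_line w \<alpha> t) (coord_line w \<alpha> t))"
      if "norm t < \<epsilon>" for t
      unfolding a_def b_def by (rule Ln_szego_sums[OF line[OF that]])
  qed
  then show ?thesis using coord_line_0[OF wc] by (simp add: a_def b'_def)
qed

text \<open>The outer derivative hits only the power sum and produces the weight m+1. The moment in
  direction \<alpha> stands under a conjugation, so only its differentiability matters and its
  derivative does not appear.\<close>

lemma szego_metric_sums:
  assumes u: "u \<in> sym_polydisc n" and ab: "\<alpha> < n" "\<beta> < n"
  shows "(\<lambda>m. of_nat (Suc m) * fps_nth (moment n u (unit_vec n \<beta>)) m
    * cnj (fps_nth (moment n u (unit_vec n \<alpha>)) m)) sums (szego_metric n u $$ (\<alpha>, \<beta>))"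
proof (rule coord_line_bounds[OF u])
  fix \<epsilon> \<rho> A :: real
  assume \<epsilon>: "0 < \<epsilon>" and \<rho>: "0 < \<rho>" "\<rho> < 1" and A: "0 \<le> A"
    and line: "\<And>\<beta> t. norm t < \<epsilon> \<Longrightarrow> coord_line u \<beta> t \<in> sym_polydisc n"
    and psum: "\<And>\<beta> t m. norm t < \<epsilon> \<Longrightarrow> norm (psum n (coord_line u \<beta> t) m) \<le> A * \<rho> ^ m"
    and moment: "\<And>\<alpha> \<beta> t m. norm t < \<epsilon> \<Longrightarrow>
      norm (fps_nth (moment n (coord_line u \<beta> t) (unit_vec n \<alpha>)) m) \<le> A * \<rho> ^ m"
  have uc: "u \<in> carrier_vec n" using sym_polydisc_carrier[OF u] .
  define a where "a m t = psum n (coord_line u \<beta> t) (Suc m)" for m t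
  define a' where "a' m t = of_nat (Suc m) * fps_nth (moment n (coord_line u \<beta> t) (unit_vec n \<beta>)) m" for m t
  define b where "b m t = fps_nth (moment n (coord_line u \<beta> t) (unit_vec n \<alpha>)) m" for m t
  have da: "(a m has_field_derivative a' m t) (at t)" if "norm t < \<epsilon>" for m t
    unfolding a_def a'_def using uc line that by (rule psum_line_has_derivative)
  have db: "(b m has_field_derivative deriv (b m) t) (at t)" if "norm t < \<epsilon>" for m t
  proof -
    have "b m field_differentiable at t"
      unfolding b_def
      by (rule moment_differentiable)
        (use coord_line_coordinate[OF uc] in \<open>auto simp: field_differentiable_def\<close>)
    then show ?thesis by (simp add: DERIV_deriv_iff_field_differentiable)
  qed
  have a: "norm (a m t) \<le> A * \<rho> ^ m" if "norm t < \<epsilon>" for m t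
  proof -
    have "norm (a m t) \<le> A * \<rho> ^ Suc m" unfolding a_def using psum[OF that] .
    also have "\<dots> \<le> A * \<rho> ^ m" using A \<rho> by (intro mult_left_mono power_decreasing) auto
    finally show ?thesis .
  qed
  have b: "norm (b m t) \<le> A * \<rho> ^ m" if "norm t < \<epsilon>" for m t
    unfolding b_def using moment[OF that] .
  have "(\<lambda>m. a' m 0 * cnj (b m 0)) sums wirt \<beta> (wirt_bar \<alpha> (\<lambda>w. Ln (szego n w w))) u"
  proof (rule wirt_series(1)[OF \<epsilon> \<rho> A da db a b])
    show "(\<lambda>m. a m t * cnj (b m t)) sums wirt_bar \<alpha> (\<lambda>w. Ln (szego n w w)) (coord_line u \<beta> t)"
      if "norm t < \<epsilon>" for t
      unfolding a_def b_def by (rule wirt_bar_Ln_szego[OF line[OF that]])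
  qed
  then show ?thesis
    using coord_line_0[OF uc] ab by (simp add: szego_metric_def a'_def b_def)
qed

lemma quadratic_form_eq_sum:
  fixes G :: "complex Matrix.mat"
  assumes "G \<in> carrier_mat n n" "v \<in> carrier_vec n"
  shows "(G *\<^sub>v v) \<bullet>c v = (\<Sum>\<alpha><n. \<Sum>\<beta><n. G $$ (\<alpha>, \<beta>) * v $ \<beta> * cnj (v $ \<alpha>))"
  using assms by (simp add: scalar_prod_def atLeast0LessThan sum_distrib_right conjugate_complex_def)

lemma szego_metric_quadratic_form:
  assumes u: "u \<in> sym_polydisc n" and v: "v \<in> carrier_vec n"
  shows "(\<lambda>m. complex_of_real (real (Suc m) * (norm (fps_nth (moment n u v) m))\<^sup>2))
    sums ((szego_metric n u *\<^sub>v v) \<bullet>c v)"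
proof -
  define \<mu> where "\<mu> \<alpha> m = fps_nth (moment n u (unit_vec n \<alpha>)) m" for \<alpha> m
  have "(\<lambda>m. \<Sum>\<alpha><n. \<Sum>\<beta><n. (of_nat (Suc m) * \<mu> \<beta> m * cnj (\<mu> \<alpha> m)) * v $ \<beta> * cnj (v $ \<alpha>))
      sums (\<Sum>\<alpha><n. \<Sum>\<beta><n. szego_metric n u $$ (\<alpha>, \<beta>) * v $ \<beta> * cnj (v $ \<alpha>))"
    unfolding \<mu>_def using szego_metric_sums[OF u] by (intro sums_sum sums_mult2) auto
  also have "(\<Sum>\<alpha><n. \<Sum>\<beta><n. szego_metric n u $$ (\<alpha>, \<beta>) * v $ \<beta> * cnj (v $ \<alpha>))
      = (szego_metric n u *\<^sub>v v) \<bullet>c v"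
    by (rule quadratic_form_eq_sum[symmetric]) (use v in \<open>simp_all add: szego_metric_def\<close>)
  also have "(\<lambda>m. \<Sum>\<alpha><n. \<Sum>\<beta><n. (of_nat (Suc m) * \<mu> \<beta> m * cnj (\<mu> \<alpha> m)) * v $ \<beta> * cnj (v $ \<alpha>))
      = (\<lambda>m. complex_of_real (real (Suc m) * (norm (fps_nth (moment n u v) m))\<^sup>2))"
  proof
    fix m
    have "complex_of_real (real (Suc m) * (norm (fps_nth (moment n u v) m))\<^sup>2)
        = of_nat (Suc m) * (cnj (\<Sum>\<alpha><n. v $ \<alpha> * \<mu> \<alpha> m) * (\<Sum>\<beta><n. v $ \<beta> * \<mu> \<beta> m))"
      unfolding moment_linear[OF v] \<mu>_def of_real_mult complex_norm_square of_real_of_nat_eq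
      by (simp only: mult.commute)
    also have "\<dots> = (\<Sum>\<alpha><n. \<Sum>\<beta><n. (of_nat (Suc m) * \<mu> \<beta> m * cnj (\<mu> \<alpha> m)) * v $ \<beta> * cnj (v $ \<alpha>))"
      by (simp add: sum_product sum_distrib_left mult_ac del: of_nat_Suc)
    finally show "(\<Sum>\<alpha><n. \<Sum>\<beta><n. (of_nat (Suc m) * \<mu> \<beta> m * cnj (\<mu> \<alpha> m)) * v $ \<beta> * cnj (v $ \<alpha>))
      = complex_of_real (real (Suc m) * (norm (fps_nth (moment n u v) m))\<^sup>2)" ..
  qed
  finally show ?thesis .
qed

lemma mat_adjoint_quadratic_form:
  fixes J G :: "complex Matrix.mat"
  assumes J: "J \<in> carrier_mat n n" and G: "G \<in> carrier_mat n n" and v: "v \<in> carrier_vec n"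
  shows "((mat_adjoint J * G * J) *\<^sub>v v) \<bullet>c v = (G *\<^sub>v (J *\<^sub>v v)) \<bullet>c (J *\<^sub>v v)"
proof -
  have adj: "mat_adjoint J \<in> carrier_mat n n"
    using J by (intro carrier_matI) (auto simp: mat_adjoint_def)
  define w where "w = G *\<^sub>v (J *\<^sub>v v)"
  have w: "w \<in> carrier_vec n" using J G v by (simp add: w_def)
  have idx: "mat_adjoint J $$ (i, j) = cnj (J $$ (j, i))" if "i < n" "j < n" for i j
    using J that by (simp add: mat_adjoint_def mat_of_rows_index conjugate_complex_def)
  have "(mat_adjoint J * G * J) *\<^sub>v v = mat_adjoint J *\<^sub>v w"
    using adj J G v by (simp add: w_def assoc_mult_mat_vec[where n\<^sub>1 = n and n\<^sub>2 = n and n\<^sub>3 = n]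
        assoc_mult_mat[where n\<^sub>1 = n and n\<^sub>2 = n and n\<^sub>3 = n and n\<^sub>4 = n])
  moreover have "(mat_adjoint J *\<^sub>v w) \<bullet>c v = (\<Sum>i<n. \<Sum>j<n. cnj (J $$ (j, i)) * w $ j * cnj (v $ i))"
    using adj w v by (simp add: scalar_prod_def atLeast0LessThan idx sum_distrib_right conjugate_complex_def)
  moreover have "\<dots> = (\<Sum>j<n. \<Sum>i<n. cnj (J $$ (j, i)) * w $ j * cnj (v $ i))"
    by (rule sum.swap)
  moreover have "\<dots> = w \<bullet>c (J *\<^sub>v v)"
    using J w v by (simp add: scalar_prod_def atLeast0LessThan sum_distrib_left conjugate_complex_def mult_ac)
  ultimately show ?thesis by (simp add: w_def)
qed

section \<open>The pullback metric\<close>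

text \<open>\<open>Lam\<close> depends on the moment sequence alone, so it can be named without
  choosing constants; \<open>disc_functional_moment\<close> supplies them whenever the locale is
  entered.\<close>

abbreviation moment_functional ::
    "nat \<Rightarrow> complex Matrix.vec \<Rightarrow> complex Matrix.vec \<Rightarrow> (complex \<Rightarrow> complex) \<Rightarrow> complex" where
  "moment_functional n u v \<equiv> disc_functional.Lam (fps_nth (moment n u v))"

lemma disc_functional_moment:
  assumes u: "u \<in> sym_polydisc n" and v: "v \<in> carrier_vec n"
  obtains A \<rho> where "disc_functional (fps_nth (moment n u v)) A \<rho>"
proof (rule coord_line_bounds[OF u])
  fix \<epsilon> \<rho> A :: real
  assume \<epsilon>: "0 < \<epsilon>" and \<rho>: "0 < \<rho>" "\<rho> < 1" and A: "0 \<le> A"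
    and moment: "\<And>\<alpha> \<beta> t m. norm t < \<epsilon> \<Longrightarrow>
      norm (fps_nth (moment n (coord_line u \<beta> t) (unit_vec n \<alpha>)) m) \<le> A * \<rho> ^ m"
  have m: "norm (fps_nth (moment n u (unit_vec n \<alpha>)) m) \<le> A * \<rho> ^ m" for \<alpha> m
    using moment[of 0 0 \<alpha> m] \<epsilon> coord_line_0[OF sym_polydisc_carrier[OF u]] by simp
  have "norm (fps_nth (moment n u v) m) \<le> (\<Sum>k<n. norm (v $ k) * A) * \<rho> ^ m" for m
    unfolding moment_linear[OF v] sum_distrib_right
    by (intro sum_norm_le) (simp add: norm_mult mult.assoc m mult_left_mono)
  then show thesis using \<rho> by (intro that[of "\<Sum>k<n. norm (v $ k) * A" \<rho>]) (simp add: disc_functional_def)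
qed

lemma moment_functional_linear:
  assumes u: "u \<in> sym_polydisc n" and v: "v \<in> carrier_vec n" and H: "H holomorphic_on ball 0 1"
  shows "moment_functional n u v H = (\<Sum>k<n. v $ k * moment_functional n u (unit_vec n k) H)"
proof -
  have s: "(\<lambda>m. coeff0 H m * fps_nth (moment n u w) m) sums moment_functional n u w H"
    if "w \<in> carrier_vec n" for w
  proof (rule disc_functional_moment[OF u that])
    fix A \<rho> assume "disc_functional (fps_nth (moment n u w)) A \<rho>"
    then interpret disc_functional "fps_nth (moment n u w)" A \<rho> .
    show ?thesis unfolding Lam_def using Lam_summable[OF H] by (rule summable_sums)
  qed
  have "(\<lambda>m. \<Sum>k<n. v $ k * (coeff0 H m * fps_nth (moment n u (unit_vec n k)) m))
      sums (\<Sum>k<n. v $ k * moment_functional n u (unit_vec n k) H)"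
    by (intro sums_sum sums_mult s) simp
  then have "(\<lambda>m. coeff0 H m * fps_nth (moment n u v) m)
      sums (\<Sum>k<n. v $ k * moment_functional n u (unit_vec n k) H)"
    unfolding moment_linear[OF v] by (simp add: sum_distrib_left mult_ac)
  then show ?thesis by (rule sums_unique2[OF s[OF v]])
qed

text \<open>The series E \<cdot> moment equals \<open>dir_fps\<close>, which has no coefficients
  from index n on. That is a linear recurrence for the moments with the root polynomial as
  characteristic polynomial.\<close>

lemma moment_functional_annihilates:
  assumes u: "u \<in> sym_polydisc n" and v: "v \<in> carrier_vec n" and q: "q holomorphic_on ball 0 1"
  shows "moment_functional n u v (\<lambda>z. (\<Prod>i<n. z - desym n u $ i) * q z) = 0"
proof (rule disc_functional_moment[OF u v])
  fix A \<rho> assume "disc_functional (fps_nth (moment n u v)) A \<rho>"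
  then interpret disc_functional "fps_nth (moment n u v)" A \<rho> .
  have Z: "desym n u \<in> carrier_vec n" using desym(1)[OF u] by (simp add: polydisc_def)
  define E where "E k = (-1) ^ k * esym_ext n u k" for k
  have prod: "(\<Prod>i<n. z - desym n u $ i) = (\<Sum>k\<le>n. E k * z ^ (n - k))" for z
    using prod_linear_sym_map[OF Z, of z] by (simp add: desym(2)[OF u] E_def)
  have "Lam (\<lambda>z. (\<Prod>i<n. z - desym n u $ i) * q z) = Lam (\<lambda>z. \<Sum>k\<le>n. E k * (z ^ (n - k) * q z))"
    by (simp add: prod sum_distrib_right mult.assoc)
  also have "\<dots> = (\<Sum>k\<le>n. E k * Lam (\<lambda>z. z ^ (n - k) * q z))"
    using q by (intro Lam_sum) (auto intro!: holomorphic_intros)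
  finally have L: "Lam (\<lambda>z. (\<Prod>i<n. z - desym n u $ i) * q z)
    = (\<Sum>k\<le>n. E k * Lam (\<lambda>z. z ^ (n - k) * q z))" .
  have "(\<lambda>l. \<Sum>k\<le>n. E k * (coeff0 q l * fps_nth (moment n u v) (l + (n - k))))
      sums (\<Sum>k\<le>n. E k * Lam (\<lambda>z. z ^ (n - k) * q z))"
    by (intro sums_sum sums_mult Lam_power_mult q)
  moreover have "(\<Sum>k\<le>n. E k * (coeff0 q l * fps_nth (moment n u v) (l + (n - k)))) = 0" for l
  proof -
    have "(\<Sum>k\<le>n. E k * fps_nth (moment n u v) (l + (n - k)))
        = (\<Sum>k\<le>l + n. E k * fps_nth (moment n u v) (l + n - k))"
      by (intro sum.mono_neutral_cong_left) (auto simp: E_def esym_ext_def)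
    also have "\<dots> = fps_nth (esym_fps n u * moment n u v) (l + n)"
      by (simp add: fps_mult_nth esym_fps_def E_def atLeast0AtMost)
    also have "\<dots> = 0" unfolding esym_fps_mult_moment by (simp add: dir_fps_def)
    finally have "coeff0 q l * (\<Sum>k\<le>n. E k * fps_nth (moment n u v) (l + (n - k))) = 0" by simp
    then show ?thesis by (simp add: sum_distrib_left mult_ac)
  qed
  ultimately have "(\<lambda>l. 0) sums (\<Sum>k\<le>n. E k * Lam (\<lambda>z. z ^ (n - k) * q z))"
    by (simp only:)
  then show ?thesis unfolding L by (rule sums_unique2[OF _ sums_zero])
qed

lemma sum_desym_sums:
  assumes w: "w \<in> sym_polydisc n" and Q: "Q holomorphic_on ball 0 1"
  shows "(\<lambda>k. coeff0 Q k * psum n w k) sums (\<Sum>i<n. Q (desym n w $ i))"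
proof -
  have "(\<lambda>k. \<Sum>i<n. coeff0 Q k * desym n w $ i ^ k) sums (\<Sum>i<n. Q (desym n w $ i))"
    using desym(1)[OF w] by (intro sums_sum coeff0_sums Q) (auto simp: polydisc_def)
  then show ?thesis by (simp add: psum_def sum_distrib_left)
qed

text \<open>For Q = z^m this is the derivative of a power sum; the general case follows termwise
  from the Taylor series of Q.\<close>

lemma sum_desym_has_derivative:
  assumes u: "u \<in> sym_polydisc n" and Q: "Q holomorphic_on ball 0 1"
  shows "((\<lambda>t. \<Sum>i<n. Q (desym n (coord_line u \<beta> t) $ i)) has_field_derivative
    moment_functional n u (unit_vec n \<beta>) (deriv Q)) (at 0)"
proof (rule coord_line_bounds[OF u])
  fix \<epsilon> \<rho> A :: real
  assume \<epsilon>: "0 < \<epsilon>" and \<rho>: "0 < \<rho>" "\<rho> < 1" and A: "0 \<le> A"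
    and line: "\<And>\<beta> t. norm t < \<epsilon> \<Longrightarrow> coord_line u \<beta> t \<in> sym_polydisc n"
    and psum: "\<And>\<beta> t m. norm t < \<epsilon> \<Longrightarrow> norm (psum n (coord_line u \<beta> t) m) \<le> A * \<rho> ^ m"
    and moment: "\<And>\<alpha> \<beta> t m. norm t < \<epsilon> \<Longrightarrow>
      norm (fps_nth (moment n (coord_line u \<beta> t) (unit_vec n \<alpha>)) m) \<le> A * \<rho> ^ m"
  have uc: "u \<in> carrier_vec n" using sym_polydisc_carrier[OF u] .
  define \<phi> where "\<phi> t m = fps_nth (moment n (coord_line u \<beta> t) (unit_vec n \<beta>)) m" for t m
  have \<phi>0: "\<phi> 0 = fps_nth (moment n u (unit_vec n \<beta>))"
    by (simp add: \<phi>_def fun_eq_iff coord_line_0[OF uc])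
  interpret disc_functional "\<phi> 0" A \<rho>
    using \<rho> \<epsilon> moment[of 0] by unfold_locales (auto simp: \<phi>_def)
  obtain B where B: "\<And>z. z \<in> cball 0 R \<Longrightarrow> norm (Q z) \<le> B"
    using bounded_on_cball[OF Q] by blast
  define f where "f m t = coeff0 Q m * psum n (coord_line u \<beta> t) m" for m t
  \<comment> \<open>The term m = 0 is the constant n times Q(0) and has derivative 0.\<close>
  define f' where "f' m t = (if m = 0 then 0 else coeff0 Q m * (of_nat m * \<phi> t (m - 1)))" for m t
  have f_deriv: "(f m has_field_derivative f' m t) (at t)" if t: "t \<in> ball 0 \<epsilon>" for m t
  proof (cases m)
    case 0
    then show ?thesis by (simp add: f_def[abs_def] f'_def psum_def)
  next
    case (Suc k)
    have "norm t < \<epsilon>" using t by simp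
    from DERIV_cmult[OF psum_line_has_derivative[OF uc line this], of "coeff0 Q m" \<beta> k]
    show ?thesis by (simp add: f_def[abs_def] f'_def \<phi>_def Suc)
  qed
  have "norm (f m t) \<le> B * A * (\<rho> / R) ^ m" if t: "t \<in> ball 0 \<epsilon>" for m t
  proof -
    have "0 \<le> B" using B[of 0] R by (auto intro: order_trans[OF norm_ge_zero])
    have "norm (f m t) \<le> (B / R ^ m) * (A * \<rho> ^ m)"
      unfolding f_def norm_mult using R(1,2) B Q t \<open>0 \<le> B\<close>
      by (intro mult_mono norm_coeff0_le psum) auto
    then show ?thesis by (simp add: power_divide)
  qed
  then have ev: "\<forall>\<^sub>F m in sequentially. \<forall>t\<in>ball 0 \<epsilon>. norm (f m t) \<le> B * A * (\<rho> / R) ^ m"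
    by simp
  obtain g g' where gg': "\<forall>t\<in>ball 0 \<epsilon>. ((\<lambda>m. f m t) sums g t) \<and> ((\<lambda>m. f' m t) sums g' t) \<and>
      (g has_field_derivative g' t) (at t)"
    by (rule series_and_derivative_comparison[OF open_ball sums_summable[OF majorant_sums] f_deriv ev])
  have "0 \<in> ball (0::complex) \<epsilon>" using \<epsilon> by simp
  then have "(\<lambda>m. f' m 0) sums g' 0" "(g has_field_derivative g' 0) (at 0)" using gg' by auto
  have "(\<lambda>m. f' (Suc m) 0) sums g' 0"
    using \<open>(\<lambda>m. f' m 0) sums g' 0\<close> by (subst sums_Suc_iff) (simp add: f'_def)
  then have "(\<lambda>m. coeff0 (deriv Q) m * \<phi> 0 m) sums g' 0"
    by (simp add: f'_def coeff0_deriv[OF Q] mult_ac)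
  then have "g' 0 = Lam (deriv Q)" unfolding Lam_def by (rule sums_unique)
  then have "(g has_field_derivative Lam (deriv Q)) (at 0)"
    using \<open>(g has_field_derivative g' 0) (at 0)\<close> by simp
  moreover have "g t = (\<Sum>i<n. Q (desym n (coord_line u \<beta> t) $ i))" if "t \<in> ball 0 \<epsilon>" for t
  proof (rule sums_unique2)
    show "(\<lambda>m. f m t) sums g t" using gg' that by blast
    show "(\<lambda>m. f m t) sums (\<Sum>i<n. Q (desym n (coord_line u \<beta> t) $ i))"
      unfolding f_def using that by (intro sum_desym_sums line Q) simp
  qed
  ultimately have "((\<lambda>t. \<Sum>i<n. Q (desym n (coord_line u \<beta> t) $ i)) has_field_derivative
      Lam (deriv Q)) (at 0)"
    using has_field_derivative_transform_within_open[of g _ 0 "ball 0 \<epsilon>"] \<epsilon> by simp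
  then show ?thesis by (simp only: \<phi>0)
qed

lemma psum_sym_map:
  assumes "Z \<in> polydisc n"
  shows "psum n (sym_map n Z) m = (\<Sum>i<n. Z $ i ^ m)"
  using arg_cong[OF desym_sym_map[OF assms], where f = "\<lambda>M. \<Sum>\<^sub># (image_mset (\<lambda>z. z ^ m) M)"]
  by (simp add: psum_def image_mset.compositionality comp_def sum_unfold_sum_mset)

lemma induced_map_in_sym_polydisc:
  assumes f: "disc_self_map f" and u: "u \<in> sym_polydisc n"
  shows "induced_map n f u \<in> sym_polydisc n"
    and "psum n (induced_map n f u) m = (\<Sum>i<n. f (desym n u $ i) ^ m)"
proof -
  have Z: "desym n u \<in> polydisc n" by (rule desym(1)[OF u])
  then have W: "map_vec f (desym n u) \<in> polydisc n"
    using f by (auto simp: polydisc_def disc_self_map_def image_subset_iff)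
  then show "induced_map n f u \<in> sym_polydisc n"
    by (auto simp: induced_map_def sym_polydisc_def)
  have "dim_vec (desym n u) = n" using Z by (simp add: polydisc_def)
  then show "psum n (induced_map n f u) m = (\<Sum>i<n. f (desym n u $ i) ^ m)"
    unfolding induced_map_def psum_sym_map[OF W] by simp
qed

text \<open>The chain rule read off in power sums. The sum of f(z_i)^(m+1) is a power sum at the
  image point, so its derivative is (m+1) times a moment there; it is also the functional at
  \<open>u\<close> applied to (f^(m+1))'.\<close>

lemma moment_induced_map:
  assumes f: "disc_self_map f" and u: "u \<in> sym_polydisc n" and v: "v \<in> carrier_vec n"
  shows "fps_nth (moment n (induced_map n f u) (jacobian n (induced_map n f) u *\<^sub>v v)) m
    = moment_functional n u v (\<lambda>z. f z ^ m * deriv f z)"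
proof -
  define F where "F = induced_map n f"
  define J where "J = jacobian n F u"
  have J: "J \<in> carrier_mat n n" by (simp add: J_def jacobian_def)
  have hol: "f holomorphic_on ball 0 1" using f by (simp add: disc_self_map_def)
  have uc: "u \<in> carrier_vec n" using sym_polydisc_carrier[OF u] .
  have hol': "(\<lambda>z. f z ^ m * deriv f z) holomorphic_on ball 0 1"
    using hol by (intro holomorphic_intros holomorphic_deriv) auto
  have col: "fps_nth (moment n (F u) (col J \<beta>)) m
      = moment_functional n u (unit_vec n \<beta>) (\<lambda>z. f z ^ m * deriv f z)" if \<beta>: "\<beta> < n" for \<beta>
  proof -
    have "eventually (\<lambda>t. coord_line u \<beta> t \<in> sym_polydisc n) (nhds 0)"
    proof (rule coord_line_bounds[OF u])
      fix \<epsilon> :: real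
      assume \<epsilon>: "0 < \<epsilon>" and line: "\<And>\<beta> t. norm t < \<epsilon> \<Longrightarrow> coord_line u \<beta> t \<in> sym_polydisc n"
      have "eventually (\<lambda>t. t \<in> ball 0 \<epsilon>) (nhds 0)" using \<epsilon> by (intro eventually_nhds_in_open) auto
      then show ?thesis by eventually_elim (simp add: line)
    qed
    then have ev: "eventually (\<lambda>t. F (coord_line u \<beta> t) \<in> sym_polydisc n) (nhds 0)"
      and ev': "\<And>k. eventually (\<lambda>t. psum n (F (coord_line u \<beta> t)) k
          = (\<Sum>i<n. f (desym n (coord_line u \<beta> t) $ i) ^ k)) (nhds 0)"
      by (auto elim!: eventually_mono simp: F_def induced_map_in_sym_polydisc[OF f])
    have der: "((\<lambda>t. psum n (F (coord_line u \<beta> t)) k) has_field_derivative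
        moment_functional n u (unit_vec n \<beta>) (deriv (\<lambda>z. f z ^ k))) (at 0)" for k
    proof -
      have "(\<lambda>z. f z ^ k) holomorphic_on ball 0 1" using hol by (intro holomorphic_intros)
      from sum_desym_has_derivative[OF u this, of \<beta>]
      show ?thesis by (simp only: DERIV_cong_ev[OF refl ev' refl])
    qed
    have "((\<lambda>t. F (coord_line u \<beta> t) $ k) has_field_derivative col J \<beta> $ k) (at 0)" if k: "k < n" for k
    proof -
      \<comment> \<open>Without this, \<open>deriv\<close> in \<open>jacobian\<close> would carry no
        information.\<close>
      have "(\<lambda>t. F (coord_line u \<beta> t) $ k) field_differentiable at 0"
        using ev by (rule sym_coordinate_differentiable) (use der k in \<open>auto simp: field_differentiable_def\<close>)
      then show ?thesis
        using k \<beta> by (simp add: J_def jacobian_def DERIV_deriv_iff_field_differentiable)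
    qed
    from psum_has_derivative[OF ev this, of m]
    have "of_nat (Suc m) * fps_nth (moment n (F u) (col J \<beta>)) m
        = moment_functional n u (unit_vec n \<beta>) (deriv (\<lambda>z. f z ^ Suc m))"
      unfolding coord_line_0[OF uc] by (rule DERIV_unique[OF _ der])
    also have "\<dots> = of_nat (Suc m) * moment_functional n u (unit_vec n \<beta>) (\<lambda>z. f z ^ m * deriv f z)"
    proof (rule disc_functional_moment[OF u unit_vec_carrier[of n \<beta>]])
      fix A \<rho> assume "disc_functional (fps_nth (moment n u (unit_vec n \<beta>))) A \<rho>"
      then interpret disc_functional "fps_nth (moment n u (unit_vec n \<beta>))" A \<rho> .
      have "deriv (\<lambda>z. f z ^ Suc m) z = of_nat (Suc m) * (f z ^ m * deriv f z)"
        if "z \<in> ball 0 1" for z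
      proof -
        have "(f has_field_derivative deriv f z) (at z)"
          using hol that by (rule holomorphic_derivI[OF _ open_ball])
        from DERIV_imp_deriv[OF DERIV_power[OF this, of "Suc m"]] show ?thesis
          by (simp add: mult_ac)
      qed
      then have "Lam (deriv (\<lambda>z. f z ^ Suc m)) = Lam (\<lambda>z. of_nat (Suc m) * (f z ^ m * deriv f z))"
        by (rule Lam_cong)
      then show ?thesis using Lam_cmult[OF hol'] by simp
    qed
    finally show ?thesis by (simp del: of_nat_Suc)
  qed
  have Jv: "J *\<^sub>v v \<in> carrier_vec n" using J v by simp
  have "fps_nth (moment n (F u) (J *\<^sub>v v)) m
      = (\<Sum>\<alpha><n. (\<Sum>\<beta><n. J $$ (\<alpha>, \<beta>) * v $ \<beta>) * fps_nth (moment n (F u) (unit_vec n \<alpha>)) m)"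
    unfolding moment_linear[OF Jv] using J v by (simp add: scalar_prod_def atLeast0LessThan)
  also have "\<dots> = (\<Sum>\<beta><n. v $ \<beta> * (\<Sum>\<alpha><n. J $$ (\<alpha>, \<beta>) * fps_nth (moment n (F u) (unit_vec n \<alpha>)) m))"
    unfolding sum_distrib_left sum_distrib_right by (subst sum.swap) (simp add: mult_ac)
  also have "\<dots> = (\<Sum>\<beta><n. v $ \<beta> * fps_nth (moment n (F u) (col J \<beta>)) m)"
  proof (intro sum.cong refl arg_cong2[where f = "(*)"])
    fix \<beta> assume "\<beta> \<in> {..<n}"
    then show "(\<Sum>\<alpha><n. J $$ (\<alpha>, \<beta>) * fps_nth (moment n (F u) (unit_vec n \<alpha>)) m)
        = fps_nth (moment n (F u) (col J \<beta>)) m"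
      using J by (subst moment_linear) auto
  qed
  also have "\<dots> = (\<Sum>\<beta><n. v $ \<beta> * moment_functional n u (unit_vec n \<beta>) (\<lambda>z. f z ^ m * deriv f z))"
    by (simp add: col)
  also have "\<dots> = moment_functional n u v (\<lambda>z. f z ^ m * deriv f z)"
    by (rule moment_functional_linear[OF u v hol', symmetric])
  finally show ?thesis by (simp add: F_def J_def)
qed

lemma quadratic_forms:
  assumes f: "disc_self_map f" and u: "u \<in> sym_polydisc n" and v: "v \<in> carrier_vec n"
  defines "G \<equiv> (\<lambda>m. real (m + 1) * (norm (fps_nth (moment n u v) m))\<^sup>2)"
    and "P \<equiv> (\<lambda>m. real (m + 1) * (norm (moment_functional n u v (\<lambda>z. f z ^ m * deriv f z)))\<^sup>2)"
  shows "summable G" "summable P"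
    and "((complex_of_real C \<cdot>\<^sub>m szego_metric n u - pullback n (induced_map n f) (szego_metric n) u) *\<^sub>v v) \<bullet>c v
      = complex_of_real (C * suminf G - suminf P)"
proof -
  define F where "F = induced_map n f"
  define J where "J = jacobian n F u"
  have J: "J \<in> carrier_mat n n" by (simp add: J_def jacobian_def)
  have Fu: "F u \<in> sym_polydisc n" unfolding F_def by (rule induced_map_in_sym_polydisc[OF f u])
  have Jv: "J *\<^sub>v v \<in> carrier_vec n" using J v by simp
  have g: "szego_metric n w \<in> carrier_mat n n" for w by (simp add: szego_metric_def)
  have 1: "(\<lambda>m. complex_of_real (G m)) sums ((szego_metric n u *\<^sub>v v) \<bullet>c v)"
    using szego_metric_quadratic_form[OF u v] by (simp add: G_def)
  have "(szego_metric n (F u) *\<^sub>v (J *\<^sub>v v)) \<bullet>c (J *\<^sub>v v)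
      = (pullback n F (szego_metric n) u *\<^sub>v v) \<bullet>c v"
    unfolding pullback_def J_def[symmetric] by (rule mat_adjoint_quadratic_form[OF J g v, symmetric])
  then have 2: "(\<lambda>m. complex_of_real (P m)) sums ((pullback n F (szego_metric n) u *\<^sub>v v) \<bullet>c v)"
    using szego_metric_quadratic_form[OF Fu Jv] moment_induced_map[OF f u v]
    by (simp add: P_def F_def J_def)
  show G: "summable G" using sums_summable[OF 1] by (simp only: summable_complex_of_real)
  show P: "summable P" using sums_summable[OF 2] by (simp only: summable_complex_of_real)
  have adj: "mat_adjoint J \<in> carrier_mat n n"
    using J by (intro carrier_matI) (auto simp: mat_adjoint_def)
  have pb: "pullback n F (szego_metric n) u \<in> carrier_mat n n"
    unfolding pullback_def J_def[symmetric]
    by (rule mult_carrier_mat[OF mult_carrier_mat[OF adj g] J])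
  have "((complex_of_real C \<cdot>\<^sub>m szego_metric n u - pullback n F (szego_metric n) u) *\<^sub>v v) \<bullet>c v
      = complex_of_real C * ((szego_metric n u *\<^sub>v v) \<bullet>c v) - (pullback n F (szego_metric n) u *\<^sub>v v) \<bullet>c v"
  proof -
    have D: "complex_of_real C \<cdot>\<^sub>m szego_metric n u - pullback n F (szego_metric n) u \<in> carrier_mat n n"
      using pb by (rule minus_carrier_mat)
    show ?thesis
      unfolding quadratic_form_eq_sum[OF D v] quadratic_form_eq_sum[OF g v] quadratic_form_eq_sum[OF pb v]
      using carrier_matD[OF g] carrier_matD[OF pb]
      by (simp add: sum_distrib_left sum_subtractf[symmetric] algebra_simps)
  qed
  also have "(szego_metric n u *\<^sub>v v) \<bullet>c v = complex_of_real (suminf G)"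
    using sums_unique2[OF 1 sums_of_real[OF summable_sums[OF G]]] .
  also have "(pullback n F (szego_metric n) u *\<^sub>v v) \<bullet>c v = complex_of_real (suminf P)"
    using sums_unique2[OF 2 sums_of_real[OF summable_sums[OF P]]] .
  finally show "((complex_of_real C \<cdot>\<^sub>m szego_metric n u - pullback n (induced_map n f) (szego_metric n) u) *\<^sub>v v) \<bullet>c v
      = complex_of_real (C * suminf G - suminf P)"
    by (simp add: F_def)
qed

lemma pullback_metric_le_iff:
  assumes f: "disc_self_map f"
  shows "pullback_metric_le n (induced_map n f) C \<longleftrightarrow>
    (\<forall>u\<in>sym_polydisc n. \<forall>v\<in>carrier_vec n.
      (\<Sum>m. real (m + 1) * (norm (moment_functional n u v (\<lambda>z. f z ^ m * deriv f z)))\<^sup>2)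
      \<le> C * (\<Sum>m. real (m + 1) * (norm (fps_nth (moment n u v) m))\<^sup>2))"
proof -
  have "complex_of_real C \<cdot>\<^sub>m szego_metric n u - pullback n (induced_map n f) (szego_metric n) u
      \<in> carrier_mat n n" for u
    by (intro carrier_matI) (simp_all add: pullback_def jacobian_def mat_adjoint_def)
  then show ?thesis
    unfolding pullback_metric_le_def pos_semidef_def
    by (simp add: quadratic_forms(3)[OF f] less_eq_complex_def del: of_nat_Suc)
qed

section \<open>Contraction and sharpness\<close>

text \<open>\<open>h\<close> has to match f only through the functional at the given
  \<open>u\<close> and \<open>v\<close>. This covers both h = f for a Blaschke product and an
  interpolant depending on \<open>u\<close>.\<close>

lemma moment_energy_bound:
  assumes f: "disc_self_map f" and u: "u \<in> sym_polydisc n" and v: "v \<in> carrier_vec n"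
    and h: "rational_inner d h"
    and eq: "\<And>m. moment_functional n u v (\<lambda>z. f z ^ m * deriv f z)
      = moment_functional n u v (\<lambda>z. h z ^ m * deriv h z)"
  shows "(\<Sum>m. real (m + 1) * (norm (moment_functional n u v (\<lambda>z. f z ^ m * deriv f z)))\<^sup>2)
    \<le> real (min n d) * (\<Sum>m. real (m + 1) * (norm (fps_nth (moment n u v) m))\<^sup>2)"
proof (rule disc_functional_moment[OF u v])
  fix A \<rho> assume "disc_functional (fps_nth (moment n u v)) A \<rho>"
  then interpret disc_functional "fps_nth (moment n u v)" A \<rho> .
  show ?thesis
  proof (rule suminf_le_const[OF quadratic_forms(2)[OF f u v]])
    fix N
    show "(\<Sum>m<N. real (m + 1) * (norm (Lam (\<lambda>z. f z ^ m * deriv f z)))\<^sup>2)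
        \<le> real (min n d) * (\<Sum>m. real (m + 1) * (norm (fps_nth (moment n u v) m))\<^sup>2)"
      unfolding eq by (rule energy_contraction[OF moment_functional_annihilates[OF u v] h])
  qed
qed

lemma pullback_metric_le_rational_inner:
  assumes "disc_self_map f" "rational_inner d f"
  shows "pullback_metric_le n (induced_map n f) (real (min n d))"
  unfolding pullback_metric_le_iff[OF assms(1)] using moment_energy_bound[OF assms(1) _ _ assms(2)] by blast

text \<open>The difference of the (m+1)-st powers of f and h is divisible by p^2, with p the root
  polynomial, so its derivative is divisible by p and is annihilated.\<close>

lemma interpolation_preserves_functional:
  assumes u: "u \<in> sym_polydisc n" and v: "v \<in> carrier_vec n"
    and f: "f holomorphic_on ball 0 1" and h: "h holomorphic_on ball 0 1"
    and r: "r holomorphic_on ball 0 1"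
    and fh: "\<And>z. z \<in> ball 0 1 \<Longrightarrow> f z - h z = (\<Prod>i<n. z - desym n u $ i)\<^sup>2 * r z"
  shows "moment_functional n u v (\<lambda>z. f z ^ m * deriv f z)
    = moment_functional n u v (\<lambda>z. h z ^ m * deriv h z)"
proof (rule disc_functional_moment[OF u v])
  fix A \<rho> assume "disc_functional (fps_nth (moment n u v)) A \<rho>"
  then interpret disc_functional "fps_nth (moment n u v)" A \<rho> .
  define p where "p z = (\<Prod>i<n. z - desym n u $ i)" for z
  have p: "p holomorphic_on ball 0 1" unfolding p_def by (intro holomorphic_intros)
  define s where "s z = r z * (\<Sum>i<Suc m. h z ^ (m - i) * f z ^ i)" for z
  have s: "s holomorphic_on ball 0 1" unfolding s_def using f h r by (intro holomorphic_intros)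
  define q where "q z = (2 * deriv p z * s z + p z * deriv s z) / of_nat (Suc m)" for z
  have q: "q holomorphic_on ball 0 1"
    unfolding q_def using p s by (intro holomorphic_intros holomorphic_deriv) auto
  have D: "(g has_field_derivative deriv g z) (at z)"
    if "g holomorphic_on ball 0 1" "z \<in> ball 0 1" for g z
    using that by (rule holomorphic_derivI[OF _ open_ball])
  have pw: "f z ^ Suc m - h z ^ Suc m = (p z)\<^sup>2 * s z" if z: "z \<in> ball 0 1" for z
    using fh[OF z] by (simp only: power_diff_sumr2 s_def p_def mult.assoc diff_Suc_Suc)
  have "f z ^ m * deriv f z = h z ^ m * deriv h z + p z * q z" if z: "z \<in> ball 0 1" for z
  proof -
    have "((\<lambda>z. f z ^ Suc m - h z ^ Suc m) has_field_derivative
        of_nat (Suc m) * (deriv f z * f z ^ m) - of_nat (Suc m) * (deriv h z * h z ^ m)) (at z)"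
      using DERIV_diff[OF DERIV_power[OF D[OF f z], of "Suc m"] DERIV_power[OF D[OF h z], of "Suc m"]]
      by (simp del: of_nat_Suc power_Suc)
    then have "((\<lambda>z. (p z)\<^sup>2 * s z) has_field_derivative
        of_nat (Suc m) * (deriv f z * f z ^ m) - of_nat (Suc m) * (deriv h z * h z ^ m)) (at z)"
      by (rule has_field_derivative_transform_within_open[OF _ open_ball z]) (rule pw)
    moreover have "((\<lambda>z. (p z)\<^sup>2 * s z) has_field_derivative
        of_nat 2 * (deriv p z * p z ^ (2 - Suc 0)) * s z + deriv s z * (p z)\<^sup>2) (at z)"
      by (rule DERIV_mult[OF DERIV_power[OF D[OF p z], of 2] D[OF s z]])
    ultimately have "of_nat (Suc m) * (deriv f z * f z ^ m) - of_nat (Suc m) * (deriv h z * h z ^ m)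
        = of_nat 2 * (deriv p z * p z ^ (2 - Suc 0)) * s z + deriv s z * (p z)\<^sup>2"
      by (rule DERIV_unique)
    also have "\<dots> = p z * (2 * deriv p z * s z + p z * deriv s z)"
      by (simp add: power2_eq_square algebra_simps)
    also have "2 * deriv p z * s z + p z * deriv s z = of_nat (Suc m) * q z"
      by (simp add: q_def del: of_nat_Suc)
    finally have "of_nat (Suc m) * (f z ^ m * deriv f z)
        = of_nat (Suc m) * (h z ^ m * deriv h z + p z * q z)"
      by (simp add: algebra_simps del: of_nat_Suc)
    then show ?thesis by (simp del: of_nat_Suc)
  qed
  then have "Lam (\<lambda>z. f z ^ m * deriv f z) = Lam (\<lambda>z. h z ^ m * deriv h z + p z * q z)"
    by (rule Lam_cong)
  also have "\<dots> = Lam (\<lambda>z. h z ^ m * deriv h z) + Lam (\<lambda>z. p z * q z)"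
    using h p q by (intro Lam_add holomorphic_intros holomorphic_deriv) auto
  also have "Lam (\<lambda>z. p z * q z) = 0"
    unfolding p_def by (rule moment_functional_annihilates[OF u v q])
  finally show ?thesis by simp
qed

lemma pullback_metric_le_disc_self_map:
  assumes f: "disc_self_map f"
  shows "pullback_metric_le n (induced_map n f) (real n)"
  unfolding pullback_metric_le_iff[OF f]
proof (intro ballI)
  fix u v :: "complex Matrix.vec"
  assume u: "u \<in> sym_polydisc n" and v: "v \<in> carrier_vec n"
  let ?G = "\<Sum>m. real (m + 1) * (norm (fps_nth (moment n u v) m))\<^sup>2"
  have hol: "f holomorphic_on ball 0 1" and f1: "\<And>z. z \<in> ball 0 1 \<Longrightarrow> norm (f z) \<le> 1"
    using f by (auto simp: disc_self_map_def image_subset_iff intro: less_imp_le)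
  define xs where "xs = map (\<lambda>i. desym n u $ i) [0..<n]"
  have "set xs \<subseteq> ball 0 1" using desym(1)[OF u] by (auto simp: xs_def polydisc_def)
  from rational_inner_hermite_interpolation[OF hol f1 this] obtain d h r
    where h: "rational_inner d h" and r: "r holomorphic_on ball 0 1"
      and fh: "\<And>z. z \<in> ball 0 1 \<Longrightarrow> f z - h z = (\<Prod>x\<leftarrow>xs. z - x)\<^sup>2 * r z"
    by metis
  have prod: "(\<Prod>x\<leftarrow>xs. z - x) = (\<Prod>i<n. z - desym n u $ i)" for z
    by (simp add: xs_def comp_def prod.distinct_set_conv_list[symmetric] atLeast0LessThan)
  have "h holomorphic_on ball 0 1" using h realizesD(1) unfolding rational_inner_def by blast
  from interpolation_preserves_functional[OF u v hol this r fh[unfolded prod]]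
  have "(\<Sum>m. real (m + 1) * (norm (moment_functional n u v (\<lambda>z. f z ^ m * deriv f z)))\<^sup>2)
      \<le> real (min n d) * ?G"
    by (rule moment_energy_bound[OF f u v h])
  \<comment> \<open>The degree \<open>d\<close> of the interpolant depends on \<open>u\<close> and
    is dropped.\<close>
  also have "\<dots> \<le> real n * ?G"
    by (intro mult_right_mono suminf_nonneg quadratic_forms(1)[OF f u v]) auto
  finally show "(\<Sum>m. real (m + 1) * (norm (moment_functional n u v (\<lambda>z. f z ^ m * deriv f z)))\<^sup>2)
      \<le> real n * ?G" .
qed

lemma finite_blaschke_disc_self_map:
  assumes B: "finite_blaschke d B" and d: "d \<ge> 1"
  shows "disc_self_map B"
proof -
  obtain \<theta> a where a: "\<And>k. k < d \<Longrightarrow> a k \<in> ball 0 1"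
    and B': "\<And>z. z \<in> ball 0 1 \<Longrightarrow> B z = cis \<theta> * (\<Prod>k<d. (z - a k) / (1 - cnj (a k) * z))"
    using B unfolding finite_blaschke_def by blast
  obtain d' where d': "d = Suc d'" using d by (cases d) auto
  have fac: "norm ((z - a k) / (1 - cnj (a k) * z)) < 1" if "k < d" "z \<in> ball 0 1" for k z
    using Moebius_function_norm_lt_1[of "a k" z 0] a[OF that(1)] that(2)
    by (simp add: Moebius_function_def)
  have "norm (B z) < 1" if z: "z \<in> ball 0 1" for z
  proof -
    have "norm (\<Prod>k<d'. (z - a k) / (1 - cnj (a k) * z)) \<le> 1"
      unfolding prod_norm[symmetric] using fac[OF _ z] d' by (intro prod_le_1) (auto intro: less_imp_le)
    then have "norm (\<Prod>k<d'. (z - a k) / (1 - cnj (a k) * z)) * norm ((z - a d') / (1 - cnj (a d') * z))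
        \<le> 1 * norm ((z - a d') / (1 - cnj (a d') * z))"
      by (intro mult_right_mono) auto
    also have "\<dots> < 1" using fac[OF _ z, of d'] d' by simp
    finally show ?thesis unfolding B'[OF z] d' prod.lessThan_Suc norm_mult norm_cis by simp
  qed
  moreover have "B holomorphic_on ball 0 1"
    using finite_blaschke_rational_inner[OF B] realizesD(1) unfolding rational_inner_def by blast
  ultimately show ?thesis by (auto simp: disc_self_map_def)
qed

section \<open>Sharpness at the origin\<close>

lemma zero_in_sym_polydisc: "sym_map n (0\<^sub>v n) \<in> sym_polydisc n"
  by (auto simp: sym_polydisc_def polydisc_def)

lemma moment_zero: "moment n (sym_map n (0\<^sub>v n)) v = dir_fps n v"
proof -
  have "esym_fps n (sym_map n (0\<^sub>v n)) = (\<Prod>i<n. 1 - fps_const ((0\<^sub>v n :: complex Matrix.vec) $ i) * fps_X)"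
    by (rule esym_fps_sym_map) simp
  then have "esym_fps n (sym_map n (0\<^sub>v n)) = 1" by simp
  then show ?thesis by (simp add: moment_def)
qed

text \<open>At the origin the functional attached to the \<open>k\<close>th coordinate direction is, up to sign, the
  coefficient of \<open>z ^ (k - 1)\<close>.\<close>

lemma pullback_metric_le_coeff:
  assumes f: "disc_self_map f" and C: "pullback_metric_le n (induced_map n f) C" and k: "1 \<le> k" "k \<le> n"
  shows "real k * (norm (coeff0 f k))\<^sup>2 \<le> C"
proof -
  define u where "u = sym_map n (0\<^sub>v n :: complex Matrix.vec)"
  define v :: "complex Matrix.vec" where "v = unit_vec n (k - 1)"
  have u: "u \<in> sym_polydisc n" unfolding u_def by (rule zero_in_sym_polydisc)
  have v: "v \<in> carrier_vec n" by (simp add: v_def)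
  have hol: "f holomorphic_on ball 0 1" using f by (simp add: disc_self_map_def)
  have \<phi>: "fps_nth (moment n u v) m = (if m = k - 1 then (-1) ^ (k - 1) else 0)" for m
    using k unfolding u_def v_def moment_zero by (auto simp: dir_fps_def)
  let ?P = "\<lambda>m. real (m + 1) * (norm (moment_functional n u v (\<lambda>z. f z ^ m * deriv f z)))\<^sup>2"
  have Lam: "moment_functional n u v H = coeff0 H (k - 1) * (-1) ^ (k - 1)" for H
  proof (rule disc_functional_moment[OF u v])
    fix A \<rho> assume "disc_functional (fps_nth (moment n u v)) A \<rho>"
    then interpret disc_functional "fps_nth (moment n u v)" A \<rho> .
    have "(\<lambda>m. coeff0 H m * fps_nth (moment n u v) m)
        = (\<lambda>m. if m = k - 1 then coeff0 H m * (-1) ^ (k - 1) else 0)"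
      unfolding \<phi> by auto
    then have "Lam H = (\<Sum>m. if m = k - 1 then coeff0 H m * (-1) ^ (k - 1) else 0)"
      by (simp only: Lam_def)
    also have "\<dots> = coeff0 H (k - 1) * (-1) ^ (k - 1)"
      using sums_single[of "k - 1" "\<lambda>m. coeff0 H m * (-1) ^ (k - 1)"] by (rule sums_unique[symmetric])
    finally show ?thesis .
  qed
  \<comment> \<open>The term m = 0 alone suffices: it contains the coefficient of z^(k-1) in f',
    that is k times coefficient k of f, while the energy of \<open>v\<close> is k.\<close>
  have "(real k * norm (coeff0 f k))\<^sup>2 = ?P 0"
    using coeff0_deriv[OF hol, of "k - 1"] k by (simp add: Lam norm_mult norm_power)
  also have "\<dots> = (\<Sum>m<1. ?P m)" by simp
  also have "\<dots> \<le> suminf ?P"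
    by (intro sum_le_suminf quadratic_forms(2)[OF f u v]) auto
  also have "\<dots> \<le> C * (\<Sum>m. real (m + 1) * (norm (fps_nth (moment n u v) m))\<^sup>2)"
    using C u v unfolding pullback_metric_le_iff[OF f] by blast
  also have "(\<lambda>m. real (m + 1) * (norm (fps_nth (moment n u v) m))\<^sup>2)
      = (\<lambda>m. if m = k - 1 then real (m + 1) else 0)"
    unfolding \<phi> by (auto simp: norm_power)
  also have "suminf \<dots> = real k"
    using sums_unique[OF sums_single[of "k - 1" "\<lambda>m. real (m + 1)"]] k by simp
  finally have "real k * (real k * (norm (coeff0 f k))\<^sup>2) \<le> real k * C"
    by (simp add: power2_eq_square mult_ac)
  then show ?thesis using k by simp
qed

lemma sharp_blaschke:
  assumes k: "1 \<le> k" "k \<le> n" "k \<le> d"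
    and C: "\<And>B. finite_blaschke d B \<Longrightarrow> pullback_metric_le n (induced_map n B) C"
  shows "real k \<le> C"
proof -
  have bound: "real k * (a\<^sup>2) ^ (d - k) \<le> C" if a: "0 \<le> a" "a < 1" for a :: real
  proof -
    define c where "c j = (if j < k then 0 else complex_of_real a)" for j
    define H where "H z = (\<Prod>j\<in>{k..<d}. (z - c j) / (1 - cnj (c j) * z))" for z
    define B where "B z = z ^ k * H z" for z
    have c: "c j \<in> ball 0 1" for j using a by (simp add: c_def)
    have nz: "1 - cnj (c j) * z \<noteq> 0" if "z \<in> ball 0 1" for j z
      using norm_mult_cnj_less_1(3)[of z "c j"] c[of j] that by auto
    have "B z = (\<Prod>j<d. (z - c j) / (1 - cnj (c j) * z))" for z
    proof -
      have "(\<Prod>j<d. (z - c j) / (1 - cnj (c j) * z))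
          = (\<Prod>j<k. (z - c j) / (1 - cnj (c j) * z)) * H z"
        unfolding H_def using prod.atLeastLessThan_concat[of 0 k d "\<lambda>j. (z - c j) / (1 - cnj (c j) * z)"] k
        by (simp add: atLeast0LessThan)
      then show ?thesis by (simp add: B_def c_def)
    qed
    then have fb: "finite_blaschke d B"
      unfolding finite_blaschke_def using c by (intro exI[of _ 0] exI[of _ c]) auto
    have "d \<ge> 1" using k by simp
    from pullback_metric_le_coeff[OF finite_blaschke_disc_self_map[OF fb this] C[OF fb] k(1,2)]
    have "real k * (norm (coeff0 B k))\<^sup>2 \<le> C" .
    moreover have "H holomorphic_on ball 0 1"
      unfolding H_def using nz by (intro holomorphic_intros)
    then have "coeff0 B k = H 0"
      using coeff0_mult_power[of H k k] by (simp add: B_def[abs_def] coeff0_higher_deriv)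
    moreover have "H 0 = (- complex_of_real a) ^ (d - k)"
      by (simp add: H_def c_def)
    ultimately show ?thesis
      using a by (simp add: norm_power power_mult[symmetric] mult.commute)
  qed
  \<comment> \<open>The parameters a = j/(j+1) tend to 1, where the lower bound tends to k.\<close>
  have "(\<lambda>j. real k * ((real j / real (Suc j))\<^sup>2) ^ (d - k)) \<longlonglongrightarrow> real k * (1\<^sup>2) ^ (d - k)"
    by (intro tendsto_intros LIMSEQ_n_over_Suc_n)
  then have "(\<lambda>j. real k * ((real j / real (Suc j))\<^sup>2) ^ (d - k)) \<longlonglongrightarrow> real k" by simp
  then show ?thesis
    by (rule LIMSEQ_le_const2) (use bound in auto)
qed

theorem corollary3p2:
  fixes n :: nat
  assumes "n \<ge> 1"
  shows
    "(\<forall>f. disc_self_map f \<longrightarrow> pullback_metric_le n (induced_map n f) (real n)) \<and>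
     (\<forall>d\<ge>1. \<forall>B. finite_blaschke d B \<longrightarrow>
        pullback_metric_le n (induced_map n B) (real (min n d))) \<and>
     (\<nexists>C::real. C < real n \<and>
        (\<forall>f. disc_self_map f \<longrightarrow> pullback_metric_le n (induced_map n f) C)) \<and>
     (\<forall>d\<ge>1. \<nexists>C::real. C < real (min n d) \<and>
        (\<forall>B. finite_blaschke d B \<longrightarrow> pullback_metric_le n (induced_map n B) C))"
proof (intro conjI allI impI notI)
  fix f assume "disc_self_map f"
  then show "pullback_metric_le n (induced_map n f) (real n)"
    by (rule pullback_metric_le_disc_self_map)
next
  fix d B assume "1 \<le> d" "finite_blaschke d B"
  then show "pullback_metric_le n (induced_map n B) (real (min n d))"
    by (intro pullback_metric_le_rational_inner finite_blaschke_disc_self_map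
        finite_blaschke_rational_inner)
next
  assume "\<exists>C<real n. \<forall>f. disc_self_map f \<longrightarrow> pullback_metric_le n (induced_map n f) C"
  then obtain C where C: "C < real n"
    "\<And>f. disc_self_map f \<Longrightarrow> pullback_metric_le n (induced_map n f) C" by blast
  \<comment> \<open>Blaschke products of degree n already exhaust the constant for general
    f.\<close>
  have "real n \<le> C"
    using assms by (intro sharp_blaschke[of n n n] C(2) finite_blaschke_disc_self_map) auto
  then show False using C(1) by simp
next
  fix d :: nat
  assume d: "1 \<le> d"
    and "\<exists>C<real (min n d). \<forall>B. finite_blaschke d B \<longrightarrow> pullback_metric_le n (induced_map n B) C"
  then obtain C where C: "C < real (min n d)"
    "\<And>B. finite_blaschke d B \<Longrightarrow> pullback_metric_le n (induced_map n B) C" by blast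
  have "real (min n d) \<le> C" using assms d by (intro sharp_blaschke[of _ n d] C(2)) auto
  then show False using C(1) by simp
qed

end
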